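(* Let $\mathcal{A}$ be a complex unital semisimple Banach algebra with $\mathrm{soc}(\mathcal{A})\neq\{0\}$, and let $f\in\mathcal{A}$. Then the following statements are equivalent: (i) $f^n\in\mathrm{soc}(\mathcal{A})$ for some $n\in\mathbb{N}$; (ii) $\sigma_{BF}(x+f)=\sigma_{BF}(x)$ for all $x\in\mathcal{A}$ commuting with $f$. Additionally, if $\mathcal{A}$ is primitive, then conditions (i) and (ii) are also equivalent to the following assertion: (iii) $\sigma_{BW}(x+f)=\sigma_{BW}(x)$ for all $x\in\mathcal{A}$ commuting with $f$.
   Context: Semisimple means the Jacobson radical is $\{0\}$; primitive means possessing a faithful irreducible representation (this implies semisimple). $\mathrm{soc}(\mathcal{A})$ is the sum of all minimal right ideals of $\mathcal{A}$ (equal to the sum of all minimal left ideals), or $\{0\}$ if there are none. An element $a$ of a ring is Drazin invertible if there are $b$ in the ring (the Drazin inverse, which is unique) and $k\in\mathbb{N}$ with $bab=b$, $ab=ba$, $a^kba=a^k$. Let $\pi:\mathcal{A}\to\mathcal{A}/\mathrm{soc}(\mathcal{A})$ be the canonical homomorphism; $a\in\mathcal{A}$ is B-Fredholm if $\pi(a)$ is Drazin invertible. For $a\in\mathrm{soc}(\mathcal{A})$ the trace is $\tau(a)=\sum_{\lambda\in\sigma(a)}\lambda\,m(\lambda,a)$, where $m(\lambda,a)$ is the algebraic multiplicity of $\lambda$ for $a$ in the sense of Aupetit and Mouton; for nonzero $\lambda\in\sigma(a)$ (there are finitely many) it is the rank of the Riesz (spectral) idempotent $p$ of $a$ at $\lambda$,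 which lies in $\mathrm{soc}(\mathcal{A})$, i.e. the smallest number of minimal right ideals of $\mathcal{A}$ whose sum is $p\mathcal{A}$. The index of a B-Fredholm element $a$ is $\mathrm{i}(a)=\tau(aa_0-a_0a)$, where $a_0\in\mathcal{A}$ is any element such that $\pi(a_0)$ is the Drazin inverse of $\pi(a)$ (independent of the choice of $a_0$). An element is B-Weyl if it is B-Fredholm of index zero. $\sigma_{BF}(a)=\{\lambda\in\mathbb{C}:a-\lambda 1\text{ is not B-Fredholm}\}$ and $\sigma_{BW}(a)=\{\lambda\in\mathbb{C}:a-\lambda 1\text{ is not B-Weyl}\}$. *)

theory Defs
  imports "HOL-Algebra.Algebraic_Closure_Type" "HOL-Analysis.Analysis"
begin

class complex_vector = real_vector +
  fixes scaleC :: "complex \<Rightarrow> 'a \<Rightarrow> 'a" (infixr \<open>*\<^sub>C\<close> 75)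
  assumes scaleC_add_right: "c *\<^sub>C (x + y) = c *\<^sub>C x + c *\<^sub>C y"
    and scaleC_add_left: "(c + d) *\<^sub>C x = c *\<^sub>C x + d *\<^sub>C x"
    and scaleC_scaleC: "c *\<^sub>C d *\<^sub>C x = (c * d) *\<^sub>C x"
    and scaleC_one: "1 *\<^sub>C x = x"
    and scaleR_scaleC: "r *\<^sub>R x = complex_of_real r *\<^sub>C x"

class complex_banach_algebra_1 = complex_vector + real_normed_algebra_1 + banach +
  assumes mult_scaleC_left: "(c *\<^sub>C x) * y = c *\<^sub>C (x * y)"
    and mult_scaleC_right: "x * (c *\<^sub>C y) = c *\<^sub>C (x * y)"
    and norm_scaleC: "norm (c *\<^sub>C x) = cmod c * norm x"


subsection \<open>Ideals, Jacobson radical, socle\<close>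

(* One-sided ideals are purely ring theoretic here; as there is a unit, they are
   automatically complex subspaces: c *\<^sub>C x = (c *\<^sub>C 1) * x = x * (c *\<^sub>C 1). *)

definition left_ideal :: "'a::ring_1 set \<Rightarrow> bool" where
  "left_ideal I \<longleftrightarrow>
     0 \<in> I \<and> (\<forall>x\<in>I. \<forall>y\<in>I. x + y \<in> I) \<and> (\<forall>a. \<forall>x\<in>I. a * x \<in> I)"

definition right_ideal :: "'a::ring_1 set \<Rightarrow> bool" where
  "right_ideal I \<longleftrightarrow>
     0 \<in> I \<and> (\<forall>x\<in>I. \<forall>y\<in>I. x + y \<in> I) \<and> (\<forall>a. \<forall>x\<in>I. x * a \<in> I)"

definition maximal_left_ideal :: "'a::ring_1 set \<Rightarrow> bool" where
  "maximal_left_ideal M \<longleftrightarrow>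
     left_ideal M \<and> M \<noteq> UNIV \<and> (\<forall>I. left_ideal I \<and> M \<subseteq> I \<longrightarrow> I = M \<or> I = UNIV)"

definition minimal_right_ideal :: "'a::ring_1 set \<Rightarrow> bool" where
  "minimal_right_ideal R \<longleftrightarrow>
     right_ideal R \<and> R \<noteq> {0} \<and> (\<forall>I. right_ideal I \<and> I \<subseteq> R \<longrightarrow> I = {0} \<or> I = R)"

definition jacobson_radical :: "'a::ring_1 set" where
  "jacobson_radical = \<Inter>{M. maximal_left_ideal M}"

(* The sum of a (possibly infinite) family of ideals: all finite sums of their elements.
   The sum of the empty family is {0}. *)
definition ideal_sum :: "'a::ring_1 set set \<Rightarrow> 'a set" where
  "ideal_sum F = {sum_list xs | xs. set xs \<subseteq> \<Union>F}"

definition socle :: "'a::ring_1 set" where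
  "socle = ideal_sum {R. minimal_right_ideal R}"


subsection \<open>Primitive algebras\<close>

definition csubspace :: "'v::complex_vector set \<Rightarrow> bool" where
  "csubspace V \<longleftrightarrow>
     0 \<in> V \<and> (\<forall>x\<in>V. \<forall>y\<in>V. x + y \<in> V) \<and> (\<forall>c. \<forall>x\<in>V. c *\<^sub>C x \<in> V)"

(* Unital algebra homomorphisms from 'a to the linear operators on the vector space V;
   the values of \<rho> a outside V are irrelevant. *)
definition representation ::
    "'v::complex_vector set \<Rightarrow> ('a::complex_banach_algebra_1 \<Rightarrow> 'v \<Rightarrow> 'v) \<Rightarrow> bool" where
  "representation V \<rho> \<longleftrightarrow> csubspace V \<and>
     (\<forall>a. \<forall>x\<in>V. \<rho> a x \<in> V) \<and>
     (\<forall>a. \<forall>x\<in>V. \<forall>y\<in>V. \<rho> a (x + y) = \<rho> a x + \<rho> a y) \<and>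
     (\<forall>a c. \<forall>x\<in>V. \<rho> a (c *\<^sub>C x) = c *\<^sub>C \<rho> a x) \<and>
     (\<forall>a b. \<forall>x\<in>V. \<rho> (a + b) x = \<rho> a x + \<rho> b x) \<and>
     (\<forall>a c. \<forall>x\<in>V. \<rho> (c *\<^sub>C a) x = c *\<^sub>C \<rho> a x) \<and>
     (\<forall>a b. \<forall>x\<in>V. \<rho> (a * b) x = \<rho> a (\<rho> b x)) \<and>
     (\<forall>x\<in>V. \<rho> 1 x = x)"

definition irreducible_representation ::
    "'v::complex_vector set \<Rightarrow> ('a::complex_banach_algebra_1 \<Rightarrow> 'v \<Rightarrow> 'v) \<Rightarrow> bool" where
  "irreducible_representation V \<rho> \<longleftrightarrow> representation V \<rho> \<and> V \<noteq> {0} \<and>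
     (\<forall>W. csubspace W \<and> W \<subseteq> V \<and> (\<forall>a. \<forall>y\<in>W. \<rho> a y \<in> W) \<longrightarrow> W = {0} \<or> W = V)"

definition faithful_on :: "'v set \<Rightarrow> ('a::zero \<Rightarrow> 'v::zero \<Rightarrow> 'v) \<Rightarrow> bool" where
  "faithful_on V \<rho> \<longleftrightarrow> (\<forall>a. (\<forall>x\<in>V. \<rho> a x = 0) \<longrightarrow> a = 0)"

(* HOL cannot quantify existentially over the type 'v containing the representation space.
   As a hypothesis with 'v a type variable of the theorem, the predicate says the same
   as the existence of a faithful irreducible representation on any vector space. *)
definition primitive_algebra ::
    "'a::complex_banach_algebra_1 itself \<Rightarrow> 'v::complex_vector itself \<Rightarrow> bool" where
  "primitive_algebra _ _ \<longleftrightarrow>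
     (\<exists>(V :: 'v set) (\<rho> :: 'a \<Rightarrow> 'v \<Rightarrow> 'v). irreducible_representation V \<rho> \<and> faithful_on V \<rho>)"


subsection \<open>B-Fredholm elements\<close>

definition drazin_inverse :: "('r, 'm) ring_scheme \<Rightarrow> 'r \<Rightarrow> 'r \<Rightarrow> bool" where
  "drazin_inverse R a b \<longleftrightarrow> a \<in> carrier R \<and> b \<in> carrier R \<and>
     b \<otimes>\<^bsub>R\<^esub> a \<otimes>\<^bsub>R\<^esub> b = b \<and> a \<otimes>\<^bsub>R\<^esub> b = b \<otimes>\<^bsub>R\<^esub> a \<and>
     (\<exists>k::nat. a [^]\<^bsub>R\<^esub> k \<otimes>\<^bsub>R\<^esub> b \<otimes>\<^bsub>R\<^esub> a = a [^]\<^bsub>R\<^esub> k)"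

definition quot_socle :: "'a::ring_1 set ring" where
  "quot_socle = ring_of_type_algebra Quot socle"

definition quot_map :: "'a::ring_1 \<Rightarrow> 'a set" where
  "quot_map a = socle +>\<^bsub>ring_of_type_algebra\<^esub> a"

definition b_fredholm :: "'a::ring_1 \<Rightarrow> bool" where
  "b_fredholm a \<longleftrightarrow> (\<exists>b. drazin_inverse quot_socle (quot_map a) b)"


subsection \<open>Trace and index\<close>

definition spectrum :: "'a::complex_banach_algebra_1 \<Rightarrow> complex set" where
  "spectrum a = {\<mu>. \<mu> *\<^sub>C 1 - a \<notin> Units ring_of_type_algebra}"

(* The Cauchy integral of the resolvent over a positively oriented circle \<Gamma> about \<mu>, on and
   inside which there is no further point of the spectrum, parametrised by
   \<Gamma> \<theta> = \<mu> + r * cis \<theta>. Only meaningful if \<mu> is isolated in the spectrum. *)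
definition riesz_idempotent :: "'a::complex_banach_algebra_1 \<Rightarrow> complex \<Rightarrow> 'a" where
  "riesz_idempotent a \<mu> =
     (let r = (SOME r::real. 0 < r \<and> cball \<mu> r \<inter> spectrum a \<subseteq> {\<mu>})
      in (1 / (2 * complex_of_real pi * \<i>)) *\<^sub>C
           integral {0..2 * pi} (\<lambda>\<theta>. (\<i> * complex_of_real r * cis \<theta>) *\<^sub>C
             inv\<^bsub>ring_of_type_algebra\<^esub> ((\<mu> + complex_of_real r * cis \<theta>) *\<^sub>C 1 - a)))"

definition idempotent_rank :: "'a::ring_1 \<Rightarrow> nat" where
  "idempotent_rank p =
     (LEAST n. \<exists>F. finite F \<and> card F = n \<and> (\<forall>R\<in>F. minimal_right_ideal R) \<and>
                   ideal_sum F = range (\<lambda>x. p * x))"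

(* For \<mu> = 0 this need not be the algebraic multiplicity, which is irrelevant for the trace. *)
definition alg_multiplicity :: "complex \<Rightarrow> 'a::complex_banach_algebra_1 \<Rightarrow> nat" where
  "alg_multiplicity \<mu> a = idempotent_rank (riesz_idempotent a \<mu>)"

(* Used for a in the socle only, where the spectrum is finite if the algebra is semisimple. *)
definition soc_trace :: "'a::complex_banach_algebra_1 \<Rightarrow> complex" where
  "soc_trace a = (\<Sum>\<mu>\<in>spectrum a. \<mu> * of_nat (alg_multiplicity \<mu> a))"

definition b_index :: "'a::complex_banach_algebra_1 \<Rightarrow> complex" where
  "b_index a =
     (let a\<^sub>0 = (SOME a\<^sub>0. drazin_inverse quot_socle (quot_map a) (quot_map a\<^sub>0))
      in soc_trace (a * a\<^sub>0 - a\<^sub>0 * a))"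

definition b_weyl :: "'a::complex_banach_algebra_1 \<Rightarrow> bool" where
  "b_weyl a \<longleftrightarrow> b_fredholm a \<and> b_index a = 0"

definition bf_spectrum :: "'a::complex_banach_algebra_1 \<Rightarrow> complex set" where
  "bf_spectrum a = {\<mu>. \<not> b_fredholm (a - \<mu> *\<^sub>C 1)}"

definition bw_spectrum :: "'a::complex_banach_algebra_1 \<Rightarrow> complex set" where
  "bw_spectrum a = {\<mu>. \<not> b_weyl (a - \<mu> *\<^sub>C 1)}"

end

theory Submission
  imports Defs "HOL-Complex_Analysis.Cauchy_Integral_Formula"
begin

text \<open>Everything is read off the quotient \<open>A/soc\<close>, in which B-Fredholm means Drazin invertible.

If \<open>f ^ n\<close> lies in the socle, the class of \<open>f\<close> is nilpotent, and a commuting nilpotent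
perturbation changes neither Drazin invertibility (\<open>drazin_add_nilpotent\<close>) nor the index
(\<open>comm_tr_drazin_add_nilpotent\<close>).

For the converse the perturbation \<open>x = 0\<close> already shows that \<open>f - \<mu>\<close> is B-Fredholm for
every \<open>\<mu>\<close>. Such an element is algebraic: its spectrum modulo the socle is discrete, hence
finite, and a Liouville argument (\<open>resolvent_everywhere_imp_null\<close>) shows that nothing else is
left (\<open>polynomial_in_socle_if_all_drazin\<close>); moreover elements of the socle are algebraic
themselves. If no power of \<open>f\<close> lies in the socle, the minimal polynomial \<open>q\<close> of \<open>f\<close> modulo
the socle has a root \<open>l \<noteq> 0\<close>; write \<open>q = (X - l) r\<close>, so that \<open>u = r(f)\<close> is outside the socle
and \<open>s = q(f)\<close> is inside. For \<open>a\<close> with \<open>a s = s a = 0\<close>, the divided difference of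
\<open>q\<close> produces an element \<open>E\<close> that commutes with \<open>f\<close> and satisfies \<open>E u = u a u\<close>. The
hypothesis is used for \<open>x = f E + k f\<close> with \<open>k = 0, 1, 2, \<dots>\<close>: it makes the B-Fredholm
property of \<open>f E - \<mu>\<close> equivalent to that of \<open>f (E + k) - \<mu>\<close>, and for large \<open>k\<close>
the latter element is Drazin invertible in the algebra itself, because \<open>f\<close> is. Thus
\<open>f E\<close> is algebraic, and so is \<open>f a u\<close>. As \<open>a\<close> varies this gives a principal left ideal of
algebraic elements. Such an ideal lies in the socle (\<open>in_socle_if_left_multiples_drazin\<close>), since
otherwise it contains infinitely many orthogonal idempotents \<open>e\<^sub>i\<close> and with them an element
\<open>\<Sum>c\<^sub>i e\<^sub>i\<close> having infinitely many eigenvalues that tend to \<open>0\<close>. It follows that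
\<open>u\<close> is in the socle, a contradiction.

This argument applies to every property that implies B-Fredholm and is shared by all Drazin
invertible elements of the algebra, so it also covers B-Weyl elements once the index is understood.
In a primitive algebra the socle acts by operators of finite rank on the left ideal \<open>A e\<close> of a
minimal idempotent, which yields a linear trace vanishing on commutators
(\<open>socle_trace_exists\<close>); it agrees with the spectrally defined one (\<open>soc_trace_eq_tr\<close>).
The index is then a value of the pairing \<open>(x, y) \<mapsto> tr (x y - y x)\<close> on commuting elements of
\<open>A/soc\<close>. The cyclic identity \<open>[xy, z] = [x, yz] + [y, zx]\<close> forces this pairing to vanish on
idempotents and to turn products into sums, from which its invariance under nilpotent
perturbations follows by a short computation.\<close>

section \<open>Drazin inverses in rings\<close>

definition drazin :: "'r::{ring,monoid_mult} \<Rightarrow> 'r \<Rightarrow> bool" where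
  "drazin a b \<longleftrightarrow> b * a * b = b \<and> a * b = b * a \<and> (\<exists>k. a ^ k * b * a = a ^ k)"

lemma power_commute:
  fixes x y :: "'r::monoid_mult"
  assumes "x * y = y * x"
  shows "x ^ n * y = y * x ^ n"
  using assms by (rule power_commuting_commutes)

lemma power_mult_commute:
  fixes x y :: "'r::monoid_mult"
  assumes "x * y = y * x"
  shows "(x * y) ^ n = x ^ n * y ^ n"
proof (induction n)
  case (Suc n)
  have "(x * y) ^ Suc n = x * y * (x ^ n * y ^ n)" by (simp add: Suc)
  also have "\<dots> = x * (y * x ^ n) * y ^ n" by (simp add: mult.assoc)
  also have "y * x ^ n = x ^ n * y" using assms power_commute by metis
  finally show ?case by (simp add: mult.assoc)
qed simp

lemma power_minus_cases:
  fixes x :: "'r::{ring,monoid_mult}"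
  shows "(- x) ^ n = x ^ n \<or> (- x) ^ n = - (x ^ n)"
  by (induction n) auto

lemma commute_mult:
  fixes x y z :: "'r::semigroup_mult"
  assumes "x * y = y * x" "x * z = z * x"
  shows "x * (y * z) = y * z * x"
  using assms by (metis mult.assoc)

lemma idempotent_complement:
  fixes e :: "'r::{ring,monoid_mult}"
  shows "e * e = e \<Longrightarrow> (1 - e) * (1 - e) = 1 - e"
  by (simp add: ring_distribs)

lemma drazinI:
  fixes a c :: "'r::{ring,monoid_mult}"
  assumes comm: "a * c = c * a" and step: "a ^ Suc m * c = a ^ m"
  shows "drazin a (a ^ m * c ^ Suc m)"
proof -
  have aux: "a ^ (m + j) * c ^ j = a ^ m" for j
  proof (induction j)
    case (Suc j)
    have "a ^ (m + Suc j) * c ^ Suc j = a ^ (j + Suc m) * (c * c ^ j)" by (simp add: add.commute)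
    also have "\<dots> = a ^ j * (a ^ Suc m * c) * c ^ j" by (simp only: power_add mult.assoc)
    also have "\<dots> = a ^ (j + m) * c ^ j" by (simp only: step power_add)
    also have "\<dots> = a ^ (m + j) * c ^ j" by (simp only: add.commute)
    finally show ?case using Suc by simp
  qed simp
  have c1: "c ^ i * a ^ j = a ^ j * c ^ i" for i j
    using comm by (metis power_commute)
  have c2: "c ^ i * a = a * c ^ i" for i
    using c1[of i 1] by simp
  have ab: "a * (a ^ m * c ^ Suc m) = a ^ Suc m * c ^ Suc m" by (simp add: mult.assoc)
  have ba: "a ^ m * c ^ Suc m * a = a ^ Suc m * c ^ Suc m"
    by (metis c2 mult.assoc power_Suc2)
  have k: "a ^ m * (a ^ m * c ^ Suc m) * a = a ^ m"
    using aux[of "Suc m"] ba by (metis add_Suc_right mult.assoc power_add)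
  have "a ^ m * c ^ Suc m * a * (a ^ m * c ^ Suc m) = (a ^ Suc m * c ^ Suc m) * (a ^ m * c ^ Suc m)"
    by (simp only: ba)
  also have "\<dots> = a ^ Suc m * (c ^ Suc m * a ^ m) * c ^ Suc m"
    by (simp only: mult.assoc)
  also have "\<dots> = a ^ Suc m * a ^ m * c ^ Suc m * c ^ Suc m"
    by (simp only: c1 mult.assoc)
  also have "\<dots> = a ^ (m + Suc m) * c ^ Suc m * c ^ Suc m"
    by (metis add.commute power_add)
  also have "\<dots> = a ^ m * c ^ Suc m" by (simp only: aux)
  finally show ?thesis unfolding drazin_def using ab ba k by metis
qed

lemma drazin_idempotent:
  assumes "drazin a b" shows "(a * b) * (a * b) = a * b"
  using assms unfolding drazin_def by (metis mult.assoc)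

lemma drazin_absorb:
  assumes "drazin a b" shows "(a * b) * b = b" "b * (a * b) = b"
  using assms unfolding drazin_def by (metis mult.assoc)+

lemma drazin_power_absorb:
  assumes "drazin a b"
  obtains k where "a ^ k * (a * b) = a ^ k"
  using assms unfolding drazin_def by (metis mult.assoc)

lemma drazin_support_power:
  fixes a b :: "'r::{ring,monoid_mult}"
  assumes "drazin a b" and "0 < k"
  shows "a * b = a ^ k * b ^ k"
proof -
  have "(a * b) ^ k = a * b" using assms(2)
  proof (induction k)
    case (Suc k)
    then show ?case using drazin_idempotent[OF assms(1)] by (cases k) auto
  qed simp
  moreover have "a * b = b * a" using assms(1) by (simp add: drazin_def)
  ultimately show ?thesis by (metis power_mult_commute)
qed

lemma drazin_power_absorb_pos:
  fixes a b :: "'r::{ring,monoid_mult}"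
  assumes "drazin a b"
  obtains k where "0 < k" "a ^ k * (a * b) = a ^ k"
proof -
  obtain k where k: "a ^ k * (a * b) = a ^ k" using drazin_power_absorb[OF assms] .
  have "a ^ Suc k * (a * b) = a ^ Suc k" using k by (simp add: mult.assoc)
  then show ?thesis using that by blast
qed

text \<open>With \<open>e = a b\<close>, a power of \<open>a\<close> is invertible on the range of \<open>e\<close> and zero on the
complement. Whatever commutes with \<open>a\<close> therefore respects the decomposition and commutes with
\<open>e\<close>, hence with the inverse of \<open>a\<close> on the range of \<open>e\<close>.\<close>

lemma drazin_commute:
  fixes a b z :: "'r::{ring,monoid_mult}"
  assumes d: "drazin a b" and z: "a * z = z * a"
  shows "b * z = z * b"
proof -
  define e where "e = a * b"
  have ab: "a * b = b * a" using d by (simp add: drazin_def)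
  obtain k where k0: "0 < k" and k: "a ^ k * e = a ^ k"
    using drazin_power_absorb_pos[OF d] e_def by metis
  have e1: "e = a ^ k * b ^ k" unfolding e_def by (rule drazin_support_power[OF d k0])
  have e2: "e = b ^ k * a ^ k" using e1 ab by (metis power_commute)
  have ak: "a ^ k * z = z * a ^ k" using z by (rule power_commute)
  have ek: "e * a ^ k = a ^ k"
    using k ab by (metis e_def mult.assoc power_commutes power_commute)
  have "e * z * e = e * z"
  proof -
    have "e * z * e = b ^ k * (a ^ k * z) * e" by (simp add: e2 mult.assoc)
    also have "\<dots> = b ^ k * z * (a ^ k * e)" by (simp add: ak mult.assoc)
    also have "\<dots> = b ^ k * (a ^ k * z)" by (simp add: k ak mult.assoc)
    finally show ?thesis by (simp add: e2 mult.assoc)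
  qed
  moreover have "e * z * e = z * e"
  proof -
    have "e * z * e = e * (z * a ^ k) * b ^ k" by (simp add: e1 mult.assoc)
    also have "\<dots> = (e * a ^ k) * z * b ^ k" by (simp only: ak[symmetric] mult.assoc)
    also have "\<dots> = z * (a ^ k * b ^ k)" by (simp only: ek ak mult.assoc)
    also have "\<dots> = z * e" by (simp only: e1)
    finally show ?thesis .
  qed
  ultimately have ez: "e * z = z * e" by simp
  have be: "b * e = b" "e * b = b" using drazin_absorb[OF d] by (simp_all add: e_def)
  have "b * z = b * (e * z)" using be by (metis mult.assoc)
  also have "\<dots> = b * (z * e)" by (simp only: ez)
  also have "\<dots> = b * z * (a * b)" by (simp only: e_def mult.assoc)
  also have "\<dots> = b * a * z * b" by (metis z mult.assoc)
  also have "\<dots> = z * b" using ez be ab by (metis e_def mult.assoc)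
  finally show ?thesis .
qed

lemma drazin_unique:
  fixes a b b' :: "'r::{ring,monoid_mult}"
  assumes d: "drazin a b" and d': "drazin a b'"
  shows "b = b'"
proof -
  have c: "a * b = b * a" "a * b' = b' * a" using d d' by (auto simp: drazin_def)
  have bb: "b * b' = b' * b" using drazin_commute[OF d] c by metis
  have half: "(a * y) * (a * x) = a * x"
    if x: "drazin a x" and y: "drazin a y" and xy: "x * y = y * x" for x y
  proof -
    obtain k where k0: "0 < k" and k: "a ^ k * (a * y) = a ^ k"
      using drazin_power_absorb_pos[OF y] .
    have cy: "a * y = y * a" using y by (auto simp: drazin_def)
    have "(a * y) * a ^ k = a ^ k" using k cy by (metis mult.assoc power_commutes power_commute)
    then show ?thesis using drazin_support_power[OF x k0] by (metis mult.assoc)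
  qed
  have e: "(a * b') * (a * b) = a * b" "(a * b) * (a * b') = a * b'"
    using half[OF d d'] half[OF d' d] bb by auto
  have "(a * b') * (a * b) = (a * b) * (a * b')"
    using c bb by (metis mult.assoc)
  then have ee: "a * b = a * b'" using e by simp
  have "b = b * (a * b)" using drazin_absorb[OF d] by simp
  also have "\<dots> = b * a * b'" by (simp add: ee mult.assoc)
  also have "\<dots> = (a * b') * b'" using c(1) ee by simp
  also have "\<dots> = b'" using drazin_absorb[OF d'] by simp
  finally show ?thesis .
qed

lemma drazin_inverse_unit:
  fixes a g :: "'r::{ring,monoid_mult}"
  assumes "a * g = 1" "g * a = 1"
  shows "drazin a g"
  using assms unfolding drazin_def by (auto intro: exI[of _ 0])

lemma geometric_telescope:
  fixes x :: "'r::{ring,monoid_mult}"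
  shows "(1 - x) * (\<Sum>i<n. x ^ i) = 1 - x ^ n"
proof (induction n)
  case (Suc n)
  have "(1 - x) * (\<Sum>i<Suc n. x ^ i) = (1 - x) * (\<Sum>i<n. x ^ i) + (1 - x) * x ^ n"
    by (simp add: distrib_left)
  also have "\<dots> = 1 - x ^ n + (1 - x) * x ^ n" by (simp only: Suc)
  finally show ?case by (simp add: left_diff_distrib)
qed simp

text \<open>Nilpotency of a sum of commuting nilpotent elements, localised at an element \<open>z\<close> so that it also
applies to corners.\<close>

lemma commuting_sum_power_annihilates:
  fixes x y z :: "'r::{ring,monoid_mult}"
  assumes "x * y = y * x" "x ^ k * z = 0" "y ^ n * z = 0"
  shows "(x + y) ^ (k + n) * z = 0"
  using assms(2,3)
proof (induction "k + n" arbitrary: k n z)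
  case 0
  then show ?case by simp
next
  case (Suc m)
  show ?case
  proof (cases "k = 0 \<or> n = 0")
    case True
    then have "z = 0" using Suc by auto
    then show ?thesis by simp
  next
    case False
    then obtain k' n' where kn: "k = Suc k'" "n = Suc n'" using not0_implies_Suc by blast
    have px: "y ^ n * x = x * y ^ n" using assms(1) by (metis power_commute)
    have py: "x ^ k * y = y * x ^ k" using assms(1) by (metis power_commute)
    have 1: "(x + y) ^ m * (x * z) = 0"
    proof -
      have "x ^ k' * (x * z) = 0" using Suc(3) kn by (simp add: power_commutes mult.assoc flip: mult.assoc)
      moreover have "y ^ n * (x * z) = 0" using Suc(4) px by (metis mult.assoc mult_zero_right)
      moreover have "m = k' + n" using Suc(2) kn by simp
      ultimately show ?thesis using Suc(1) by metis
    qed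
    have 2: "(x + y) ^ m * (y * z) = 0"
    proof -
      have "y ^ n' * (y * z) = 0" using Suc(4) kn by (simp add: power_commutes mult.assoc flip: mult.assoc)
      moreover have "x ^ k * (y * z) = 0" using Suc(3) py by (metis mult.assoc mult_zero_right)
      moreover have "m = k + n'" using Suc(2) kn by simp
      ultimately show ?thesis using Suc(1) by metis
    qed
    have "(x + y) ^ (k + n) * z = (x + y) ^ m * ((x + y) * z)"
      using Suc(2) by (metis mult.assoc power_Suc2)
    also have "\<dots> = 0" using 1 2 by (simp add: distrib_right distrib_left)
    finally show ?thesis .
  qed
qed

definition neumann_sum :: "nat \<Rightarrow> 'r::{ring,monoid_mult} \<Rightarrow> 'r" where
  "neumann_sum n u = (\<Sum>i<n. (- u) ^ i)"

lemma neumann_sum_commute: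
  fixes x y :: "'r::{ring,monoid_mult}"
  assumes "x * y = y * x"
  shows "neumann_sum n x * y = y * neumann_sum n x"
  unfolding neumann_sum_def sum_distrib_left sum_distrib_right
  by (rule sum.cong) (use assms in \<open>auto intro!: power_commute\<close>)

lemma neumann_sum_inverse:
  fixes u :: "'r::{ring,monoid_mult}"
  assumes "u ^ n = 0"
  shows "(1 + u) * neumann_sum n u = 1" "neumann_sum n u * (1 + u) = 1"
proof -
  have "(- u) ^ n = 0" using power_minus_cases[of u n] assms by auto
  then show 1: "(1 + u) * neumann_sum n u = 1"
    using geometric_telescope[of "- u" n] by (simp add: neumann_sum_def)
  show "neumann_sum n u * (1 + u) = 1"
    using 1 neumann_sum_commute[of u "1 + u" n] by (simp add: algebra_simps)
qed

text \<open>On the range of \<open>e = a b\<close> the sum \<open>a + f\<close> equals \<open>a (1 + f b)\<close> with \<open>f b\<close>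
nilpotent; on the complement it is a sum of two commuting nilpotent elements. The explicit form
of the Drazin inverse serves the computation of the index.\<close>

lemma drazin_add_nilpotent:
  fixes a b f :: "'r::{ring,monoid_mult}"
  assumes d: "drazin a b" and af: "a * f = f * a" and f: "f ^ n = 0"
  shows "drazin (a + f) (b * neumann_sum n (f * b))"
proof -
  define u where "u = f * b"
  define w where "w = neumann_sum n u"
  define e where "e = a * b"
  have ab: "a * b = b * a" using d by (simp add: drazin_def)
  have bf: "b * f = f * b" using drazin_commute[OF d af] .
  have un: "u ^ n = 0" unfolding u_def using power_mult_commute[of f b n] bf f by simp
  have ww: "(1 + u) * w = 1" "w * (1 + u) = 1"
    unfolding w_def using neumann_sum_inverse[OF un] by auto
  have ua: "u * a = a * u" and ub: "u * b = b * u" and uf: "u * f = f * u"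
    unfolding u_def using ab bf af by (metis mult.assoc)+
  have wa: "w * a = a * w" and wb: "w * b = b * w" and wf: "w * f = f * w"
    unfolding w_def using neumann_sum_commute ua ub uf by blast+
  have eb: "e * b = b" "b * e = b" using drazin_absorb[OF d] by (simp_all add: e_def)
  have ef: "e * f = f * e" unfolding e_def using af bf by (metis mult.assoc)
  have eu: "e * u = u" unfolding u_def using ef eb by (metis mult.assoc)
  have prod: "(a + f) * (b * w) = e"
  proof -
    have "(a + f) * (b * w) = (e + u) * w" by (simp add: e_def u_def algebra_simps)
    also have "\<dots> = e * ((1 + u) * w)" using eu by (simp add: algebra_simps flip: mult.assoc)
    finally show ?thesis using ww by simp
  qed
  have comm: "(b * w) * (a + f) = (a + f) * (b * w)"
    using ab bf wa wf by (simp add: ring_distribs) (metis mult.assoc)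
  have sandwich: "b * w * (a + f) * (b * w) = b * w"
  proof -
    have "b * w * (a + f) * (b * w) = e * (b * w)" using comm prod by simp
    then show ?thesis using eb by (simp flip: mult.assoc)
  qed
  obtain k where k: "a ^ k * e = a ^ k" using drazin_power_absorb[OF d] e_def by metis
  have "(a + f) ^ (k + n) * (1 - e) = 0"
    by (rule commuting_sum_power_annihilates[OF af]) (simp_all add: k f algebra_simps)
  then have "(a + f) ^ (k + n) * ((b * w) * (a + f)) = (a + f) ^ (k + n)"
    unfolding comm prod by (simp add: right_diff_distrib)
  then have "(a + f) ^ (k + n) * (b * w) * (a + f) = (a + f) ^ (k + n)"
    by (simp only: mult.assoc)
  then show ?thesis unfolding drazin_def using comm sandwich by (metis u_def w_def)
qed

section \<open>The quotient by the socle\<close>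

lemma right_ideal_neg:
  assumes "right_ideal (R :: 'a::ring_1 set)" "x \<in> R" shows "- x \<in> R"
  using assms unfolding right_ideal_def by (metis mult_1_right mult_minus_right)

lemma right_ideal_image_mult:
  assumes "right_ideal (R :: 'a::ring_1 set)"
  shows "right_ideal ((*) a ` R)"
  unfolding right_ideal_def
proof (intro conjI allI ballI)
  show "0 \<in> (*) a ` R" using assms unfolding right_ideal_def by (metis image_eqI mult_zero_right)
next
  fix x y assume "x \<in> (*) a ` R" "y \<in> (*) a ` R"
  then show "x + y \<in> (*) a ` R"
    using assms unfolding right_ideal_def by (auto simp: distrib_left[symmetric])
next
  fix b x assume "x \<in> (*) a ` R"
  then show "x * b \<in> (*) a ` R"
    using assms unfolding right_ideal_def by (auto simp: mult.assoc)
qed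

text \<open>Left multiplication is a homomorphism of right modules, so by Schur's argument it kills a
simple submodule or maps it onto a simple one. This makes the socle a two-sided ideal.\<close>

lemma minimal_right_ideal_image_mult:
  assumes R: "minimal_right_ideal (R :: 'a::ring_1 set)"
  shows "(*) a ` R = {0} \<or> minimal_right_ideal ((*) a ` R)"
proof (cases "(*) a ` R = {0}")
  case False
  have rR: "right_ideal R" using R by (simp add: minimal_right_ideal_def)
  have "I = {0} \<or> I = (*) a ` R" if I: "right_ideal I" "I \<subseteq> (*) a ` R" for I
  proof -
    define K where "K = {x \<in> R. a * x \<in> I}"
    have "right_ideal K"
      using rR I unfolding K_def right_ideal_def
      by (auto simp: distrib_left simp flip: mult.assoc)
    then have "K = {0} \<or> K = R"
      using R unfolding minimal_right_ideal_def K_def by blast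
    moreover have "I = (*) a ` K" using I(2) unfolding K_def by auto
    ultimately show ?thesis by auto
  qed
  then show ?thesis
    using False right_ideal_image_mult[OF rR] by (auto simp: minimal_right_ideal_def)
qed simp

lemma ideal_sum_add: "x \<in> ideal_sum F \<Longrightarrow> y \<in> ideal_sum F \<Longrightarrow> x + y \<in> ideal_sum F"
  unfolding ideal_sum_def
  by (clarsimp) (metis le_sup_iff set_append sum_list_append)

lemma ideal_sum_incl: "R \<in> F \<Longrightarrow> x \<in> R \<Longrightarrow> x \<in> ideal_sum F"
  unfolding ideal_sum_def by (auto intro!: exI[of _ "[x]"])

lemma ideal_sum_zero: "0 \<in> ideal_sum F"
  unfolding ideal_sum_def by (auto intro!: exI[of _ "[]"])

lemma ideal_sum_mono: "F \<subseteq> G \<Longrightarrow> ideal_sum F \<subseteq> ideal_sum G"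
  unfolding ideal_sum_def by blast

lemma ideal_sum_induct [consumes 1, case_names zero add]:
  assumes "x \<in> ideal_sum F" "P 0"
    and "\<And>R r y. R \<in> F \<Longrightarrow> r \<in> R \<Longrightarrow> y \<in> ideal_sum F \<Longrightarrow> P y \<Longrightarrow> P (r + y)"
  shows "P x"
proof -
  obtain xs where xs: "x = sum_list xs" "set xs \<subseteq> \<Union>F" using assms(1) unfolding ideal_sum_def by auto
  have "set xs \<subseteq> \<Union>F \<Longrightarrow> P (sum_list xs) \<and> sum_list xs \<in> ideal_sum F"
  proof (induction xs)
    case Nil
    then show ?case using assms(2) ideal_sum_zero by simp
  next
    case (Cons r ys)
    then obtain R where R: "R \<in> F" "r \<in> R" by auto
    with Cons show ?case using assms(3)[OF R] ideal_sum_add[OF ideal_sum_incl[OF R]] by auto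
  qed
  then show ?thesis using xs by simp
qed

lemma socle_zero [simp]: "0 \<in> (socle :: 'a::ring_1 set)"
  unfolding socle_def by (rule ideal_sum_zero)

lemma socle_add: "x \<in> socle \<Longrightarrow> y \<in> socle \<Longrightarrow> x + y \<in> (socle :: 'a::ring_1 set)"
  unfolding socle_def by (rule ideal_sum_add)

lemma socle_incl: "minimal_right_ideal R \<Longrightarrow> x \<in> R \<Longrightarrow> x \<in> (socle :: 'a::ring_1 set)"
  unfolding socle_def by (auto intro: ideal_sum_incl)

lemma socle_induct [consumes 1, case_names zero add]:
  assumes "(x :: 'a::ring_1) \<in> socle" "P 0"
    and "\<And>R r y. minimal_right_ideal R \<Longrightarrow> r \<in> R \<Longrightarrow> y \<in> socle \<Longrightarrow> P y \<Longrightarrow> P (r + y)"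
  shows "P x"
  using assms unfolding socle_def by (induction rule: ideal_sum_induct) auto

lemma socle_mult_right:
  assumes "x \<in> (socle :: 'a::ring_1 set)" shows "x * a \<in> socle"
  using assms
proof (induction rule: socle_induct)
  case (add R r y)
  have "r * a \<in> R" using add(1,2) by (simp add: minimal_right_ideal_def right_ideal_def)
  then show ?case using add by (simp add: distrib_right socle_add socle_incl)
qed simp

lemma socle_mult_left:
  assumes "x \<in> (socle :: 'a::ring_1 set)" shows "a * x \<in> socle"
  using assms
proof (induction rule: socle_induct)
  case (add R r y)
  have "a * r \<in> (*) a ` R" using add(2) by blast
  then have "a * r \<in> socle"
    using minimal_right_ideal_image_mult[OF add(1), of a] socle_incl socle_zero by (metis singletonD)
  then show ?case using add by (simp add: distrib_left socle_add)
qed simp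

lemma socle_minus: "x \<in> socle \<Longrightarrow> - x \<in> (socle :: 'a::ring_1 set)"
  using socle_mult_left[of x "- 1"] by simp

lemma socle_diff: "x \<in> socle \<Longrightarrow> y \<in> socle \<Longrightarrow> x - y \<in> (socle :: 'a::ring_1 set)"
  using socle_add[of x "- y"] socle_minus[of y] by simp

lemma socle_mult_cong:
  fixes x y x' y' :: "'a::ring_1"
  assumes "x - x' \<in> socle" "y - y' \<in> socle"
  shows "x * y - x' * y' \<in> socle"
proof -
  have "x * y - x' * y' = (x - x') * y + x' * (y - y')" by (simp add: algebra_simps)
  then show ?thesis using assms by (simp add: socle_add socle_mult_left socle_mult_right)
qed

text \<open>The quotient as a type, so that computations modulo the socle are computations in a ring. It can be
the zero ring, so it is an instance of \<^class>\<open>ring\<close> and \<^class>\<open>monoid_mult\<close> only.\<close>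

quotient_type (overloaded) 'a soc_quot = "'a::ring_1" / "\<lambda>x y. x - y \<in> (socle :: 'a set)"
proof (rule equivpI)
  show "reflp (\<lambda>x y. x - y \<in> (socle :: 'a set))" by (simp add: reflp_def)
  show "symp (\<lambda>x y. x - y \<in> (socle :: 'a set))"
    unfolding symp_def by (metis minus_diff_eq socle_minus)
  show "transp (\<lambda>x y. x - y \<in> (socle :: 'a set))"
    unfolding transp_def by (metis diff_add_cancel add_diff_eq socle_add)
qed

instantiation soc_quot :: (ring_1) "{ring, monoid_mult}"
begin

lift_definition zero_soc_quot :: "'a soc_quot" is 0 .
lift_definition one_soc_quot :: "'a soc_quot" is 1 .
lift_definition plus_soc_quot :: "'a soc_quot \<Rightarrow> 'a soc_quot \<Rightarrow> 'a soc_quot" is "(+)"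
  by (metis add_diff_add socle_add)
lift_definition minus_soc_quot :: "'a soc_quot \<Rightarrow> 'a soc_quot \<Rightarrow> 'a soc_quot" is "(-)"
proof -
  fix x y z w :: 'a assume "x - y \<in> socle" "z - w \<in> socle"
  then have "(x - y) - (z - w) \<in> socle" by (rule socle_diff)
  then show "x - z - (y - w) \<in> socle" by (simp add: algebra_simps)
qed
lift_definition uminus_soc_quot :: "'a soc_quot \<Rightarrow> 'a soc_quot" is uminus
  by (drule socle_minus) (simp add: algebra_simps)
lift_definition times_soc_quot :: "'a soc_quot \<Rightarrow> 'a soc_quot \<Rightarrow> 'a soc_quot" is "(*)"
  by (rule socle_mult_cong)

instance
proof
  fix a b c :: "'a soc_quot"
  show "a + b + c = a + (b + c)" by (transfer; simp add: add.assoc)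
  show "a + b = b + a" by (transfer; simp add: add.commute)
  show "0 + a = a" by (transfer; simp)
  show "- a + a = 0" by (transfer; simp)
  show "a - b = a + - b" by (transfer; simp)
  show "a * b * c = a * (b * c)" by (transfer; simp add: mult.assoc)
  show "1 * a = a" by (transfer; simp)
  show "a * 1 = a" by (transfer; simp)
  show "(a + b) * c = a * c + b * c" by (transfer; simp add: distrib_right)
  show "a * (b + c) = a * b + a * c" by (transfer; simp add: distrib_left)
qed

end

lift_definition soc_proj :: "'a::ring_1 \<Rightarrow> 'a soc_quot" is "\<lambda>x. x" .

lemma soc_proj_simps [simp]:
  "soc_proj 0 = 0" "soc_proj 1 = 1" "soc_proj (x + y) = soc_proj x + soc_proj y"
  "soc_proj (x - y) = soc_proj x - soc_proj y" "soc_proj (- x) = - soc_proj x"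
  "soc_proj (x * y) = soc_proj x * soc_proj y"
  by (transfer; simp)+

lemma soc_proj_power [simp]: "soc_proj (x ^ n) = soc_proj x ^ n"
  by (induction n) auto

lemma soc_proj_neumann_sum: "soc_proj (neumann_sum n x) = neumann_sum n (soc_proj x)"
proof -
  have "soc_proj (\<Sum>i<n. (- x) ^ i) = (\<Sum>i<n. (- soc_proj x) ^ i)"
    by (induction n) simp_all
  then show ?thesis by (simp add: neumann_sum_def)
qed

lemma soc_proj_eq_iff: "soc_proj x = soc_proj y \<longleftrightarrow> x - y \<in> socle"
  by transfer simp

lemma soc_proj_eq_0_iff: "soc_proj x = 0 \<longleftrightarrow> x \<in> socle"
  using soc_proj_eq_iff[of x 0] by simp

lemma soc_proj_surj: obtains x where "u = soc_proj x"
proof -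
  have "\<exists>x. u = soc_proj x" by transfer (metis diff_self socle_zero)
  then show ?thesis using that by blast
qed

lemma ring_ring_of_type: "ring (ring_of_type_algebra :: 'a::ring_1 ring)"
proof -
  have "\<exists>y. x + y = 0" for x :: 'a
    using add.right_inverse by blast
  then show ?thesis
    unfolding ring_of_type_algebra_def using add.right_inverse
    by unfold_locales (auto simp: algebra_simps Units_def)
qed

lemma ideal_socle: "ideal (socle :: 'a::ring_1 set) ring_of_type_algebra"
proof (rule idealI)
  show "ring (ring_of_type_algebra :: 'a ring)" by (rule ring_ring_of_type)
  interpret ring "ring_of_type_algebra :: 'a ring" by (rule ring_ring_of_type)
  show "subgroup (socle :: 'a set) (add_monoid ring_of_type_algebra)"
  proof (rule add.subgroupI)
    fix a :: 'a assume "a \<in> socle"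
    moreover have "\<ominus>\<^bsub>ring_of_type_algebra\<^esub> a = - a"
      by (rule minus_equality) (auto simp: ring_of_type_algebra_def)
    ultimately show "\<ominus>\<^bsub>ring_of_type_algebra\<^esub> a \<in> socle" by (simp add: socle_minus)
  next
    show "(socle :: 'a set) \<noteq> {}" using socle_zero by blast
  qed (auto simp: ring_of_type_algebra_def socle_add)
qed (auto simp: ring_of_type_algebra_def socle_mult_left socle_mult_right)

lemma quot_map_eq_iff: "quot_map x = quot_map y \<longleftrightarrow> x - y \<in> (socle :: 'a::ring_1 set)"
proof -
  interpret ideal "socle :: 'a set" ring_of_type_algebra by (rule ideal_socle)
  have "quot_map z = {s + z | s. s \<in> socle}" for z :: 'a
    unfolding quot_map_def a_r_coset_def' by (auto simp: ring_of_type_algebra_def)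
  then have q: "w \<in> quot_map z \<longleftrightarrow> w - z \<in> socle" for w z :: 'a by (auto simp: algebra_simps) (metis diff_add_cancel add.commute)
  show ?thesis
  proof
    assume "quot_map x = quot_map y"
    then show "x - y \<in> socle" using q[of x x] q[of x y] by simp
  next
    assume a: "x - y \<in> socle"
    show "quot_map x = quot_map y"
    proof (rule Set.set_eqI)
      fix w
      show "w \<in> quot_map x \<longleftrightarrow> w \<in> quot_map y"
        unfolding q using a socle_add[of "w - x" "x - y"] socle_diff[of "w - y" "x - y"] by auto
    qed
  qed
qed

lemma quot_socle_simps:
  "carrier (quot_socle :: 'a::ring_1 set ring) = range quot_map"
  "quot_map (x :: 'a) \<otimes>\<^bsub>quot_socle\<^esub> quot_map y = quot_map (x * y)"
  "quot_map x [^]\<^bsub>quot_socle\<^esub> (n::nat) = quot_map (x ^ n)"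
proof -
  interpret ideal "socle :: 'a set" ring_of_type_algebra by (rule ideal_socle)
  show "carrier (quot_socle :: 'a set ring) = range quot_map"
    unfolding quot_socle_def FactRing_def A_RCOSETS_def' quot_map_def
    by (auto simp: ring_of_type_algebra_def)
  show m: "quot_map (x :: 'a) \<otimes>\<^bsub>quot_socle\<^esub> quot_map y = quot_map (x * y)" for x y :: 'a
    unfolding quot_socle_def FactRing_def quot_map_def
    using rcoset_mult_add[of x y] by (simp add: ring_of_type_algebra_def)
  show "quot_map x [^]\<^bsub>quot_socle\<^esub> (n::nat) = quot_map (x ^ n)"
  proof (induction n)
    case 0
    show ?case
      unfolding quot_socle_def FactRing_def quot_map_def by (simp add: ring_of_type_algebra_def nat_pow_def)
  next
    case (Suc n)
    then show ?case using m[of "x ^ n" x] by (simp add: nat_pow_def power_commutes)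
  qed
qed

lemma drazin_inverse_quot_iff:
  "drazin_inverse quot_socle (quot_map (a :: 'a::ring_1)) (quot_map b) \<longleftrightarrow> drazin (soc_proj a) (soc_proj b)"
  unfolding drazin_inverse_def drazin_def
  by (simp add: quot_socle_simps quot_map_eq_iff flip: soc_proj_eq_iff)

lemma b_fredholm_iff: "b_fredholm (a :: 'a::ring_1) \<longleftrightarrow> (\<exists>d. drazin (soc_proj a) d)"
proof
  assume "b_fredholm a"
  then obtain B where B: "drazin_inverse quot_socle (quot_map a) B" unfolding b_fredholm_def by blast
  then obtain b where "B = quot_map b" unfolding drazin_inverse_def quot_socle_simps by blast
  then show "\<exists>d. drazin (soc_proj a) d" using B drazin_inverse_quot_iff by blast
next
  assume "\<exists>d. drazin (soc_proj a) d"
  then show "b_fredholm a" unfolding b_fredholm_def by (metis drazin_inverse_quot_iff soc_proj_surj)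
qed

section \<open>A resolvent that exists everywhere vanishes\<close>

text \<open>Liouville's theorem for the resolvent \<open>c\<close> of \<open>x\<close> in the corner of an idempotent \<open>e\<close>, with
respect to a submultiplicative seminorm \<open>N\<close>. It is proved as a maximum principle: the value of the resolvent
at a point is almost the mean of its values at the vertices of a surrounding regular polygon. At a
maximum of \<open>N (c \<mu>)\<close> each vertex must carry the maximal value as well; marching on in one
direction contradicts the decay at infinity. With the norm of the algebra this gives the
Gelfand-Mazur theorem, with the quotient seminorm it is applied modulo the socle.\<close>

lemma resolvent_everywhere_imp_null:
  fixes N :: "'r::{ring,monoid_mult} \<Rightarrow> real" and scal :: "complex \<Rightarrow> 'r" and x e :: 'r
  assumes N_add: "\<And>y z. N (y + z) \<le> N y + N z"
    and N_mult: "\<And>y z. N (y * z) \<le> N y * N z"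
    and N_scal: "\<And>\<mu> y. N (scal \<mu> * y) = cmod \<mu> * N y"
    and scal_add: "\<And>\<mu> \<nu>. scal (\<mu> + \<nu>) = scal \<mu> + scal \<nu>"
    and scal_mult: "\<And>\<mu> \<nu>. scal (\<mu> * \<nu>) = scal \<mu> * scal \<nu>"
    and scal_1: "scal 1 = 1"
    and scal_central: "\<And>\<mu> y. scal \<mu> * y = y * scal \<mu>"
    and right: "\<And>\<mu>. (x - scal \<mu>) * c \<mu> = e"
    and left: "\<And>\<mu>. c \<mu> * (x - scal \<mu>) = e"
    and absorb: "\<And>\<mu>. e * c \<mu> = c \<mu>"
  shows "N e = 0"
proof (rule ccontr)
  assume "N e \<noteq> 0"
  have scal_0: "scal 0 = 0" using scal_add[of 0 0] by simp
  have scal_minus: "scal (- \<mu>) = - scal \<mu>" for \<mu>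
    using scal_add[of "- \<mu>" \<mu>] scal_0 by (simp add: eq_neg_iff_add_eq_0)
  have scal_diff: "scal (\<mu> - \<nu>) = scal \<mu> - scal \<nu>" for \<mu> \<nu>
    using scal_add[of \<mu> "- \<nu>"] scal_minus by simp
  have scal_power: "scal (\<mu> ^ n) = scal \<mu> ^ n" for \<mu> n
    by (induction n) (simp_all add: scal_1 scal_mult)
  have scal_sum: "scal (\<Sum>j<n. g j) = (\<Sum>j<n. scal (g j))" for g and n :: nat
    by (induction n) (simp_all add: scal_0 scal_add)
  have N_0: "N 0 = 0" using N_scal[of 0 0] by simp
  have N_minus: "N (- y) = N y" for y
    using N_scal[of "- 1" y] by (simp add: scal_minus scal_1)
  have N_nonneg: "0 \<le> N y" for y
    using N_add[of y "- y"] N_0 N_minus[of y] by simp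
  have N_sum: "N (\<Sum>j<n. g j) \<le> (\<Sum>j<n. N (g j))" for g and n :: nat
  proof (induction n)
    case (Suc n)
    then show ?case using N_add[of "\<Sum>j<n. g j" "g n"] by simp
  qed (simp add: N_0)
  have N_power: "N (y ^ n * z) \<le> N y ^ n * N z" for y z n
  proof (induction n)
    case (Suc n)
    have "N (y ^ Suc n * z) \<le> N y * N (y ^ n * z)" using N_mult by (simp add: mult.assoc)
    also have "\<dots> \<le> N y * (N y ^ n * N z)" using Suc N_nonneg by (simp add: mult_left_mono)
    finally show ?case by (simp add: mult.assoc)
  qed simp
  have Ne: "0 < N e" using \<open>N e \<noteq> 0\<close> N_nonneg[of e] by simp
  have Nc: "0 < N (c \<mu>)" for \<mu>
    using N_mult[of "x - scal \<mu>" "c \<mu>"] Ne N_nonneg[of "c \<mu>"] right[of \<mu>]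
    by (cases "N (c \<mu>) = 0") auto
  have absorb': "c \<mu> * e = c \<mu>" for \<mu>
    by (metis absorb left right mult.assoc)
  have resolvent: "c \<mu> - c \<nu> = scal (\<mu> - \<nu>) * (c \<mu> * c \<nu>)" for \<mu> \<nu>
  proof -
    have "c \<mu> = c \<mu> * ((x - scal \<nu>) * c \<nu>)" by (simp add: right absorb')
    moreover have "c \<nu> = c \<mu> * (x - scal \<mu>) * c \<nu>" by (simp add: left absorb)
    ultimately have "c \<mu> - c \<nu> = c \<mu> * (x - scal \<nu>) * c \<nu> - c \<mu> * (x - scal \<mu>) * c \<nu>"
      by (metis mult.assoc)
    also have "\<dots> = c \<mu> * scal (\<mu> - \<nu>) * c \<nu>" by (simp add: scal_diff algebra_simps)
    finally show ?thesis by (metis scal_central mult.assoc)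
  qed
  \<comment> \<open>The reciprocal of the norm of the resolvent is a contraction that tends to infinity, so it
    attains its minimum.\<close>
  define v where "v \<mu> = 1 / N (c \<mu>)" for \<mu>
  have v_lipschitz: "v \<nu> - v \<mu> \<le> cmod (\<mu> - \<nu>)" for \<mu> \<nu>
  proof -
    have "N (c \<mu>) \<le> N (c \<nu>) + N (c \<mu> - c \<nu>)" using N_add[of "c \<nu>" "c \<mu> - c \<nu>"] by simp
    also have "N (c \<mu> - c \<nu>) \<le> cmod (\<mu> - \<nu>) * (N (c \<mu>) * N (c \<nu>))"
      unfolding resolvent[of \<mu> \<nu>] N_scal by (simp add: N_mult mult_left_mono)
    finally show ?thesis
      using Nc[of \<mu>] Nc[of \<nu>] unfolding v_def by (simp add: field_simps)
  qed
  have v_growth: "(cmod \<mu> - N x) / N e \<le> v \<mu>" for \<mu>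
  proof -
    have "scal \<mu> * c \<mu> = x * c \<mu> + - e" using right[of \<mu>] by (simp add: algebra_simps)
    then have "cmod \<mu> * N (c \<mu>) \<le> N (x * c \<mu>) + N e"
      using N_add[of "x * c \<mu>" "- e"] N_scal[of \<mu> "c \<mu>"] N_minus[of e] by simp
    also have "\<dots> \<le> N x * N (c \<mu>) + N e" using N_mult by simp
    finally show ?thesis using Nc[of \<mu>] Ne unfolding v_def by (simp add: field_simps)
  qed
  have v_cont: "continuous_on S v" for S
  proof (rule continuous_onI)
    fix \<mu> and \<epsilon> :: real assume "0 < \<epsilon>"
    then show "\<exists>d>0. \<forall>\<nu>\<in>S. dist \<nu> \<mu> < d \<longrightarrow> dist (v \<nu>) (v \<mu>) \<le> \<epsilon>"
    proof (intro exI[of _ \<epsilon>] conjI ballI impI)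
      fix \<nu> assume "dist \<nu> \<mu> < \<epsilon>"
      then show "dist (v \<nu>) (v \<mu>) \<le> \<epsilon>"
        using v_lipschitz[of \<nu> \<mu>] v_lipschitz[of \<mu> \<nu>]
        by (simp add: dist_norm norm_minus_commute)
    qed
  qed
  \<comment> \<open>Outside the disc of radius \<open>R\<close> the growth estimate gives values above \<open>v 0\<close>.\<close>
  define R where "R = N x + N e * v 0"
  have v0: "0 < v 0" using Nc by (simp add: v_def)
  have R: "0 \<le> R" unfolding R_def using N_nonneg[of x] Ne v0 by simp
  obtain \<mu>0 where \<mu>0: "\<mu>0 \<in> cball 0 R" "\<And>\<mu>. \<mu> \<in> cball 0 R \<Longrightarrow> v \<mu>0 \<le> v \<mu>"
    using continuous_attains_inf[OF compact_cball _ v_cont, of 0 R] R by auto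
  have min: "v \<mu>0 \<le> v \<mu>" for \<mu>
  proof (cases "\<mu> \<in> cball 0 R")
    case False
    then have "v 0 * N e \<le> cmod \<mu> - N x" by (simp add: R_def mult.commute)
    then have "v 0 \<le> (cmod \<mu> - N x) / N e" using Ne by (simp add: field_simps)
    also have "\<dots> \<le> v \<mu>" by (rule v_growth)
    finally show ?thesis using \<mu>0(2)[of 0] R by simp
  qed (rule \<mu>0(2))
  define M where "M = N (c \<mu>0)"
  have M: "0 < M" by (simp add: M_def Nc)
  have max: "N (c \<mu>) \<le> M" for \<mu>
    using min[of \<mu>] Nc[of \<mu>] M unfolding v_def M_def[symmetric] by (simp add: field_simps)
  define \<rho> where "\<rho> = 1 / (2 * M)"
  have \<rho>: "0 < \<rho>" "\<rho> * M = 1 / 2" using M by (simp_all add: \<rho>_def)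
  have shift: "N (c (\<mu>1 + of_real \<rho>)) = M" if \<mu>1: "N (c \<mu>1) = M" for \<mu>1
  proof -
    define d where "d = c \<mu>1"
    define L where "L = N (c (\<mu>1 + of_real \<rho>))"
    \<comment> \<open>The mean of the resolvent over the vertices of a regular polygon equals its value at the
      centre, up to a geometrically small error.\<close>
    have key: "(1 - scal (z ^ n) * d ^ n) * c (\<mu>1 + z) = (\<Sum>i<n. scal (z ^ i) * d ^ Suc i)" for z n
    proof -
      define q where "q = scal z * d"
      have qp: "q ^ i = scal (z ^ i) * d ^ i" for i
        unfolding q_def scal_power by (rule power_mult_commute) (rule scal_central)
      have 1: "(1 - q) * c (\<mu>1 + z) = d"
        using resolvent[of \<mu>1 "\<mu>1 + z"]
        by (simp add: d_def q_def scal_minus algebra_simps)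
      have "1 - q ^ n = (\<Sum>i<n. q ^ i) * (1 - q)"
        unfolding geometric_telescope[symmetric] sum_distrib_left sum_distrib_right
        by (rule sum.cong) (simp_all add: algebra_simps power_commutes)
      then have "(1 - q ^ n) * c (\<mu>1 + z) = (\<Sum>i<n. q ^ i) * d"
        using 1 by (simp add: mult.assoc)
      also have "\<dots> = (\<Sum>i<n. scal (z ^ i) * d ^ Suc i)"
        unfolding sum_distrib_right by (rule sum.cong) (simp_all add: qp mult.assoc power_commutes)
      finally show ?thesis by (simp add: qp)
    qed
    have bound: "M - L \<le> of_nat n * (1 / 2) ^ n * M" if n: "0 < n" for n :: nat
    proof -
      define \<omega> where "\<omega> j = exp (2 * of_real pi * \<i> * of_nat j / of_nat n)" for j
      define z where "z j = of_real \<rho> * \<omega> j" for j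
      have \<omega>n: "\<omega> j ^ n = 1" for j unfolding \<omega>_def using n complex_root_unity by auto
      have zn: "z j ^ n = of_real (\<rho> ^ n)" for j by (simp add: z_def power_mult_distrib \<omega>n)
      have swap: "\<omega> j ^ i = \<omega> i ^ j" for i j
        unfolding \<omega>_def exp_of_nat_mult[symmetric] by (simp add: field_simps)
      have sum_\<omega>: "(\<Sum>j<n. \<omega> j ^ i) = (if i = 0 then of_nat n else 0)" if "i < n" for i
      proof (cases "i = 0")
        case False
        then have "\<omega> i \<noteq> 1" unfolding \<omega>_def using that n complex_root_unity_eq_1[of n i]
          by (auto dest: dvd_imp_le)
        then have "(\<Sum>j<n. \<omega> i ^ j) = 0" using geometric_sum[of "\<omega> i" n] \<omega>n by simp
        then show ?thesis using False by (simp add: swap)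
      qed simp
      have sum_z: "(\<Sum>j<n. z j ^ i) = (if i = 0 then of_nat n else 0)" if "i < n" for i
        using sum_\<omega>[OF that] by (simp add: z_def power_mult_distrib flip: sum_distrib_left)
      define W where "W = (\<Sum>j<n. c (\<mu>1 + z j))"
      have "(1 - scal (of_real (\<rho> ^ n)) * d ^ n) * W
          = (\<Sum>j<n. (1 - scal (z j ^ n) * d ^ n) * c (\<mu>1 + z j))"
        unfolding W_def sum_distrib_left by (simp add: zn)
      also have "\<dots> = (\<Sum>j<n. \<Sum>i<n. scal (z j ^ i) * d ^ Suc i)" by (simp only: key)
      also have "\<dots> = (\<Sum>i<n. \<Sum>j<n. scal (z j ^ i) * d ^ Suc i)" by (rule sum.swap)
      also have "\<dots> = (\<Sum>i<n. scal (\<Sum>j<n. z j ^ i) * d ^ Suc i)"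
        by (simp only: scal_sum sum_distrib_right)
      also have "\<dots> = (\<Sum>i<n. if i = 0 then scal (of_nat n) * d else 0)"
        by (rule sum.cong) (simp_all add: sum_z scal_0)
      also have "\<dots> = scal (of_nat n) * d" using n by (simp add: sum.delta)
      finally have eq: "scal (of_nat n) * d = W + - (scal (of_real (\<rho> ^ n)) * (d ^ n * W))"
        by (simp add: algebra_simps)
      have NW: "N W \<le> of_nat (n - 1) * M + L"
      proof -
        have "N W \<le> (\<Sum>j<n. N (c (\<mu>1 + z j)))" unfolding W_def by (rule N_sum)
        also have "\<dots> = N (c (\<mu>1 + z 0)) + (\<Sum>j\<in>{..<n} - {0}. N (c (\<mu>1 + z j)))"
          using n by (intro sum.remove) auto
        also have "N (c (\<mu>1 + z 0)) = L" by (simp add: L_def z_def \<omega>_def)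
        also have "(\<Sum>j\<in>{..<n} - {0}. N (c (\<mu>1 + z j))) \<le> (\<Sum>j\<in>{..<n} - {0}. M)"
          by (rule sum_mono) (rule max)
        also have "\<dots> = of_nat (n - 1) * M" using n by simp
        finally show ?thesis by simp
      qed
      have LM: "L \<le> M" by (simp add: L_def max)
      have NW': "N W \<le> of_nat n * M"
        using NW LM n by (cases n) (auto simp: algebra_simps)
      have "N (scal (of_real (\<rho> ^ n)) * (d ^ n * W)) = \<rho> ^ n * N (d ^ n * W)"
        using \<rho> unfolding N_scal by (simp add: norm_power)
      also have "\<dots> \<le> \<rho> ^ n * (M ^ n * N W)"
        using \<rho> N_power[of d n W] \<mu>1 by (simp add: d_def)
      also have "\<dots> = (1 / 2) ^ n * N W"
        by (simp only: power_mult_distrib[symmetric] mult.assoc[symmetric] \<rho>(2))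
      also have "\<dots> \<le> (1 / 2) ^ n * (of_nat n * M)" using NW' by simp
      finally have 2: "N (scal (of_real (\<rho> ^ n)) * (d ^ n * W)) \<le> (1 / 2) ^ n * (of_nat n * M)" .
      have "of_nat n * M = N (scal (of_nat n) * d)" unfolding N_scal using \<mu>1 by (simp add: d_def)
      also have "\<dots> \<le> N W + N (scal (of_real (\<rho> ^ n)) * (d ^ n * W))"
        unfolding eq using N_add N_minus by metis
      also have "\<dots> \<le> of_nat (n - 1) * M + L + (1 / 2) ^ n * (of_nat n * M)"
        using NW 2 by simp
      finally have "of_nat n * M \<le> of_nat (n - 1) * M + L + (1 / 2) ^ n * (of_nat n * M)" .
      moreover have "of_nat (n - 1) * M = of_nat n * M - M"
        using n by (simp add: of_nat_diff left_diff_distrib)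
      ultimately show ?thesis by (simp add: mult.assoc mult.left_commute)
    qed
    have "(\<lambda>n. of_nat n * (1 / 2 :: real) ^ n * M) \<longlonglongrightarrow> 0 * M"
      by (intro tendsto_mult tendsto_const powser_times_n_limit_0) simp
    moreover have "\<forall>n\<ge>1. M - L \<le> of_nat n * (1 / 2) ^ n * M" using bound by simp
    ultimately have "M - L \<le> 0" using LIMSEQ_le_const[of _ "0 * M" "M - L"] by auto
    then show ?thesis using max[of "\<mu>1 + of_real \<rho>"] by (simp add: L_def)
  qed
  have iter: "N (c (\<mu>0 + of_nat k * of_real \<rho>)) = M" for k
  proof (induction k)
    case (Suc k)
    have "\<mu>0 + of_nat k * of_real \<rho> + of_real \<rho> = \<mu>0 + of_nat (Suc k) * of_real \<rho>"
      by (simp add: distrib_right)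
    then show ?case using shift[OF Suc] by (simp only:)
  qed (simp add: M_def)
  obtain k :: nat where k: "(N e / M + N x + cmod \<mu>0) / \<rho> < of_nat k"
    using reals_Archimedean2 by blast
  have "(cmod (\<mu>0 + of_nat k * of_real \<rho>) - N x) / N e \<le> 1 / M"
    using v_growth[of "\<mu>0 + of_nat k * of_real \<rho>"] by (simp add: v_def iter)
  then have "cmod (\<mu>0 + of_nat k * of_real \<rho>) \<le> N e / M + N x"
    using Ne by (simp only: pos_divide_le_eq) simp
  moreover have "of_nat k * \<rho> - cmod \<mu>0 \<le> cmod (\<mu>0 + of_nat k * of_real \<rho>)"
    using norm_triangle_ineq2[of "of_nat k * of_real \<rho>" "- \<mu>0"] \<rho>(1)
    by (simp add: norm_mult add.commute)
  moreover have "N e / M + N x + cmod \<mu>0 < of_nat k * \<rho>" using k \<rho>(1) by (simp add: field_simps)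
  ultimately show False by simp
qed

section \<open>Complex scalars\<close>

global_interpretation cvec: vector_space "scaleC :: complex \<Rightarrow> 'a::complex_vector \<Rightarrow> 'a"
  by standard (simp_all add: scaleC_add_right scaleC_add_left scaleC_scaleC scaleC_one)

lemma scaleC_mult_simps [simp]:
  fixes x y :: "'a::complex_banach_algebra_1"
  shows "(\<mu> *\<^sub>C x) * y = \<mu> *\<^sub>C (x * y)" "x * (\<mu> *\<^sub>C y) = \<mu> *\<^sub>C (x * y)"
  by (simp_all add: mult_scaleC_left mult_scaleC_right)

lemma socle_scaleC:
  fixes x :: "'a::complex_banach_algebra_1"
  assumes "x \<in> socle" shows "\<mu> *\<^sub>C x \<in> socle"
  using socle_mult_left[OF assms, of "\<mu> *\<^sub>C 1"] by simp

section \<open>Minimal idempotents of semisimple rings\<close>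

definition minimal_idempotent :: "'a::ring_1 \<Rightarrow> bool" where
  "minimal_idempotent e \<longleftrightarrow> e * e = e \<and> minimal_right_ideal (range ((*) e))"

lemma right_ideal_range_mult: "right_ideal (range ((*) (a :: 'a::ring_1)))"
  using right_ideal_image_mult[of UNIV a] by (simp add: right_ideal_def)

lemma minimal_idempotent_nonzero: "minimal_idempotent e \<Longrightarrow> e \<noteq> 0"
  unfolding minimal_idempotent_def minimal_right_ideal_def by auto

lemma minimal_idempotent_idem: "minimal_idempotent e \<Longrightarrow> e * e = e"
  unfolding minimal_idempotent_def by blast

lemma minimal_idempotent_in_socle: "minimal_idempotent e \<Longrightarrow> e \<in> socle"
  unfolding minimal_idempotent_def by (metis rangeI socle_incl)

lemma minimal_idempotent_right_inverse:
  fixes e a :: "'a::ring_1"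
  assumes e: "minimal_idempotent e" and "e * a \<noteq> 0"
  obtains b where "e * a * b = e"
proof -
  have "range ((*) (e * a)) \<subseteq> range ((*) e)" by (auto simp: mult.assoc)
  moreover have "range ((*) (e * a)) \<noteq> {0}"
    using assms(2) by (metis mult_1_right rangeI singletonD)
  ultimately have "range ((*) (e * a)) = range ((*) e)"
    using e right_ideal_range_mult[of "e * a"]
    unfolding minimal_idempotent_def minimal_right_ideal_def by blast
  moreover have "e \<in> range ((*) e)" by (metis mult_1_right rangeI)
  ultimately have "e \<in> range ((*) (e * a))" by simp
  then obtain b where "e = e * a * b" by blast
  then show ?thesis using that by metis
qed

lemma ideal_sum_insert:
  assumes R: "right_ideal (R :: 'a::ring_1 set)"
  shows "ideal_sum (insert R F) = {r + y | r y. r \<in> R \<and> y \<in> ideal_sum F}"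
proof (intro Set.equalityI subsetI)
  fix x assume "x \<in> ideal_sum (insert R F)"
  then show "x \<in> {r + y | r y. r \<in> R \<and> y \<in> ideal_sum F}"
  proof (induction rule: ideal_sum_induct)
    case zero
    have "(0::'a) = 0 + 0" by simp
    then show ?case using R ideal_sum_zero unfolding right_ideal_def by blast
  next
    case (add R' r y)
    then obtain r0 y0 where y: "y = r0 + y0" "r0 \<in> R" "y0 \<in> ideal_sum F" by blast
    show ?case
    proof (cases "R' = R")
      case True
      then have "r + r0 \<in> R" using add(2) y(2) R unfolding right_ideal_def by blast
      moreover have "r + y = (r + r0) + y0" by (simp add: y(1) add.assoc)
      ultimately show ?thesis using y(3) by blast
    next
      case False
      then have "r \<in> ideal_sum F" using add(1,2) by (auto intro: ideal_sum_incl)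
      then have "r + y0 \<in> ideal_sum F" using y(3) by (rule ideal_sum_add)
      moreover have "r + y = r0 + (r + y0)" by (simp add: y(1) algebra_simps)
      ultimately show ?thesis using y(2) by blast
    qed
  qed
next
  fix x assume "x \<in> {r + y | r y. r \<in> R \<and> y \<in> ideal_sum F}"
  then obtain r y where x: "x = r + y" "r \<in> R" "y \<in> ideal_sum F" by blast
  have "r \<in> ideal_sum (insert R F)" using x(2) by (intro ideal_sum_incl[of R]) auto
  moreover have "y \<in> ideal_sum (insert R F)" using x(3) ideal_sum_mono[of F "insert R F"] by blast
  ultimately show "x \<in> ideal_sum (insert R F)" unfolding x(1) by (rule ideal_sum_add)
qed

lemma right_ideal_ideal_sum:
  assumes "\<And>R. R \<in> F \<Longrightarrow> right_ideal (R :: 'a::ring_1 set)"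
  shows "right_ideal (ideal_sum F)"
  unfolding right_ideal_def
proof (intro conjI allI ballI)
  fix a x assume "x \<in> ideal_sum F"
  then show "x * a \<in> ideal_sum F"
  proof (induction rule: ideal_sum_induct)
    case (add R r y)
    have "r * a \<in> R" using assms[OF add(1)] add(2) unfolding right_ideal_def by simp
    then show ?case using add(1,4) by (simp add: distrib_right ideal_sum_add ideal_sum_incl)
  qed (simp add: ideal_sum_zero)
qed (auto simp: ideal_sum_zero ideal_sum_add)

lemma socle_finite_sum:
  assumes "(s :: 'a::ring_1) \<in> socle"
  obtains F where "finite F" "\<And>R. R \<in> F \<Longrightarrow> minimal_right_ideal R" "s \<in> ideal_sum F"
proof -
  have "\<exists>F. finite F \<and> (\<forall>R\<in>F. minimal_right_ideal R) \<and> s \<in> ideal_sum F"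
    using assms
  proof (induction rule: socle_induct)
    case zero
    show ?case by (rule exI[of _ "{}"]) (simp add: ideal_sum_zero)
  next
    case (add R r y)
    then obtain F where F: "finite F" "\<forall>R\<in>F. minimal_right_ideal R" "y \<in> ideal_sum F" by blast
    have "r \<in> ideal_sum (insert R F)" using add(2) by (intro ideal_sum_incl[of R]) auto
    moreover have "y \<in> ideal_sum (insert R F)" using F(3) ideal_sum_mono[of F "insert R F"] by blast
    ultimately show ?case using F add(1) by (intro exI[of _ "insert R F"]) (auto intro: ideal_sum_add)
  qed
  then show ?thesis using that by blast
qed

lemma sum_orthogonal_idempotents:
  fixes E :: "'a::ring_1 set"
  assumes "finite E" "\<And>e. e \<in> E \<Longrightarrow> e * e = e"
    "\<And>e e'. e \<in> E \<Longrightarrow> e' \<in> E \<Longrightarrow> e \<noteq> e' \<Longrightarrow> e * e' = 0"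
  shows "e \<in> E \<Longrightarrow> e * \<Sum>E = e" "e \<in> E \<Longrightarrow> \<Sum>E * e = e" "\<Sum>E * \<Sum>E = \<Sum>E"
proof -
  show r: "e * \<Sum>E = e" if "e \<in> E" for e
  proof -
    have "e * \<Sum>E = (\<Sum>e'\<in>E. if e' = e then e else 0)"
      unfolding sum_distrib_left by (rule sum.cong) (use assms that in auto)
    then show ?thesis using assms(1) that by simp
  qed
  show "\<Sum>E * e = e" if "e \<in> E" for e
  proof -
    have "\<Sum>E * e = (\<Sum>e'\<in>E. if e' = e then e else 0)"
      unfolding sum_distrib_right by (rule sum.cong) (use assms that in auto)
    then show ?thesis using assms(1) that by simp
  qed
  show "\<Sum>E * \<Sum>E = \<Sum>E" by (subst sum_distrib_right) (simp add: r)
qed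

lemma in_range_idempotent:
  fixes q x :: "'a::ring_1"
  assumes "q * q = q"
  shows "x \<in> range ((*) q) \<longleftrightarrow> q * x = x"
  using assms by (metis mult.assoc rangeE rangeI)

text \<open>McCoy's lemma: von Neumann regularity can be checked after subtracting an element of the
form \<open>s x s\<close>.\<close>

lemma regular_if_difference_regular:
  fixes s x w :: "'a::ring_1"
  assumes "(s - s * x * s) * w * (s - s * x * s) = s - s * x * s"
  shows "\<exists>y. s * y * s = s"
proof
  have "s * (x + (1 - x * s) * w * (1 - s * x)) * s
      = s * x * s + (s - s * x * s) * w * (s - s * x * s)"
    by (simp add: algebra_simps)
  then show "s * (x + (1 - x * s) * w * (1 - s * x)) * s = s" using assms by simp
qed

context
  assumes semisimple: "(jacobson_radical :: 'a::ring_1 set) = {0}"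
begin

text \<open>If a maximal left ideal misses \<open>u\<close>, it contains some \<open>1 - a u\<close>, which would be invertible if
\<open>a u\<close> were nilpotent.\<close>

lemma semisimple_non_nilpotent:
  fixes u :: 'a
  assumes "u \<noteq> 0"
  obtains a where "\<And>n. (a * u) ^ n \<noteq> 0"
proof -
  obtain M where M: "maximal_left_ideal M" "u \<notin> M"
    using assms semisimple unfolding jacobson_radical_def by blast
  then have lM: "left_ideal M" "M \<noteq> UNIV" by (auto simp: maximal_left_ideal_def)
  define I where "I = {m + a * u | m a. m \<in> M}"
  have "left_ideal I"
    unfolding left_ideal_def
  proof (intro conjI allI ballI)
    have "(0::'a) = 0 + 0 * u" by simp
    then show "0 \<in> I" using lM(1) unfolding I_def left_ideal_def by blast
  next
    fix x y assume "x \<in> I" "y \<in> I"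
    then obtain m a m' a' where "x = m + a * u" "y = m' + a' * u" "m \<in> M" "m' \<in> M"
      unfolding I_def by blast
    then have "x + y = (m + m') + (a + a') * u" "m + m' \<in> M"
      using lM(1) by (auto simp: algebra_simps left_ideal_def)
    then show "x + y \<in> I" unfolding I_def by blast
  next
    fix b x assume "x \<in> I"
    then obtain m a where "x = m + a * u" "m \<in> M" unfolding I_def by blast
    then have "b * x = b * m + (b * a) * u" "b * m \<in> M"
      using lM(1) by (auto simp: algebra_simps left_ideal_def)
    then show "b * x \<in> I" unfolding I_def by blast
  qed
  moreover have "M \<subseteq> I"
  proof
    fix m assume "m \<in> M"
    moreover have "m = m + 0 * u" by simp
    ultimately show "m \<in> I" unfolding I_def by blast
  qed
  moreover have "u \<in> I"
  proof -
    have "u = 0 + 1 * u" "0 \<in> M" using lM(1) by (auto simp: left_ideal_def)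
    then show ?thesis unfolding I_def by blast
  qed
  ultimately have "I = UNIV" using M unfolding maximal_left_ideal_def by blast
  then obtain m a where ma: "1 = m + a * u" "m \<in> M" unfolding I_def by blast
  have "(a * u) ^ n \<noteq> 0" for n
  proof
    assume "(a * u) ^ n = 0"
    moreover have "m = 1 - a * u" using ma(1) by (simp add: eq_diff_eq)
    moreover have "(\<Sum>i<n. (a * u) ^ i) * (1 - a * u) = (1 - a * u) * (\<Sum>i<n. (a * u) ^ i)"
      unfolding sum_distrib_left sum_distrib_right
      by (rule sum.cong) (simp_all add: algebra_simps power_commutes)
    ultimately have "(\<Sum>i<n. (a * u) ^ i) * m = 1" by (simp add: geometric_telescope)
    then have "1 \<in> M" using lM(1) ma(2) unfolding left_ideal_def by metis
    then have "x \<in> M" for x using lM(1) unfolding left_ideal_def by (metis mult_1_right)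
    then show False using lM(2) by blast
  qed
  then show ?thesis using that by blast
qed

lemma power_Suc_swap: "((u :: 'a) * a) ^ Suc n = u * (a * u) ^ n * a"
  by (induction n) (simp_all add: mult.assoc power_commutes)

lemma semisimple_non_nilpotent':
  fixes u :: 'a
  assumes "u \<noteq> 0"
  obtains a where "\<And>n. (u * a) ^ n \<noteq> 0"
proof -
  obtain a where a: "\<And>n. (a * u) ^ n \<noteq> 0" using semisimple_non_nilpotent[OF assms] by blast
  have "(u * a) ^ n \<noteq> 0" for n
  proof
    assume "(u * a) ^ n = 0"
    then have "(a * u) ^ Suc n = 0" unfolding power_Suc_swap by simp
    then show False using a by blast
  qed
  then show ?thesis using that by blast
qed

text \<open>Brauer's lemma. By semisimplicity some \<open>r\<close> in the ideal \<open>R\<close> satisfies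
\<open>r R = R\<close>; the solution \<open>e\<close> of \<open>r e = r\<close> in \<open>R\<close> is idempotent because left multiplication by
\<open>r\<close> is injective on \<open>R\<close>.\<close>

lemma minimal_right_ideal_idempotent:
  assumes R: "minimal_right_ideal (R :: 'a set)"
  obtains e where "minimal_idempotent e" "R = range ((*) e)"
proof -
  have rR: "right_ideal R" and min: "\<And>I. right_ideal I \<Longrightarrow> I \<subseteq> R \<Longrightarrow> I = {0} \<or> I = R"
    using R unfolding minimal_right_ideal_def by blast+
  have R0: "0 \<in> R" and Radd: "\<And>x y. x \<in> R \<Longrightarrow> y \<in> R \<Longrightarrow> x + y \<in> R"
    and Rmult: "\<And>x a. x \<in> R \<Longrightarrow> x * a \<in> R" using rR unfolding right_ideal_def by blast+
  obtain u where u: "u \<in> R" "u \<noteq> 0" using R R0 unfolding minimal_right_ideal_def by blast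
  obtain a where a: "\<And>n. (u * a) ^ n \<noteq> 0" using semisimple_non_nilpotent'[OF u(2)] by blast
  define r where "r = u * a"
  have r: "r \<in> R" "r * r \<noteq> 0"
    using Rmult[OF u(1), of a] a[of 2] by (auto simp: r_def power2_eq_square)
  have rRR: "(*) r ` R \<subseteq> R" using Rmult[OF r(1)] by blast
  moreover have "(*) r ` R \<noteq> {0}" using r by blast
  ultimately have "(*) r ` R = R" using min right_ideal_image_mult[OF rR] by blast
  then obtain e where e: "e \<in> R" "r * e = r" using r(1) by (metis imageE)
  define K where "K = {x \<in> R. r * x = 0}"
  have "right_ideal K"
    using R0 Radd Rmult unfolding K_def right_ideal_def
    by (auto simp: distrib_left simp flip: mult.assoc)
  moreover have "K \<noteq> R" using e r unfolding K_def by fastforce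
  ultimately have K: "K = {0}" using min[of K] unfolding K_def by blast
  have "e * e - e \<in> R" using Radd[OF Rmult[OF e(1), of e] right_ideal_neg[OF rR e(1)]] by simp
  moreover have "r * (e * e - e) = 0" using e(2) by (simp add: right_diff_distrib flip: mult.assoc)
  ultimately have "e * e - e \<in> K" unfolding K_def by blast
  then have ee: "e * e = e" using K by simp
  have e0: "e \<noteq> 0" using e(2) r(2) by auto
  have "range ((*) e) \<subseteq> R" using Rmult[OF e(1)] by blast
  moreover have "range ((*) e) \<noteq> {0}" using e0 by (metis mult_1_right rangeI singletonD)
  ultimately have "R = range ((*) e)" using min[OF right_ideal_range_mult] by blast
  then show ?thesis using that[of e] ee R unfolding minimal_idempotent_def by simp
qed

text \<open>Each further minimal right ideal is replaced by its image under \<open>1 - q\<close>, which is again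
simple, and then by an idempotent orthogonal to \<open>q\<close>. The same induction makes all elements of the
sum regular, because the component along the new idempotent can be removed by McCoy's lemma.\<close>

lemma finite_sum_minimal_right_ideals:
  assumes "finite F" "\<And>R. R \<in> F \<Longrightarrow> minimal_right_ideal (R :: 'a set)"
  obtains E where "finite E" "card E \<le> card F" "\<And>e. e \<in> E \<Longrightarrow> minimal_idempotent e"
    "\<And>e e'. e \<in> E \<Longrightarrow> e' \<in> E \<Longrightarrow> e \<noteq> e' \<Longrightarrow> e * e' = 0"
    "ideal_sum F = range ((*) (\<Sum>E))"
    "\<And>s. \<Sum>E * s = s \<Longrightarrow> \<exists>y. s * y * s = s"
proof -
  have "\<exists>E. finite E \<and> card E \<le> card F \<and> (\<forall>e\<in>E. minimal_idempotent e) \<and>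
      (\<forall>e\<in>E. \<forall>e'\<in>E. e \<noteq> e' \<longrightarrow> e * e' = 0) \<and> ideal_sum F = range ((*) (\<Sum>E)) \<and>
      (\<forall>s. \<Sum>E * s = s \<longrightarrow> (\<exists>y. s * y * s = s))"
    using assms
  proof (induction F)
    case empty
    have "ideal_sum {} = range ((*) (0::'a))" unfolding ideal_sum_def by auto
    then show ?case by (intro exI[of _ "{}"]) auto
  next
    case (insert R F)
    then obtain E where E: "finite E" "card E \<le> card F" "\<forall>e\<in>E. minimal_idempotent e"
      "\<forall>e\<in>E. \<forall>e'\<in>E. e \<noteq> e' \<longrightarrow> e * e' = 0" and sum: "ideal_sum F = range ((*) (\<Sum>E))"
      and reg: "\<forall>s. \<Sum>E * s = s \<longrightarrow> (\<exists>y. s * y * s = s)" by (metis insertCI)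
    define q where "q = \<Sum>E"
    have idem: "\<And>e. e \<in> E \<Longrightarrow> e * e = e" using E(3) minimal_idempotent_idem by blast
    have qE: "\<And>e. e \<in> E \<Longrightarrow> e * q = e" "\<And>e. e \<in> E \<Longrightarrow> q * e = e" and qq: "q * q = q"
      using sum_orthogonal_idempotents[OF E(1) idem] E(4) unfolding q_def by auto
    have mR: "minimal_right_ideal R" using insert(4)[of R] by simp
    then have rR: "right_ideal R" by (simp add: minimal_right_ideal_def)
    have sumR: "ideal_sum (insert R F) = {r + y | r y. r \<in> R \<and> q * y = y}"
      unfolding ideal_sum_insert[OF rR] sum using in_range_idempotent[OF qq] unfolding q_def by blast
    define T where "T = (*) (1 - q) ` R"
    show ?case
    proof (cases "T = {0}")
      case True
      have "q * r = r" if "r \<in> R" for r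
      proof -
        have "(1 - q) * r = 0" using that True unfolding T_def by blast
        then show ?thesis by (simp add: left_diff_distrib)
      qed
      then have "ideal_sum (insert R F) = {y. q * y = y}"
      proof (intro Set.equalityI subsetI)
        fix y assume "y \<in> {y. q * y = y}"
        moreover have "0 \<in> R" "y = 0 + y" using rR by (auto simp: right_ideal_def)
        ultimately show "y \<in> ideal_sum (insert R F)" unfolding sumR by blast
      qed (auto simp: sumR distrib_left)
      also have "\<dots> = range ((*) q)" using in_range_idempotent[OF qq] by blast
      finally show ?thesis
        using E reg insert(1,2) unfolding q_def by (intro exI[of _ E]) auto
    next
      case False
      then have mT: "minimal_right_ideal T"
        using minimal_right_ideal_image_mult[OF mR] unfolding T_def by blast
      obtain g where g: "minimal_idempotent g" "T = range ((*) g)"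
        using minimal_right_ideal_idempotent[OF mT] by blast
      have gg: "g * g = g" using g(1) by (rule minimal_idempotent_idem)
      have "g \<in> T" unfolding g(2) by (metis mult_1_right rangeI)
      then obtain r0 where r0: "r0 \<in> R" "g = (1 - q) * r0" unfolding T_def by blast
      have qg: "q * g = 0" unfolding r0(2) by (simp add: ring_distribs qq flip: mult.assoc)
      define h where "h = g * (1 - q)"
      have hg: "h * g = g" unfolding h_def by (simp add: mult.assoc left_diff_distrib qg gg)
      have gh: "g * h = h" unfolding h_def by (simp add: gg flip: mult.assoc)
      have hh: "h * h = h" using hg by (simp add: h_def flip: mult.assoc)
      have qh: "q * h = 0" unfolding h_def by (simp add: qg flip: mult.assoc)
      have hq: "h * q = 0" unfolding h_def by (simp add: mult.assoc left_diff_distrib qq)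
      have hT: "range ((*) h) = T"
      proof (rule Set.set_eqI)
        fix x
        have "h * x = x \<longleftrightarrow> g * x = x" using gh hg by (metis mult.assoc)
        then show "x \<in> range ((*) h) \<longleftrightarrow> x \<in> T"
          unfolding g(2) in_range_idempotent[OF hh] in_range_idempotent[OF gg] .
      qed
      have mh: "minimal_idempotent h" unfolding minimal_idempotent_def hT using hh mT by blast
      have hE: "h \<notin> E" using qE(2)[of h] qh minimal_idempotent_nonzero[OF mh] by auto
      have orth: "e * h = 0" "h * e = 0" if "e \<in> E" for e
      proof -
        have "e * h = (e * q) * h" using qE(1)[OF that] by simp
        then show "e * h = 0" by (simp add: mult.assoc qh)
        have "h * e = h * (q * e)" using qE(2)[OF that] by simp
        then show "h * e = 0" by (simp add: hq flip: mult.assoc)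
      qed
      define q' where "q' = \<Sum>(insert h E)"
      have q': "q' = h + q" unfolding q'_def q_def using E(1) hE by simp
      have q'q': "q' * q' = q'" by (simp add: q' ring_distribs hh qq qh hq)
      have "ideal_sum (insert R F) = range ((*) q')"
      proof (intro Set.equalityI subsetI)
        fix x assume "x \<in> ideal_sum (insert R F)"
        then obtain r y where x: "x = r + y" "r \<in> R" "q * y = y" unfolding sumR by blast
        have "(1 - q) * r \<in> T" using x(2) unfolding T_def by blast
        then have hr: "h * ((1 - q) * r) = (1 - q) * r" using hT in_range_idempotent[OF hh] by blast
        have "h * y = 0" using x(3) hq by (metis mult.assoc mult_zero_left)
        moreover have "h * r = r - q * r" using hr hq
          by (simp add: ring_distribs flip: mult.assoc)
        ultimately have "q' * x = x" by (simp add: q' x ring_distribs)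
        then show "x \<in> range ((*) q')" using in_range_idempotent[OF q'q'] by blast
      next
        fix x assume "x \<in> range ((*) q')"
        then have x: "x = h * x + q * x" using in_range_idempotent[OF q'q'] q' by (metis distrib_right)
        have "h * x \<in> T" using hT by blast
        then obtain r where r: "r \<in> R" "h * x = (1 - q) * r" unfolding T_def by blast
        have "x = r + (q * x - q * r)" using x r(2) by (simp add: left_diff_distrib algebra_simps)
        moreover have "q * (q * x - q * r) = q * x - q * r"
          by (simp add: right_diff_distrib qq flip: mult.assoc)
        ultimately show "x \<in> ideal_sum (insert R F)" unfolding sumR using r(1) by blast
      qed
      moreover have "\<exists>y. s * y * s = s" if s: "q' * s = s" for s
      proof -
        have s': "s = h * s + q * s" using s by (metis q' distrib_right)
        show ?thesis
        proof (cases "h * s = 0")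
          case True
          then show ?thesis using s' reg unfolding q_def by auto
        next
          case False
          obtain b where b: "h * s * b = h" using minimal_idempotent_right_inverse[OF mh False] .
          define d where "d = s - s * (b * h) * s"
          have "h * d = 0"
            unfolding d_def by (simp add: right_diff_distrib b hh flip: mult.assoc)
          moreover have "q' * d = d"
            unfolding d_def by (simp add: right_diff_distrib s flip: mult.assoc)
          ultimately have "q * d = d" by (simp add: q' distrib_right)
          then obtain w where "d * w * d = d" using reg unfolding q_def by blast
          then show ?thesis using regular_if_difference_regular[of s "b * h" w] unfolding d_def by blast
        qed
      qed
      ultimately show ?thesis
        using E insert(1,2) mh hE orth unfolding q'_def
        by (intro exI[of _ "insert h E"]) auto
    qed
  qed
  then obtain E where "finite E" "card E \<le> card F" "\<forall>e\<in>E. minimal_idempotent e"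
      "\<forall>e\<in>E. \<forall>e'\<in>E. e \<noteq> e' \<longrightarrow> e * e' = 0" "ideal_sum F = range ((*) (\<Sum>E))"
      "\<forall>s. \<Sum>E * s = s \<longrightarrow> (\<exists>y. s * y * s = s)"
    by (elim exE conjE) (rule that)
  then show ?thesis by (intro that[of E]) simp_all
qed

lemma socle_element_support:
  assumes "(s :: 'a) \<in> socle"
  obtains E where "finite E" "\<And>e. e \<in> E \<Longrightarrow> minimal_idempotent e"
    "\<And>e e'. e \<in> E \<Longrightarrow> e' \<in> E \<Longrightarrow> e \<noteq> e' \<Longrightarrow> e * e' = 0" "\<Sum>E * s = s"
    "\<Sum>E * \<Sum>E = \<Sum>E" "\<exists>y. s * y * s = s"
proof -
  obtain F where F: "finite F" "\<And>R. R \<in> F \<Longrightarrow> minimal_right_ideal R" "s \<in> ideal_sum F"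
    using socle_finite_sum[OF assms] by blast
  obtain E where E: "finite E" "\<And>e. e \<in> E \<Longrightarrow> minimal_idempotent e"
    "\<And>e e'. e \<in> E \<Longrightarrow> e' \<in> E \<Longrightarrow> e \<noteq> e' \<Longrightarrow> e * e' = 0" "ideal_sum F = range ((*) (\<Sum>E))"
    "\<And>s. \<Sum>E * s = s \<Longrightarrow> \<exists>y. s * y * s = s"
    by (rule finite_sum_minimal_right_ideals[OF F(1,2)]) blast+
  have q: "\<Sum>E * \<Sum>E = \<Sum>E"
    using sum_orthogonal_idempotents(3)[OF E(1)] E(2,3) minimal_idempotent_idem by blast
  then have "\<Sum>E * s = s" using F(3) unfolding E(4) by (simp add: in_range_idempotent)
  then show ?thesis using that[OF E(1-3) _ q] E(5) by blast
qed

lemma socle_regular: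
  assumes "(s :: 'a) \<in> socle"
  obtains y where "s * y * s = s"
  by (rule socle_element_support[OF assms]) (use that in blast)

text \<open>If \<open>q\<close> is a finite sum of minimal idempotents \<open>e\<close> with \<open>q p = p\<close>, then \<open>p = p q p\<close> exhibits
\<open>p A\<close> as the sum of the ideals \<open>p e A\<close>, each of which is zero or minimal.\<close>

lemma socle_idempotent_decomposition:
  fixes p :: 'a
  assumes p: "p \<in> socle" "p * p = p"
  obtains E where "finite E" "\<And>e. e \<in> E \<Longrightarrow> minimal_idempotent e"
    "\<And>e e'. e \<in> E \<Longrightarrow> e' \<in> E \<Longrightarrow> e \<noteq> e' \<Longrightarrow> e * e' = 0" "range ((*) p) = range ((*) (\<Sum>E))"
proof -
  obtain E0 where E0: "finite E0" "\<And>e. e \<in> E0 \<Longrightarrow> minimal_idempotent e" "\<Sum>E0 * p = p"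
    by (rule socle_element_support[OF p(1)]) blast
  define F where "F = (\<lambda>e. (*) p ` range ((*) e)) ` {e \<in> E0. (*) p ` range ((*) e) \<noteq> {0}}"
  have "minimal_right_ideal (range ((*) e))" if "e \<in> E0" for e
    using E0(2)[OF that] unfolding minimal_idempotent_def by blast
  then have F: "finite F" "\<forall>R\<in>F. minimal_right_ideal R"
    unfolding F_def using E0(1) minimal_right_ideal_image_mult by (simp, blast)
  have rF: "right_ideal (ideal_sum F)"
    by (rule right_ideal_ideal_sum) (use F(2) in \<open>auto simp: minimal_right_ideal_def\<close>)
  have pep: "p * (e * p) \<in> ideal_sum F" if e: "e \<in> E0" for e
  proof (cases "(*) p ` range ((*) e) = {0}")
    case True
    then have "p * (e * p) = 0" by blast
    then show ?thesis by (simp add: ideal_sum_zero)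
  next
    case False
    then show ?thesis
      using e by (intro ideal_sum_incl[of "(*) p ` range ((*) e)"]) (auto simp: F_def)
  qed
  have "(\<Sum>e\<in>E. p * (e * p)) \<in> ideal_sum F" if "E \<subseteq> E0" for E
    using finite_subset[OF that E0(1)] that
    by (induction E rule: finite_induct) (simp_all add: ideal_sum_zero ideal_sum_add pep)
  from this[of E0] have "p \<in> ideal_sum F"
    using E0(3) p(2) by (simp flip: sum_distrib_left sum_distrib_right)
  then have "range ((*) p) \<subseteq> ideal_sum F" using rF unfolding right_ideal_def by blast
  moreover have "ideal_sum F \<subseteq> range ((*) p)"
  proof
    fix x assume "x \<in> ideal_sum F"
    then show "x \<in> range ((*) p)"
    proof (induction rule: ideal_sum_induct)
      case (add R r y)
      then obtain a b where "r = p * a" "y = p * b" unfolding F_def by blast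
      then have "r + y = p * (a + b)" by (simp add: distrib_left)
      then show ?case by blast
    qed (metis mult_zero_right rangeI)
  qed
  ultimately have eq: "ideal_sum F = range ((*) p)" by blast
  obtain E where "finite E" "\<And>e. e \<in> E \<Longrightarrow> minimal_idempotent e"
    "\<And>e e'. e \<in> E \<Longrightarrow> e' \<in> E \<Longrightarrow> e \<noteq> e' \<Longrightarrow> e * e' = 0" "ideal_sum F = range ((*) (\<Sum>E))"
    by (rule finite_sum_minimal_right_ideals[OF F(1)]) (use F(2) in blast)+
  then show ?thesis using that eq by metis
qed

end

section \<open>Corners at minimal idempotents are one-dimensional\<close>

text \<open>The Gelfand-Mazur theorem: by minimality the corner is a division algebra, so an element that is
not a scalar would have an everywhere defined resolvent.\<close>

lemma minimal_idempotent_corner: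
  fixes e a :: "'a::complex_banach_algebra_1"
  assumes e: "minimal_idempotent e"
  obtains \<mu> where "e * a * e = \<mu> *\<^sub>C e"
proof (rule ccontr)
  assume "\<not> thesis"
  then have ne: "e * a * e \<noteq> \<mu> *\<^sub>C e" for \<mu> using that by blast
  have ee: "e * e = e" using e by (rule minimal_idempotent_idem)
  have ri: "\<exists>z. e * z = z \<and> z * e = z \<and> w * z = e" if w: "e * w = w" "w * e = w" "w \<noteq> 0" for w
  proof -
    obtain b where b: "e * w * b = e" using minimal_idempotent_right_inverse[OF e, of w] w by metis
    have "w * (e * b * e) = e" using w b ee by (metis mult.assoc)
    then show ?thesis using ee by (intro exI[of _ "e * b * e"]) (metis mult.assoc)
  qed
  have inv: "\<exists>z. e * z = z \<and> z * e = z \<and> w * z = e \<and> z * w = e" if w: "e * w = w" "w * e = w" "w \<noteq> 0" for w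
  proof -
    obtain z where z: "e * z = z" "z * e = z" "w * z = e" using ri[OF w] by blast
    have "z \<noteq> 0" using z(3) minimal_idempotent_nonzero[OF e] by auto
    then obtain z' where z': "e * z' = z'" "z' * e = z'" "z * z' = e" using ri[OF z(1,2)] by blast
    have "w = w * (z * z')" using z' w by simp
    also have "\<dots> = z'" using z z' by (metis mult.assoc)
    finally show ?thesis using z z' by blast
  qed
  define y where "y = e * a * e"
  have y: "e * y = y" "y * e = y" unfolding y_def using ee by (metis mult.assoc)+
  have "\<exists>z. e * z = z \<and> z * e = z \<and> (y - \<mu> *\<^sub>C e) * z = e \<and> z * (y - \<mu> *\<^sub>C e) = e" for \<mu>
    by (rule inv) (use y ee ne[of \<mu>] in \<open>simp_all add: right_diff_distrib left_diff_distrib y_def\<close>)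
  then obtain c where c: "\<And>\<mu>. e * c \<mu> = c \<mu>" "\<And>\<mu>. c \<mu> * e = c \<mu>"
    "\<And>\<mu>. (y - \<mu> *\<^sub>C e) * c \<mu> = e" "\<And>\<mu>. c \<mu> * (y - \<mu> *\<^sub>C e) = e" by metis
  have "norm e = 0"
  proof (rule resolvent_everywhere_imp_null[where N = norm and scal = "\<lambda>\<mu>. \<mu> *\<^sub>C 1" and c = c and x = y])
    show "(y - \<mu> *\<^sub>C 1) * c \<mu> = e" for \<mu> using c(1,3)[of \<mu>] by (simp add: left_diff_distrib)
    show "c \<mu> * (y - \<mu> *\<^sub>C 1) = e" for \<mu> using c(2,4)[of \<mu>] by (simp add: right_diff_distrib)
  qed (simp_all add: c norm_triangle_ineq norm_mult_ineq norm_scaleC scaleC_add_left)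
  then show False using minimal_idempotent_nonzero[OF e] by simp
qed

text \<open>A nonzero \<open>x\<close> in \<open>e A g\<close> has a partner \<open>b\<close> with \<open>x b = e\<close> and \<open>b x = g\<close>, so that
\<open>e a g = (e a g b) x\<close> with a scalar in front of \<open>x\<close>.\<close>

lemma minimal_idempotents_between:
  fixes e g :: "'a::complex_banach_algebra_1"
  assumes e: "minimal_idempotent e" and g: "minimal_idempotent g"
  shows "\<exists>x. \<forall>a. \<exists>\<mu>. e * a * g = \<mu> *\<^sub>C x"
proof (cases "\<forall>a. e * a * g = 0")
  case True
  then show ?thesis by (metis cvec.scale_zero_left)
next
  case False
  then obtain a0 where a0: "e * a0 * g \<noteq> 0" by blast
  define x where "x = e * a0 * g"
  have ee: "e * e = e" "g * g = g" using e g minimal_idempotent_idem by blast+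
  have x: "e * x = x" "x * g = x" "x \<noteq> 0" using ee a0 unfolding x_def by (metis mult.assoc)+
  obtain b0 where b0: "e * x * b0 = e" using minimal_idempotent_right_inverse[OF e, of x] x by metis
  define b where "b = g * b0 * e"
  have xb: "x * b = e" using b0 x ee unfolding b_def by (metis mult.assoc)
  obtain \<nu> where \<nu>: "g * (b0 * e * x) * g = \<nu> *\<^sub>C g" using minimal_idempotent_corner[OF g] by blast
  have "b * x = \<nu> *\<^sub>C g" using \<nu> x unfolding b_def by (metis mult.assoc)
  moreover have "x * (b * x) = x" using xb x by (metis mult.assoc)
  ultimately have "\<nu> *\<^sub>C x = 1 *\<^sub>C x" using x by (simp add: scaleC_one)
  then have "\<nu> = 1" using cvec.scale_right_imp_eq[OF x(3)] by blast
  then have bx: "b * x = g" using \<open>b * x = \<nu> *\<^sub>C g\<close> by (simp add: scaleC_one)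
  show ?thesis
  proof (intro exI[of _ x] allI)
    fix a
    obtain \<mu> where \<mu>: "e * (a * g * b) * e = \<mu> *\<^sub>C e" using minimal_idempotent_corner[OF e] by blast
    have "e * a * g = e * a * g * (b * x)" using bx ee by (metis mult.assoc)
    also have "\<dots> = (e * (a * g * b) * e) * x" using x by (metis mult.assoc)
    also have "\<dots> = \<mu> *\<^sub>C x" by (simp add: \<mu> x)
    finally show "\<exists>\<mu>. e * a * g = \<mu> *\<^sub>C x" by blast
  qed
qed

section \<open>Algebraic elements\<close>

definition peval :: "complex poly \<Rightarrow> 'a::complex_banach_algebra_1 \<Rightarrow> 'a" where
  "peval p x = fold_coeffs (\<lambda>c y. c *\<^sub>C 1 + x * y) p 0"

lemma peval_0 [simp]: "peval 0 x = 0"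
  by (simp add: peval_def)

lemma peval_pCons [simp]: "peval (pCons c p) x = c *\<^sub>C 1 + x * peval p x"
  by (cases "c = 0 \<and> p = 0") (auto simp: peval_def)

lemma peval_add: "peval (p + q) x = peval p x + peval q x"
  by (induction p q rule: poly_induct2) (simp_all add: distrib_left scaleC_add_left)

lemma peval_smult: "peval (smult c p) x = c *\<^sub>C peval p x"
  by (induction p) (simp_all add: scaleC_add_right scaleC_scaleC)

lemma peval_mult: "peval (p * q) x = peval p x * peval q x"
  by (induction p) (simp_all add: peval_add peval_smult distrib_right mult.assoc)

lemma peval_pcompose: "peval (pcompose p q) x = peval p (peval q x)"
  by (induction p) (simp_all add: pcompose_pCons peval_add peval_mult)

lemma peval_sum: "peval (\<Sum>i\<in>A. g i) x = (\<Sum>i\<in>A. peval (g i) x)"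
  by (induction A rule: infinite_finite_induct) (simp_all add: peval_add)

lemma peval_monom: "peval (Polynomial.monom c n) x = c *\<^sub>C x ^ n"
  by (induction n) (simp_all add: Polynomial.monom_0 Polynomial.monom_Suc)

text \<open>Besides evaluation of polynomials, products of linear factors are used: they are what intertwining
relations and case distinctions on the roots refer to.\<close>

definition roots_prod :: "'a::complex_banach_algebra_1 \<Rightarrow> complex list \<Rightarrow> 'a" where
  "roots_prod x ls = prod_list (map (\<lambda>l. x - l *\<^sub>C 1) ls)"

definition algebraic_element :: "'a::complex_banach_algebra_1 \<Rightarrow> bool" where
  "algebraic_element x \<longleftrightarrow> (\<exists>ls. roots_prod x ls = 0)"

lemma roots_prod_simps [simp]:
  "roots_prod x [] = 1" "roots_prod x (l # ls) = (x - l *\<^sub>C 1) * roots_prod x ls"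
  by (simp_all add: roots_prod_def)

lemma roots_prod_append: "roots_prod x (ls @ ls') = roots_prod x ls * roots_prod x ls'"
  by (simp add: roots_prod_def)

lemma roots_prod_intertwine:
  assumes "x * u = u * y"
  shows "roots_prod x ls * u = u * roots_prod y ls"
proof (induction ls)
  case (Cons l ls)
  have "roots_prod x (l # ls) * u = (x - l *\<^sub>C 1) * (u * roots_prod y ls)"
    by (simp add: Cons mult.assoc)
  also have "\<dots> = u * roots_prod y (l # ls)"
    using assms by (simp add: ring_distribs flip: mult.assoc)
  finally show ?case .
qed simp

lemma roots_prod_commute:
  "x * z = z * x \<Longrightarrow> roots_prod x ls * z = z * roots_prod x ls"
  by (rule roots_prod_intertwine)

lemma roots_prod_snoc: "roots_prod x ls * (x - l *\<^sub>C 1) = roots_prod x (l # ls)"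
  using roots_prod_commute[of x "x - l *\<^sub>C 1" ls] by (simp add: ring_distribs)

lemma roots_prod_conv_peval: "roots_prod x ls = peval (prod_list (map (\<lambda>l. [:- l, 1:]) ls)) x"
  by (induction ls) (simp_all add: peval_mult scaleC_one one_pCons del: mult_pCons_left mult_pCons_right)

lemma peval_factor:
  assumes "p \<noteq> 0"
  obtains c ls where "c \<noteq> 0" "\<And>x :: 'a::complex_banach_algebra_1. peval p x = c *\<^sub>C roots_prod x ls"
proof -
  obtain A where A: "p = smult (lead_coeff p) (\<Prod>x\<in>#A. [:- x, 1:])"
    using alg_closed_imp_factorization[OF assms] by blast
  obtain ls where "A = mset ls" by (metis ex_mset)
  then have "(\<Prod>x\<in>#A. [:- x, 1:]) = prod_list (map (\<lambda>l. [:- l, 1:]) ls)"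
    by (metis mset_map prod_mset_prod_list)
  then have "peval p x = lead_coeff p *\<^sub>C roots_prod x ls" for x :: 'a
    by (metis A peval_smult roots_prod_conv_peval)
  then show ?thesis using that assms by (metis leading_coeff_0_iff)
qed

lemma algebraic_if_peval_eq_0:
  assumes "p \<noteq> 0" "peval p x = 0"
  shows "algebraic_element x"
proof -
  obtain c ls where "c \<noteq> 0" "peval p x = c *\<^sub>C roots_prod x ls"
    using peval_factor[OF assms(1)] by metis
  then show ?thesis using assms(2) unfolding algebraic_element_def by auto
qed

text \<open>At least one linear factor is required, since a constant polynomial in \<open>x\<close> carries no information.\<close>

lemma algebraic_if_roots_prod_algebraic:
  assumes "algebraic_element (roots_prod x (l # ls))"
  shows "algebraic_element x"
proof -
  define q where "q = prod_list (map (\<lambda>l. [:- l, 1:]) (l # ls))"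
  define q0 where "q0 = prod_list (map (\<lambda>l. [:- l, 1:]) ls)"
  have nz: "prod_list (map (\<lambda>l. [:- l, 1:]) ms) \<noteq> (0 :: complex poly)" for ms
    by (auto simp: prod_list_zero_iff)
  have "degree q = degree [:- l, 1:] + degree q0"
    unfolding q_def q0_def list.map prod_list.Cons by (rule degree_mult_eq) (use nz in auto)
  then have "0 < degree q" by simp
  obtain rs where rs: "roots_prod (roots_prod x (l # ls)) rs = 0"
    using assms unfolding algebraic_element_def by blast
  define p where "p = prod_list (map (\<lambda>l. [:- l, 1:]) rs)"
  have "peval (pcompose p q) x = 0"
    using rs unfolding roots_prod_conv_peval peval_pcompose p_def q_def by simp
  moreover have "pcompose p q \<noteq> 0"
    using pcompose_eq_0_iff[OF \<open>0 < degree q\<close>] nz by (simp add: p_def)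
  ultimately show ?thesis by (intro algebraic_if_peval_eq_0)
qed

lemma algebraic_mult_commute:
  assumes "algebraic_element (x * y)"
  shows "algebraic_element (y * x)"
proof -
  obtain ls where ls: "roots_prod (x * y) ls = 0" using assms unfolding algebraic_element_def by blast
  have "roots_prod (y * x) ls * y = y * roots_prod (x * y) ls"
    by (rule roots_prod_intertwine) (simp add: mult.assoc)
  then have "roots_prod (y * x) ls * (y * x - 0 *\<^sub>C 1) = 0" by (simp add: ls flip: mult.assoc)
  then show ?thesis unfolding roots_prod_snoc algebraic_element_def by blast
qed

text \<open>A factor \<open>x - l\<close> with \<open>l \<noteq> 0\<close> is a scalar multiple of some \<open>1 - x c\<close>, and so are products
of such factors. Hence \<open>x ^ m (1 - x c) = 0\<close> for some \<open>c\<close> that commutes with \<open>x\<close>.\<close>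

lemma algebraic_drazin:
  assumes "algebraic_element x"
  shows "\<exists>b. drazin x b"
proof -
  have "\<exists>k m c. k \<noteq> 0 \<and> x * c = c * x \<and> roots_prod x ls = k *\<^sub>C (x ^ m * (1 - x * c))" for ls
  proof (induction ls)
    case Nil
    show ?case by (intro exI[of _ 1] exI[of _ 0]) (simp add: scaleC_one)
  next
    case (Cons l ls)
    then obtain k m c where IH: "k \<noteq> 0" "x * c = c * x" "roots_prod x ls = k *\<^sub>C (x ^ m * (1 - x * c))"
      by blast
    show ?case
    proof (cases "l = 0")
      case True
      then show ?thesis using IH by (intro exI[of _ k] exI[of _ "Suc m"] exI[of _ c]) (simp add: mult.assoc)
    next
      case False
      define c' where "c' = inverse l *\<^sub>C 1 + c - inverse l *\<^sub>C (x * c)"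
      have eq: "x - l *\<^sub>C 1 = (- l) *\<^sub>C (1 - inverse l *\<^sub>C x)"
        using False by (simp add: cvec.scale_right_diff_distrib scaleC_scaleC scaleC_one)
      have "roots_prod x (l # ls) = (- l * k) *\<^sub>C ((1 - inverse l *\<^sub>C x) * x ^ m * (1 - x * c))"
        unfolding roots_prod_simps IH(3) eq by (simp add: scaleC_scaleC mult.assoc)
      also have "(1 - inverse l *\<^sub>C x) * x ^ m = x ^ m * (1 - inverse l *\<^sub>C x)"
        by (simp add: ring_distribs power_commutes)
      also have "x ^ m * (1 - inverse l *\<^sub>C x) * (1 - x * c) = x ^ m * (1 - x * c')"
        unfolding c'_def mult.assoc
        by (simp add: algebra_simps cvec.scale_right_diff_distrib scaleC_add_right)
      finally have "roots_prod x (l # ls) = (- l * k) *\<^sub>C (x ^ m * (1 - x * c'))" .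
      moreover have "x * c' = c' * x"
        unfolding c'_def
        by (simp add: ring_distribs mult.assoc
            IH(2)[symmetric])
      moreover have "- l * k \<noteq> 0" using False IH(1) by simp
      ultimately show ?thesis by blast
    qed
  qed
  then obtain k m c where c: "k \<noteq> 0" "x * c = c * x" "k *\<^sub>C (x ^ m * (1 - x * c)) = 0"
    using assms unfolding algebraic_element_def by metis
  then have "x ^ m * (1 - x * c) = 0" by simp
  then have "x ^ Suc m * c = x ^ m" by (simp add: right_diff_distrib power_commutes flip: mult.assoc)
  then show ?thesis using drazinI[OF c(2)] by blast
qed

lemma algebraic_if_powers_in_finite_span:
  fixes w :: "'a::complex_banach_algebra_1"
  assumes T: "finite T" and sp: "\<And>n. w ^ Suc n \<in> cvec.span T"
  shows "algebraic_element w"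
proof -
  define N where "N = card T"
  define g where "g i = w ^ Suc i" for i
  have "\<exists>c. (\<exists>i\<le>N. c i \<noteq> 0) \<and> (\<Sum>i\<le>N. c i *\<^sub>C g i) = 0"
  proof (cases "inj_on g {..N}")
    case True
    then have "card (g ` {..N}) = Suc N" by (simp add: card_image)
    then have "cvec.dependent (g ` {..N})"
      using cvec.independent_span_bound[OF T, of "g ` {..N}"] sp unfolding N_def g_def by fastforce
    then obtain u v where u: "v \<in> g ` {..N}" "u v \<noteq> 0" "(\<Sum>v\<in>g ` {..N}. u v *\<^sub>C v) = 0"
      unfolding cvec.dependent_finite[OF finite_imageI[OF finite_atMost]] by blast
    have "(\<Sum>i\<le>N. u (g i) *\<^sub>C g i) = 0" using u(3) by (simp add: sum.reindex[OF True])
    then show ?thesis using u(1,2) by (intro exI[of _ "\<lambda>i. u (g i)"]) auto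
  next
    case False
    then obtain i j where ij: "i \<le> N" "j \<le> N" "i \<noteq> j" "g i = g j" unfolding inj_on_def by auto
    define c :: "nat \<Rightarrow> complex" where "c n = (if n = i then 1 else if n = j then - 1 else 0)" for n
    have "(\<Sum>n\<le>N. c n *\<^sub>C g n) = (\<Sum>n\<in>{i, j}. c n *\<^sub>C g n)"
      by (rule sum.mono_neutral_right) (use ij in \<open>auto simp: c_def\<close>)
    also have "\<dots> = 0" using ij by (simp add: c_def scaleC_one)
    finally show ?thesis using ij by (intro exI[of _ c]) (auto simp: c_def)
  qed
  then obtain c i where c: "i \<le> N" "c i \<noteq> 0" "(\<Sum>i\<le>N. c i *\<^sub>C g i) = 0" by blast
  define p where "p = pCons 0 (\<Sum>i\<le>N. Polynomial.monom (c i) i)"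
  have "Polynomial.coeff (\<Sum>i\<le>N. Polynomial.monom (c i) i) i \<noteq> 0"
    using Polynomial.coeff_sum_monom[OF c(1), of c] c(2) by simp
  then have "p \<noteq> 0" unfolding p_def by auto
  moreover have "peval p w = 0"
    using c(3) unfolding p_def g_def by (simp add: peval_sum peval_monom sum_distrib_left)
  ultimately show ?thesis by (rule algebraic_if_peval_eq_0)
qed

text \<open>If \<open>q\<close> is a finite sum of minimal idempotents with \<open>q s = s\<close>, the corner of \<open>q\<close> is
finite-dimensional and contains \<open>s q\<close>; the relation \<open>(s q) s = s s\<close> transfers a polynomial
identity from \<open>s q\<close> to \<open>s\<close>.\<close>

lemma socle_algebraic:
  fixes s :: "'a::complex_banach_algebra_1"
  assumes ss: "(jacobson_radical :: 'a set) = {0}" and s: "s \<in> socle"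
  shows "algebraic_element s"
proof -
  obtain E where E: "finite E" "\<And>e. e \<in> E \<Longrightarrow> minimal_idempotent e" "\<Sum>E * s = s" "\<Sum>E * \<Sum>E = \<Sum>E"
    by (rule socle_element_support[OF ss s]) blast
  define q where "q = \<Sum>E"
  have "\<forall>e\<in>E. \<forall>g\<in>E. \<exists>x. \<forall>a. \<exists>\<mu>. e * a * g = \<mu> *\<^sub>C x"
    using E(2) minimal_idempotents_between by blast
  then obtain Y where Y: "\<And>e g a. e \<in> E \<Longrightarrow> g \<in> E \<Longrightarrow> \<exists>\<mu>. e * a * g = \<mu> *\<^sub>C Y e g"
    by metis
  define T where "T = (\<lambda>(e, g). Y e g) ` (E \<times> E)"
  have corner: "q * a * q \<in> cvec.span T" for a
  proof -
    have "e * a * g \<in> cvec.span T" if eg: "e \<in> E" "g \<in> E" for e g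
    proof -
      obtain \<mu> where "e * a * g = \<mu> *\<^sub>C Y e g" using Y[OF eg] by blast
      moreover have "Y e g \<in> T" using eg unfolding T_def by auto
      ultimately show ?thesis by (simp add: cvec.span_base cvec.span_scale)
    qed
    then show ?thesis unfolding q_def sum_distrib_left sum_distrib_right
      by (intro cvec.span_sum) auto
  qed
  have qq: "q * q = q" "q * s = s" using E(3,4) by (simp_all add: q_def)
  have "(s * q) ^ Suc n \<in> cvec.span T" for n
  proof -
    have "(s * q) ^ Suc n = q * ((s * q) ^ n * s) * q"
    proof -
      have "(s * q) ^ Suc n = (s * q) ^ n * s * q" by (simp add: power_commutes mult.assoc)
      moreover have "q * ((s * q) ^ n * s) = (s * q) ^ n * s"
        by (cases n) (simp_all add: qq mult.assoc flip: mult.assoc[of q s])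
      ultimately show ?thesis by simp
    qed
    then show ?thesis using corner by metis
  qed
  then have "algebraic_element (s * q)"
    by (intro algebraic_if_powers_in_finite_span[of T]) (auto simp: T_def E(1))
  then obtain ls where ls: "roots_prod (s * q) ls = 0" unfolding algebraic_element_def by blast
  have "roots_prod (s * q) ls * s = s * roots_prod s ls"
    by (rule roots_prod_intertwine) (simp add: mult.assoc qq)
  then have "roots_prod s (0 # ls) = 0" by (simp add: ls)
  then show ?thesis unfolding algebraic_element_def by blast
qed

section \<open>A characterisation of the socle\<close>

text \<open>For suitable weights the element \<open>x = \<Sum>c\<^sub>i e\<^sub>i = (\<Sum>c\<^sub>i a\<^sub>i) u\<close> converges and is
again a left multiple of \<open>u\<close>. Each weight is an eigenvalue of \<open>x\<close>, so \<open>1 / c\<^sub>i\<close> is an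
eigenvalue of a Drazin inverse of \<open>x\<close>; but the weights tend to \<open>0\<close>.\<close>

lemma no_infinite_orthogonal_sequence:
  fixes u :: "'a::complex_banach_algebra_1" and a e :: "nat \<Rightarrow> 'a"
  assumes dr: "\<And>a. \<exists>b. drazin (a * u) b"
    and e: "\<And>n. e n = a n * u" and nz: "\<And>n. e n \<noteq> 0"
    and orth: "\<And>i j. e i * e j = (if i = j then e i else 0)"
  shows False
proof -
  \<comment> \<open>The weights make \<open>\<Sum>c\<^sub>i a\<^sub>i\<close> absolutely convergent and tend to \<open>0\<close> themselves.\<close>
  define c where "c i = (1 / 2) ^ i / (1 + norm (a i))" for i
  have c0: "0 < c i" for i unfolding c_def by (simp add: add_pos_nonneg)
  have c1: "c i \<le> (1 / 2) ^ i" for i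
    unfolding c_def by (simp add: divide_le_eq add_pos_nonneg mult_le_cancel_left1 power_le_one)
  have bound: "norm (c i *\<^sub>R a i) \<le> (1 / 2) ^ i" for i
  proof -
    have "norm (c i *\<^sub>R a i) = (1 / 2) ^ i * (norm (a i) / (1 + norm (a i)))"
      using c0[of i] by (simp add: c_def)
    also have "\<dots> \<le> (1 / 2) ^ i * 1"
      by (intro mult_left_mono) (auto simp: divide_le_eq add_pos_nonneg)
    finally show ?thesis by simp
  qed
  have summ: "summable (\<lambda>i. c i *\<^sub>R a i)"
    by (rule summable_comparison_test'[where g = "\<lambda>i. (1 / 2) ^ i" and N = 0])
       (use bound in \<open>auto intro: summable_geometric\<close>)
  define S where "S = (\<Sum>i. c i *\<^sub>R a i)"
  define x where "x = S * u"
  have xe: "x * e j = c j *\<^sub>R e j" for j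
  proof -
    have "x * e j = (\<Sum>i. c i *\<^sub>R a i) * (u * e j)" by (simp add: x_def S_def mult.assoc)
    also have "\<dots> = (\<Sum>i. c i *\<^sub>R a i * (u * e j))" by (rule suminf_mult2[OF summ])
    also have "(\<lambda>i. c i *\<^sub>R a i * (u * e j)) = (\<lambda>i. c i *\<^sub>R (e i * e j))"
      by (rule ext) (simp add: e mult.assoc)
    also have "\<dots> = (\<lambda>i. if i = j then c i *\<^sub>R e i else 0)"
      by (auto simp: orth)
    also have "(\<Sum>i. if i = j then c i *\<^sub>R e i else 0) = c j *\<^sub>R e j"
      using sums_single[of j "\<lambda>i. c i *\<^sub>R e i"] by (simp add: sums_iff)
    finally show ?thesis .
  qed
  have xke: "x ^ k * e j = c j ^ k *\<^sub>R e j" for j k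
  proof (induction k)
    case (Suc k)
    have "x ^ Suc k * e j = x ^ k * (x * e j)" by (metis power_Suc2 mult.assoc)
    then show ?case by (simp add: xe Suc)
  qed simp
  obtain b where b: "drazin x b" using dr unfolding x_def by blast
  then have xb: "x * b = b * x" by (simp add: drazin_def)
  obtain k where k: "x ^ k * (x * b) = x ^ k" using drazin_power_absorb[OF b] .
  have "x ^ k * (x * b) = b * x ^ Suc k"
    using xb by (metis mult.assoc power_Suc power_Suc2 power_commute)
  then have k': "b * x ^ Suc k = x ^ k" using k by simp
  have "1 \<le> c j * norm b" for j
  proof -
    have "c j ^ k *\<^sub>R e j = b * (x ^ Suc k * e j)" using k' xke by (metis mult.assoc)
    also have "\<dots> = c j ^ k *\<^sub>R (c j *\<^sub>R (b * e j))" by (subst xke) simp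
    finally have "c j ^ k *\<^sub>R e j = c j ^ k *\<^sub>R (c j *\<^sub>R (b * e j))" .
    moreover have "c j ^ k \<noteq> 0" using c0[of j] by simp
    ultimately have "e j = c j *\<^sub>R (b * e j)" by (metis scaleR_cancel_left)
    then have "norm (e j) \<le> c j * (norm b * norm (e j))"
      using c0[of j] norm_mult_ineq[of b "e j"] by (metis abs_of_pos mult_le_cancel_left_pos norm_scaleR)
    then show ?thesis using nz[of j] by (simp add: mult.assoc[symmetric])
  qed
  moreover obtain j where "(1 / 2) ^ j * norm b < 1"
  proof -
    have "(\<lambda>j. (1 / 2) ^ j * norm b) \<longlonglongrightarrow> 0 * norm b"
      by (intro tendsto_mult tendsto_const LIMSEQ_realpow_zero) auto
    then have "eventually (\<lambda>j. (1 / 2) ^ j * norm b < 1) sequentially"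
      by (intro order_tendstoD(2)) auto
    then show ?thesis using that eventually_sequentially by auto
  qed
  ultimately show False
    using c1[of j] mult_right_mono[OF c1[of j] norm_ge_zero[of b]] by (meson not_le order.strict_trans1 order.trans)
qed

lemma drazin_support_nonzero:
  assumes "drazin (y :: 'a::complex_banach_algebra_1) d" "\<And>n. y ^ n \<noteq> 0"
  shows "y * d \<noteq> 0"
  using drazin_power_absorb[OF assms(1)] assms(2) by (metis mult_zero_right)

text \<open>The chain increases or decreases according to the flag \<open>inc\<close>; in both cases the differences of
consecutive members are orthogonal.\<close>

lemma no_infinite_idempotent_chain:
  fixes u :: "'a::complex_banach_algebra_1" and a H :: "nat \<Rightarrow> 'a"
  assumes dr: "\<And>a. \<exists>b. drazin (a * u) b"
    and H: "\<And>n. H n = a n * u" "\<And>n. H n * H n = H n" "\<And>n. H (Suc n) \<noteq> H n"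
    and chain: "\<And>n. H n * H (Suc n) = H (if inc then n else Suc n)"
      "\<And>n. H (Suc n) * H n = H (if inc then n else Suc n)"
  shows False
proof (rule no_infinite_orthogonal_sequence[OF dr])
  define e where "e n = (if inc then H (Suc n) - H n else H n - H (Suc n))" for n
  show "e n = (if inc then a (Suc n) - a n else a n - a (Suc n)) * u" for n
    unfolding e_def using H(1) by (simp add: left_diff_distrib)
  show "e n \<noteq> 0" for n using H(3)[of n] unfolding e_def by auto
  have HH: "H n * H m = H (if inc then n else m) \<and> H m * H n = H (if inc then n else m)" if "n \<le> m" for n m
    using that
  proof (induction m rule: dec_induct)
    case (step m)
    show ?case using step(3) chain[of m] by (cases inc; simp; metis mult.assoc)
  qed (simp add: H(2))
  show "e i * e j = (if i = j then e i else 0)" for i j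
  proof (cases i j rule: linorder_cases)
    case equal
    then show ?thesis
      using HH[of i "Suc i"] H(2) by (cases inc) (simp_all add: e_def ring_distribs)
  qed (use HH in \<open>cases inc; simp add: e_def ring_distribs\<close>)+
qed

context
  assumes semisimple: "(jacobson_radical :: 'a::complex_banach_algebra_1 set) = {0}"
begin

text \<open>A nonzero right ideal strictly inside \<open>h A\<close> contains an element that is not nilpotent. Its
compression to the corner of \<open>h\<close> is not nilpotent either, and the support of the compression is the
required idempotent.\<close>

lemma split_non_minimal_idempotent:
  fixes h u :: 'a
  assumes dr: "\<And>a. \<exists>b. drazin (a * u) b"
    and h: "h = a0 * u" "h * h = h" "h \<noteq> 0" "\<not> minimal_idempotent h"
  obtains g where "g * g = g" "h * g = g" "g * h = g" "g \<noteq> 0" "g \<noteq> h"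
proof -
  have "range ((*) h) \<noteq> {0}" using h(3) by (metis mult_1_right rangeI singletonD)
  then obtain I where I: "right_ideal I" "I \<subseteq> range ((*) h)" "I \<noteq> {0}" "I \<noteq> range ((*) h)"
    using h(2,4) right_ideal_range_mult[of h] unfolding minimal_idempotent_def minimal_right_ideal_def
    by blast
  have Imult: "\<And>x a. x \<in> I \<Longrightarrow> x * a \<in> I" and I0: "0 \<in> I" using I(1) unfolding right_ideal_def by blast+
  obtain z where z: "z \<in> I" "z \<noteq> 0" using I(3) I0 by blast
  obtain b where b: "\<And>n. (z * b) ^ n \<noteq> 0" using semisimple_non_nilpotent'[OF semisimple z(2)] by blast
  define w where "w = z * b"
  have w: "w \<in> I" unfolding w_def by (rule Imult[OF z(1)])
  then have hw: "h * w = w" using I(2) in_range_idempotent[OF h(2)] by blast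
  define y where "y = w * h"
  have hy: "h * y = y" "y * h = y" unfolding y_def by (simp_all add: h(2) hw mult.assoc flip: mult.assoc[of h w])
  have "w ^ Suc n = y ^ n * w" for n
  proof (induction n)
    case (Suc n)
    have "w ^ Suc (Suc n) = w * (y ^ n * w)" by (simp only: power_Suc Suc[symmetric])
    also have "y ^ n * w = h * (y ^ n * w)" by (cases n) (simp_all add: hw hy flip: mult.assoc)
    finally show ?case by (simp add: y_def mult.assoc)
  qed simp
  then have yn: "y ^ n \<noteq> 0" for n using b[of "Suc n"] unfolding w_def by (metis mult_zero_left)
  have "y = (w * a0) * u" by (simp add: y_def h(1) mult.assoc)
  then obtain d where d: "drazin y d" using dr by metis
  define g where "g = y * d"
  have g2: "g = d * y" using d by (simp add: g_def drazin_def)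
  have "g * g = g" unfolding g_def by (rule drazin_idempotent[OF d])
  moreover have "h * g = g" unfolding g_def by (simp add: hy flip: mult.assoc)
  moreover have "g * h = g" unfolding g2 by (simp add: hy mult.assoc)
  moreover have "g \<noteq> 0" unfolding g_def by (rule drazin_support_nonzero[OF d yn])
  moreover have "g \<noteq> h"
  proof
    assume "g = h"
    then have "h \<in> I" using Imult[OF Imult[OF w, of h], of d] by (simp add: g_def y_def)
    then have "range ((*) h) \<subseteq> I" using Imult by blast
    then show False using I by blast
  qed
  ultimately show ?thesis by (rule that)
qed

text \<open>The principal left ideal of \<open>u\<close> contains no infinite strictly monotone chain of idempotents.
By the absence of decreasing chains all its idempotents are in the socle; by the absence of increasing
chains one of them is a right unit for \<open>u\<close>.\<close>

lemma in_socle_if_left_multiples_drazin: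
  fixes u :: 'a
  assumes dr: "\<And>a. \<exists>b. drazin (a * u) b"
  shows "u \<in> socle"
proof (rule ccontr)
  assume u: "u \<notin> socle"
  \<comment> \<open>An idempotent outside the socle is not minimal, and one of its two parts is again outside.\<close>
  have idem_soc: "h \<in> socle" if h: "h * h = h" "h = a * u" for h a
  proof (rule ccontr)
    assume "h \<notin> socle"
    define P where "P h \<longleftrightarrow> (\<exists>a. h = a * u) \<and> h * h = h \<and> h \<notin> socle" for h
    have "\<exists>H. \<forall>n. P (H n) \<and> H n * H (Suc n) = H (Suc n) \<and> H (Suc n) * H n = H (Suc n) \<and> H (Suc n) \<noteq> H n"
    proof (rule dependent_nat_choice)
      show "\<exists>h. P h" using h \<open>h \<notin> socle\<close> unfolding P_def by blast
    next
      fix h n assume "P h"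
      then obtain a where h: "h = a * u" "h * h = h" "h \<notin> socle" unfolding P_def by blast
      have "h \<noteq> 0" "\<not> minimal_idempotent h" using h(3) minimal_idempotent_in_socle by auto
      then obtain g where g: "g * g = g" "h * g = g" "g * h = g" "g \<noteq> 0" "g \<noteq> h"
        using split_non_minimal_idempotent[OF dr h(1,2)] by blast
      show "\<exists>h'. P h' \<and> h * h' = h' \<and> h' * h = h' \<and> h' \<noteq> h"
      proof (cases "g \<in> socle")
        case False
        have "g = (g * a) * u" using g(3) h(1) by (simp add: mult.assoc)
        then show ?thesis using False g unfolding P_def by blast
      next
        case True
        have "h - g = (a - g * a) * u" using g(3) h(1) by (simp add: left_diff_distrib mult.assoc)
        moreover have "h - g \<notin> socle" using h(3) socle_add[OF _ True, of "h - g"] by auto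
        moreover have "(h - g) * (h - g) = h - g" "h * (h - g) = h - g" "(h - g) * h = h - g" "h - g \<noteq> h"
          using g h(2) by (simp_all add: ring_distribs)
        ultimately show ?thesis unfolding P_def by blast
      qed
    qed
    then obtain H where H: "\<And>n. P (H n)" "\<And>n. H n * H (Suc n) = H (Suc n)"
      "\<And>n. H (Suc n) * H n = H (Suc n)" "\<And>n. H (Suc n) \<noteq> H n" by blast
    obtain a where "\<And>n. H n = a n * u" using H(1) unfolding P_def by metis
    then show False
      using no_infinite_idempotent_chain[OF dr, of H a False] H unfolding P_def by auto
  qed
  \<comment> \<open>As no idempotent \<open>h\<close> of the left ideal is a right unit for \<open>u\<close>, the element
    \<open>u (1 - h)\<close> gives rise to a further idempotent orthogonal to \<open>h\<close>.\<close>
  define P where "P h \<longleftrightarrow> (\<exists>a. h = a * u) \<and> h * h = h" for h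
  have "\<exists>H. \<forall>n. P (H n) \<and> H n * H (Suc n) = H n \<and> H (Suc n) * H n = H n \<and> H (Suc n) \<noteq> H n"
  proof (rule dependent_nat_choice)
    have "(0::'a) = 0 * u" by simp
    then show "\<exists>h. P h" unfolding P_def by (metis mult_zero_left)
  next
    fix h n assume "P h"
    then obtain a0 where h: "h = a0 * u" "h * h = h" unfolding P_def by blast
    have "h \<in> socle" by (rule idem_soc[OF h(2,1)])
    then have "u * (1 - h) \<noteq> 0" using u socle_mult_left[of h u] by (auto simp: right_diff_distrib)
    then obtain a where a: "\<And>n. (a * (u * (1 - h))) ^ n \<noteq> 0"
      using semisimple_non_nilpotent[OF semisimple] by blast
    define w where "w = a * (u * (1 - h))"
    have wh: "w * h = 0" unfolding w_def by (simp add: mult.assoc left_diff_distrib h(2))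
    define y where "y = (1 - h) * w"
    have hy: "h * y = 0" "y * h = 0"
      unfolding y_def by (simp_all add: wh right_diff_distrib left_diff_distrib h(2) mult.assoc flip: mult.assoc[of h h])
    have "w ^ Suc n = w * y ^ n" for n
    proof (induction n)
      case (Suc n)
      have "w ^ Suc (Suc n) = w * y ^ n * w" using Suc by (metis power_Suc2)
      moreover have "w * y ^ n * h = 0"
      proof (cases n)
        case (Suc m)
        then show ?thesis by (metis hy(2) mult.assoc mult_zero_right power_Suc2)
      qed (simp add: wh)
      ultimately have "w ^ Suc (Suc n) = w * y ^ n * ((1 - h) * w)"
        by (simp add: ring_distribs flip: mult.assoc)
      then show ?case by (simp add: y_def power_commutes mult.assoc power_Suc2 del: power_Suc)
    qed simp
    then have yn: "y ^ n \<noteq> 0" for n using a[of "Suc n"] unfolding w_def by (metis mult_zero_right)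
    have y: "y = ((1 - h) * a - (1 - h) * a * u * a0) * u"
      unfolding y_def w_def using h(1) by (simp add: algebra_simps)
    then obtain d where d: "drazin y d" using dr by metis
    define g where "g = y * d"
    have g2: "g = d * y" using d by (simp add: g_def drazin_def)
    have g: "g * g = g" "h * g = 0" "g * h = 0" "g \<noteq> 0"
      using drazin_idempotent[OF d] drazin_support_nonzero[OF d yn] hy
      by (auto simp: g_def) (metis g2 g_def mult.assoc mult_zero_right mult_zero_left)+
    obtain a1 where "g = a1 * u" using g2 y by (metis mult.assoc)
    then have "h + g = (a0 + a1) * u" by (simp add: h(1) distrib_right)
    moreover have "(h + g) * (h + g) = h + g" "h * (h + g) = h" "(h + g) * h = h" "h + g \<noteq> h"
      using g h(2) by (simp_all add: ring_distribs)
    ultimately show "\<exists>h'. P h' \<and> h * h' = h \<and> h' * h = h \<and> h' \<noteq> h"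
      unfolding P_def by blast
  qed
  then obtain H where H: "\<And>n. P (H n)" "\<And>n. H n * H (Suc n) = H n"
    "\<And>n. H (Suc n) * H n = H n" "\<And>n. H (Suc n) \<noteq> H n" by blast
  obtain a where "\<And>n. H n = a n * u" using H(1) unfolding P_def by metis
  then show False
    using no_infinite_idempotent_chain[OF dr, of H a True] H unfolding P_def by auto
qed

end

section \<open>Isolated points of the essential spectrum\<close>

text \<open>On the range of \<open>e = a b\<close> one has \<open>a - \<nu> = a (1 - \<nu> b)\<close>; on the complement \<open>a\<close> is
nilpotent and \<open>a - \<nu>\<close> is inverted by a finite geometric sum.\<close>

lemma drazin_isolated:
  fixes a b \<nu> t z :: "'r::{ring,monoid_mult}"
  assumes d: "drazin a b" and central: "\<And>y. \<nu> * y = y * \<nu>" and t: "\<nu> * t = 1"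
    and z: "(1 - \<nu> * b) * z = 1" "z * (1 - \<nu> * b) = 1"
  shows "\<exists>c. (a - \<nu>) * c = 1 \<and> c * (a - \<nu>) = 1"
proof -
  define e where "e = a * b"
  have ab: "a * b = b * a" using d by (simp add: drazin_def)
  have eb: "e * b = b" using drazin_absorb[OF d] by (simp add: e_def)
  obtain k where k: "a ^ k * e = a ^ k" using drazin_power_absorb[OF d] e_def by metis
  have t': "t * \<nu> = 1" using central t by metis
  have tc: "t * y = y * t" for y
    by (metis central t t' mult.assoc mult_1_left mult_1_right)
  have az: "a * z = z * a"
  proof -
    have "(1 - \<nu> * b) * a = a * (1 - \<nu> * b)"
      using ab central[of "b * a"] central[of b] by (simp add: ring_distribs)
        (metis central mult.assoc)
    then show ?thesis by (metis z mult.assoc mult_1_left mult_1_right)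
  qed
  have ea: "e * a = a * e" unfolding e_def by (metis ab mult.assoc)
  define S where "S = (\<Sum>j<k. (t * a) ^ j)"
  have Sa: "S * a = a * S"
    unfolding S_def sum_distrib_left sum_distrib_right
    by (rule sum.cong) (use tc in \<open>auto intro!: power_commute simp: mult.assoc\<close>)
  define c where "c = b * z - t * (S * (1 - e))"
  have 1: "(a - \<nu>) * (b * z) = e"
  proof -
    have "(a - \<nu>) * b = e * (1 - \<nu> * b)"
      unfolding ring_distribs
      by (metis central eb e_def mult.assoc mult_1_right)
    then show ?thesis using z(1) by (metis mult.assoc mult_1_right)
  qed
  have 2: "(a - \<nu>) * (t * (S * (1 - e))) = - (1 - e)"
  proof -
    have "(a - \<nu>) * t = - (1 - t * a)" using t tc by (simp add: left_diff_distrib)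
    then have "(a - \<nu>) * (t * (S * (1 - e))) = - (1 - t * a) * S * (1 - e)"
      by (simp only: mult.assoc[symmetric])
    also have "\<dots> = - ((1 - t * a) * S * (1 - e))" by (simp only: mult_minus_left)
    also have "(1 - t * a) * S = 1 - (t * a) ^ k" unfolding S_def by (rule geometric_telescope)
    also have "(t * a) ^ k = t ^ k * a ^ k" by (rule power_mult_commute) (rule tc)
    also have "(1 - t ^ k * a ^ k) * (1 - e) = 1 - e"
      by (simp add: ring_distribs k mult.assoc)
    finally show ?thesis .
  qed
  have right: "(a - \<nu>) * c = 1" unfolding c_def right_diff_distrib[of "a - \<nu>"] 1 2 by simp
  have "c * a = a * c"
  proof -
    have "b * z * a = a * (b * z)" using ab az by (metis mult.assoc)
    moreover have "t * (S * (1 - e)) * a = a * (t * (S * (1 - e)))"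
    proof -
      have "t * (S * (1 - e)) * a = t * (S * a * (1 - e))"
        using ea by (simp add: right_diff_distrib left_diff_distrib mult.assoc)
      then show ?thesis using Sa tc by (metis mult.assoc)
    qed
    ultimately show ?thesis unfolding c_def by (simp add: ring_distribs)
  qed
  then have "c * (a - \<nu>) = (a - \<nu>) * c" using central by (simp add: ring_distribs)
  then show ?thesis using right by metis
qed

lemma neumann_inverse:
  fixes y :: "'a::complex_banach_algebra_1"
  assumes "norm y < 1"
  obtains z where "(1 - y) * z = 1" "z * (1 - y) = 1"
proof -
  have s: "summable (\<lambda>n. y ^ n)" by (rule complete_algebra_summable_geometric[OF assms])
  define z where "z = (\<Sum>n. y ^ n)"
  have z: "z = 1 + (\<Sum>n. y ^ Suc n)"
    using suminf_split_head[OF s] by (simp add: z_def)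
  have "y * z = (\<Sum>n. y ^ Suc n)" using suminf_mult[OF s, of y] by (simp add: z_def)
  moreover have "z * y = (\<Sum>n. y ^ Suc n)"
    using suminf_mult2[OF s, of y] by (simp add: z_def power_commutes)
  ultimately have "(1 - y) * z = 1" "z * (1 - y) = 1"
    using z by (simp_all add: left_diff_distrib right_diff_distrib)
  then show ?thesis by (rule that)
qed

definition cscal :: "complex \<Rightarrow> 'a::complex_banach_algebra_1 soc_quot" where
  "cscal \<mu> = soc_proj (\<mu> *\<^sub>C 1)"

lemma cscal_simps:
  "cscal (\<mu> + \<nu>) = cscal \<mu> + cscal \<nu>" "cscal (\<mu> * \<nu>) = cscal \<mu> * cscal \<nu>" "cscal 1 = 1"
  "cscal 0 = 0"
  by (simp_all add: cscal_def scaleC_add_left scaleC_scaleC scaleC_one mult.commute flip: soc_proj_simps)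

lemma cscal_central: "cscal \<mu> * u = u * cscal \<mu>"
proof -
  obtain x where "u = soc_proj x" by (rule soc_proj_surj)
  then show ?thesis by (simp add: cscal_def mult.commute flip: soc_proj_simps)
qed

lemma soc_proj_scaleC: "soc_proj (\<mu> *\<^sub>C x) = cscal \<mu> * soc_proj x"
  by (simp add: cscal_def flip: soc_proj_simps)

text \<open>The socle need not be closed, so the quotient norm is only a seminorm. It nevertheless separates
idempotents from \<open>0\<close>, because \<open>1 - e\<close> is invertible as soon as \<open>e\<close> has a representative of norm
less than \<open>1\<close>.\<close>

definition soc_norm :: "'a::complex_banach_algebra_1 soc_quot \<Rightarrow> real" where
  "soc_norm u = Inf (norm ` {x. soc_proj x = u})"

lemma soc_norm_le: "soc_norm (soc_proj x) \<le> norm x"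
  unfolding soc_norm_def by (rule cInf_lower) (auto intro: bdd_belowI[of _ 0])

lemma soc_norm_approx:
  assumes "0 < \<epsilon>"
  obtains x where "soc_proj x = u" "norm x < soc_norm u + \<epsilon>"
proof -
  obtain x0 where "u = soc_proj x0" by (rule soc_proj_surj)
  then have ne: "norm ` {x. soc_proj x = u} \<noteq> {}" by auto
  have "Inf (norm ` {x. soc_proj x = u}) < soc_norm u + \<epsilon>" using assms by (simp add: soc_norm_def)
  from cInf_lessD[OF ne this] show ?thesis using that by blast
qed

lemma soc_norm_nonneg: "0 \<le> soc_norm u"
proof -
  obtain x0 where "u = soc_proj x0" by (rule soc_proj_surj)
  then show ?thesis unfolding soc_norm_def by (intro cInf_greatest) auto
qed

lemma soc_norm_add: "soc_norm (u + v) \<le> soc_norm u + soc_norm v"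
proof (rule field_le_epsilon)
  fix \<epsilon> :: real assume "0 < \<epsilon>"
  then have "0 < \<epsilon> / 2" by simp
  obtain x where x: "soc_proj x = u" "norm x < soc_norm u + \<epsilon> / 2" using soc_norm_approx[OF \<open>0 < \<epsilon> / 2\<close>] .
  obtain y where y: "soc_proj y = v" "norm y < soc_norm v + \<epsilon> / 2" using soc_norm_approx[OF \<open>0 < \<epsilon> / 2\<close>] .
  have "soc_norm (u + v) \<le> norm (x + y)" using soc_norm_le[of "x + y"] x y by simp
  also have "\<dots> \<le> norm x + norm y" by (rule norm_triangle_ineq)
  finally show "soc_norm (u + v) \<le> soc_norm u + soc_norm v + \<epsilon>" using x y by simp
qed

lemma soc_norm_mult: "soc_norm (u * v) \<le> soc_norm u * soc_norm v"
proof -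
  have "soc_norm (u * v) \<le> (soc_norm u + \<epsilon>) * (soc_norm v + \<epsilon>)" if pos: "0 < \<epsilon>" for \<epsilon>
  proof -
    obtain x where x: "soc_proj x = u" "norm x < soc_norm u + \<epsilon>" using soc_norm_approx[OF pos] .
    obtain y where y: "soc_proj y = v" "norm y < soc_norm v + \<epsilon>" using soc_norm_approx[OF pos] .
    have "soc_norm (u * v) \<le> norm (x * y)" using soc_norm_le[of "x * y"] x y by simp
    also have "\<dots> \<le> norm x * norm y" by (rule norm_mult_ineq)
    also have "\<dots> \<le> (soc_norm u + \<epsilon>) * (soc_norm v + \<epsilon>)"
      using x y by (intro mult_mono) (auto intro: order.trans[OF norm_ge_zero less_imp_le])
    finally show ?thesis .
  qed
  then have ev: "eventually (\<lambda>\<epsilon>. soc_norm (u * v) \<le> (soc_norm u + \<epsilon>) * (soc_norm v + \<epsilon>)) (at_right 0)"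
    by (auto simp: eventually_at_right_field intro: exI[of _ 1])
  have "((\<lambda>\<epsilon>. (soc_norm u + \<epsilon>) * (soc_norm v + \<epsilon>)) \<longlongrightarrow> (soc_norm u + 0) * (soc_norm v + 0)) (at_right 0)"
    by (intro tendsto_intros)
  from tendsto_lowerbound[OF this ev] show ?thesis by simp
qed

lemma soc_norm_scal: "soc_norm (cscal \<mu> * u) = cmod \<mu> * soc_norm u"
proof -
  have le: "soc_norm (cscal \<nu> * v) \<le> cmod \<nu> * soc_norm v" for \<nu> and v :: "'a soc_quot"
  proof -
    have "soc_norm (cscal \<nu> * v) \<le> soc_norm (cscal \<nu> :: 'a soc_quot) * soc_norm v" by (rule soc_norm_mult)
    also have "soc_norm (cscal \<nu> :: 'a soc_quot) \<le> norm (\<nu> *\<^sub>C (1 :: 'a))" unfolding cscal_def by (rule soc_norm_le)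
    finally show ?thesis using soc_norm_nonneg[of v] by (simp add: norm_scaleC mult_right_mono)
  qed
  show ?thesis
  proof (cases "\<mu> = 0")
    case True
    then have "soc_norm (cscal \<mu> * u) \<le> 0" using le[of 0 u] by simp
    then show ?thesis using soc_norm_nonneg[of "cscal \<mu> * u"] True by simp
  next
    case False
    have "cscal (inverse \<mu>) * (cscal \<mu> * u) = u"
      using False by (simp add: cscal_simps(3) flip: mult.assoc cscal_simps(2))
    then have "soc_norm u \<le> cmod (inverse \<mu>) * soc_norm (cscal \<mu> * u)" using le by metis
    also have "cmod (inverse \<mu>) = inverse (cmod \<mu>)" by (rule norm_inverse)
    finally have "cmod \<mu> * soc_norm u \<le> soc_norm (cscal \<mu> * u)"
      using False by (simp add: field_simps)
    then show ?thesis using le[of \<mu> u] by simp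
  qed
qed

lemma idempotent_norm_0_imp_0:
  fixes e :: "'a::complex_banach_algebra_1 soc_quot"
  assumes "e * e = e" "soc_norm e = 0"
  shows "e = 0"
proof -
  obtain e0 where e0: "soc_proj e0 = e" "norm e0 < 1"
    using soc_norm_approx[of 1 e] assms(2) by auto
  obtain z where "z * (1 - e0) = 1" using neumann_inverse[OF e0(2)] by blast
  then have "soc_proj (z * (1 - e0)) = 1" by simp
  then have z: "soc_proj z * (1 - e) = 1" by (simp add: e0 right_diff_distrib)
  have "(1 - e) * e = 0" using assms(1) by (simp add: left_diff_distrib)
  then show ?thesis using z by (metis mult.assoc mult_1_left mult_zero_right)
qed

text \<open>The spectrum modulo the socle is discrete, so by compactness it is finite.
The product \<open>e\<close> of the supports at these finitely many points is an idempotent on whose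
corner the resolvent exists everywhere; hence \<open>e = 0\<close>, and a product of powers of
the factors \<open>x - \<mu>\<close> vanishes.\<close>

lemma polynomial_in_socle_if_all_drazin:
  fixes x0 :: "'a::complex_banach_algebra_1"
  assumes dr: "\<And>\<mu>. \<exists>d. drazin (soc_proj (x0 - \<mu> *\<^sub>C 1)) d"
  shows "\<exists>ls. roots_prod x0 ls \<in> socle"
proof -
  define x where "x = soc_proj x0"
  have px: "soc_proj (x0 - \<mu> *\<^sub>C 1) = x - cscal \<mu>" for \<mu> by (simp add: x_def cscal_def)
  obtain d where d: "\<And>\<mu>. drazin (x - cscal \<mu>) (d \<mu>)" using dr unfolding px by metis
  have dcom: "d \<mu> * y = y * d \<mu>" if "x * y = y * x" for \<mu> y
  proof (rule drazin_commute[OF d])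
    show "(x - cscal \<mu>) * y = y * (x - cscal \<mu>)"
      using that by (simp add: ring_distribs cscal_central)
  qed
  define E where "E \<mu> = (x - cscal \<mu>) * d \<mu>" for \<mu>
  have Ecom: "E \<mu> * y = y * E \<mu>" if "x * y = y * x" for \<mu> y
    unfolding E_def using dcom[OF that, of \<mu>] that
    by (simp add: ring_distribs) (metis cscal_central mult.assoc)
  have xE: "x * E \<mu> = E \<mu> * x" for \<mu> using Ecom[of x] by simp
  have EE: "E \<mu> * E \<mu> = E \<mu>" for \<mu> unfolding E_def by (rule drazin_idempotent[OF d])
  have E1: "E \<mu> = 1" if "(x - cscal \<mu>) * c = 1" "c * (x - cscal \<mu>) = 1" for \<mu> c
    using drazin_unique[OF d drazin_inverse_unit[OF that]] that unfolding E_def by simp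
  have iso: "\<exists>\<delta>>0. \<forall>\<nu>. \<nu> \<noteq> \<mu> \<longrightarrow> dist \<nu> \<mu> < \<delta> \<longrightarrow> E \<nu> = 1" for \<mu>
  proof -
    obtain b0 where b0: "soc_proj b0 = d \<mu>" using soc_proj_surj by metis
    show ?thesis
    proof (intro exI[of _ "1 / (1 + norm b0)"] conjI allI impI)
      show "0 < 1 / (1 + norm b0)" by (simp add: add_pos_nonneg)
    next
      fix \<nu> assume \<nu>: "\<nu> \<noteq> \<mu>" "dist \<nu> \<mu> < 1 / (1 + norm b0)"
      define h where "h = \<nu> - \<mu>"
      have h: "h \<noteq> 0" using \<nu> by (simp add: h_def)
      have "cmod h * (1 + norm b0) < 1" using \<nu>(2) by (simp add: h_def dist_norm less_divide_eq add_pos_nonneg)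
      moreover have "cmod h * norm b0 \<le> cmod h * (1 + norm b0)" by (simp add: distrib_left)
      ultimately have "norm (h *\<^sub>C b0) < 1" by (simp add: norm_scaleC)
      then obtain z where z: "(1 - h *\<^sub>C b0) * z = 1" "z * (1 - h *\<^sub>C b0) = 1" by (rule neumann_inverse)
      have z': "(1 - cscal h * d \<mu>) * soc_proj z = 1" "soc_proj z * (1 - cscal h * d \<mu>) = 1"
        using arg_cong[OF z(1), of soc_proj] arg_cong[OF z(2), of soc_proj]
        by (simp_all add: soc_proj_scaleC b0 del: scaleC_mult_simps)
      have "cscal h * cscal (inverse h) = 1" using h by (simp add: cscal_simps(3) flip: cscal_simps(2))
      from drazin_isolated[OF d[of \<mu>] cscal_central this z']
      obtain c where "(x - cscal \<mu> - cscal h) * c = 1" "c * (x - cscal \<mu> - cscal h) = 1" by blast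
      moreover have "cscal \<nu> = cscal \<mu> + (cscal h :: 'a soc_quot)"
        unfolding cscal_simps(1)[symmetric] by (simp add: h_def)
      then have "x - cscal \<mu> - cscal h = x - cscal \<nu>" by (simp only: diff_diff_eq)
      ultimately show "E \<nu> = 1" using E1 by metis
    qed
  qed
  have bound: "E \<mu> = 1" if "norm x0 < cmod \<mu>" for \<mu>
  proof -
    have "\<mu> \<noteq> 0" using that by auto
    have "norm (inverse \<mu> *\<^sub>C x0) = norm x0 / cmod \<mu>"
      by (simp add: norm_scaleC norm_inverse divide_inverse mult.commute)
    then have "norm (inverse \<mu> *\<^sub>C x0) < 1" using that \<open>\<mu> \<noteq> 0\<close> by (simp add: divide_less_eq)
    then obtain z where z: "(1 - inverse \<mu> *\<^sub>C x0) * z = 1" "z * (1 - inverse \<mu> *\<^sub>C x0) = 1"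
      by (rule neumann_inverse)
    have eq: "x0 - \<mu> *\<^sub>C 1 = (- \<mu>) *\<^sub>C (1 - inverse \<mu> *\<^sub>C x0)"
      using \<open>\<mu> \<noteq> 0\<close> by (simp add: cvec.scale_right_diff_distrib scaleC_scaleC scaleC_one)
    have "(x0 - \<mu> *\<^sub>C 1) * ((- inverse \<mu>) *\<^sub>C z) = 1" "((- inverse \<mu>) *\<^sub>C z) * (x0 - \<mu> *\<^sub>C 1) = 1"
      unfolding eq using z \<open>\<mu> \<noteq> 0\<close> by (simp_all add: scaleC_scaleC scaleC_one)
    then have "soc_proj ((x0 - \<mu> *\<^sub>C 1) * ((- inverse \<mu>) *\<^sub>C z)) = 1"
      "soc_proj (((- inverse \<mu>) *\<^sub>C z) * (x0 - \<mu> *\<^sub>C 1)) = 1" by simp_all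
    then have "(x - cscal \<mu>) * soc_proj ((- inverse \<mu>) *\<^sub>C z) = 1"
      "soc_proj ((- inverse \<mu>) *\<^sub>C z) * (x - cscal \<mu>) = 1"
      unfolding soc_proj_simps(6) px by simp_all
    then show ?thesis by (rule E1)
  qed
  have fin: "finite {\<mu>. E \<mu> \<noteq> 1}"
  proof (rule ccontr)
    assume inf: "infinite {\<mu>. E \<mu> \<noteq> 1}"
    have "norm \<mu> \<le> norm x0" if "E \<mu> \<noteq> 1" for \<mu>
      using bound[of \<mu>] that by (cases "norm x0 < cmod \<mu>") auto
    then have "{\<mu>. E \<mu> \<noteq> 1} \<subseteq> cball 0 (norm x0)" by auto
    then obtain \<mu> where \<mu>: "\<mu> islimpt {\<mu>. E \<mu> \<noteq> 1}"
      using inf compact_cball[of 0 "norm x0"] unfolding compact_eq_Bolzano_Weierstrass by blast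
    obtain \<delta> where "\<delta> > 0" "\<And>\<nu>. \<nu> \<noteq> \<mu> \<Longrightarrow> dist \<nu> \<mu> < \<delta> \<Longrightarrow> E \<nu> = 1" using iso[of \<mu>] by blast
    then show False using \<mu> unfolding islimpt_approachable by blast
  qed
  have "\<exists>e rs. x * e = e * x \<and> e * e = e \<and> (\<forall>\<mu>\<in>S. e * E \<mu> = e) \<and> soc_proj (roots_prod x0 rs) * (1 - e) = 0"
    if "finite S" for S
    using that
  proof (induction S rule: finite_induct)
    case empty
    show ?case by (intro exI[of _ 1]) simp
  next
    case (insert \<mu> S)
    then obtain e rs where e: "x * e = e * x" "e * e = e" "\<forall>\<mu>\<in>S. e * E \<mu> = e"
      and rs: "soc_proj (roots_prod x0 rs) * (1 - e) = 0" by blast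
    have Ee: "E \<mu> * e = e * E \<mu>" by (rule Ecom[OF e(1)])
    define R where "R = soc_proj (roots_prod x0 rs)"
    have xR: "x * R = R * x"
      using arg_cong[OF roots_prod_commute[of x0 x0 rs], of soc_proj] by (simp add: R_def x_def)
    obtain k where k: "(x - cscal \<mu>) ^ k * E \<mu> = (x - cscal \<mu>) ^ k"
      using drazin_power_absorb[OF d[of \<mu>]] unfolding E_def by blast
    define Y where "Y = (x - cscal \<mu>) ^ k"
    have YR: "Y * R = R * Y"
      unfolding Y_def by (rule power_commute) (simp add: ring_distribs xR cscal_central)
    have "1 - E \<mu> * e = (1 - E \<mu>) + E \<mu> * (1 - e)" by (simp add: right_diff_distrib)
    then have "Y * R * (1 - E \<mu> * e) = Y * R * (1 - E \<mu>) + Y * R * (E \<mu> * (1 - e))"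
      by (simp only: distrib_left)
    also have "Y * R * (1 - E \<mu>) = R * (Y * (1 - E \<mu>))" by (simp only: YR mult.assoc)
    also have "Y * R * (E \<mu> * (1 - e)) = Y * (R * E \<mu>) * (1 - e)" by (simp only: mult.assoc)
    also have "\<dots> = Y * (E \<mu> * (R * (1 - e)))" by (simp only: Ecom[OF xR, symmetric] mult.assoc)
    also have "R * (Y * (1 - E \<mu>)) + Y * (E \<mu> * (R * (1 - e))) = 0"
      using rs k by (simp add: Y_def R_def right_diff_distrib)
    also have "Y = soc_proj (roots_prod x0 (replicate k \<mu>))"
      unfolding Y_def by (induction k) (simp_all add: px[symmetric])
    finally have "soc_proj (roots_prod x0 (replicate k \<mu> @ rs)) * (1 - E \<mu> * e) = 0"
      by (simp add: roots_prod_append R_def)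
    moreover have "x * (E \<mu> * e) = E \<mu> * e * x" using xE e(1) by (metis mult.assoc)
    moreover have "E \<mu> * e * (E \<mu> * e) = E \<mu> * e" using EE e(2) Ee by (metis mult.assoc)
    moreover have "E \<mu> * e * E \<mu> = E \<mu> * e" using EE Ee by (metis mult.assoc)
    moreover have "\<forall>\<nu>\<in>S. E \<mu> * e * E \<nu> = E \<mu> * e" using e(3) by (simp add: mult.assoc)
    ultimately show ?case by blast
  qed
  from this[OF fin] obtain e rs where xe: "x * e = e * x" and ee: "e * e = e"
    and abs: "\<forall>\<mu>\<in>{\<mu>. E \<mu> \<noteq> 1}. e * E \<mu> = e" and rs: "soc_proj (roots_prod x0 rs) * (1 - e) = 0"
    by blast
  have eE: "e * E \<mu> = e" for \<mu> using abs by (cases "E \<mu> = 1") auto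
  have "soc_norm e = 0"
  proof (rule resolvent_everywhere_imp_null[where N = soc_norm and scal = cscal and c = "\<lambda>\<mu>. e * d \<mu>" and x = x])
    fix \<mu>
    have xe': "(x - cscal \<mu>) * e = e * (x - cscal \<mu>)"
      using xe by (simp add: ring_distribs cscal_central)
    show 1: "(x - cscal \<mu>) * (e * d \<mu>) = e" using xe' eE[of \<mu>] unfolding E_def by (metis mult.assoc)
    have "d \<mu> * (x - cscal \<mu>) = E \<mu>" using d[of \<mu>] unfolding E_def drazin_def by simp
    then show "e * d \<mu> * (x - cscal \<mu>) = e" using eE[of \<mu>] by (simp add: mult.assoc)
    show "e * (e * d \<mu>) = e * d \<mu>" using ee by (simp flip: mult.assoc)
  qed (rule soc_norm_add soc_norm_mult soc_norm_scal cscal_simps(1-3) cscal_central)+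
  then have "e = 0" by (rule idempotent_norm_0_imp_0[OF ee])
  then show ?thesis using rs unfolding soc_proj_eq_0_iff[symmetric] by auto
qed

lemma algebraic_if_all_drazin:
  fixes x :: "'a::complex_banach_algebra_1"
  assumes ss: "(jacobson_radical :: 'a set) = {0}"
    and dr: "\<And>\<mu>. \<exists>d. drazin (soc_proj (x - \<mu> *\<^sub>C 1)) d"
  shows "algebraic_element x"
proof -
  obtain ls where "roots_prod x ls \<in> socle" using polynomial_in_socle_if_all_drazin[OF dr] by blast
  then have "roots_prod x (0 # ls) \<in> socle" by (simp add: socle_mult_left)
  then show ?thesis using socle_algebraic[OF ss] algebraic_if_roots_prod_algebraic by blast
qed

lemma drazin_soc_proj: "drazin a b \<Longrightarrow> drazin (soc_proj a) (soc_proj b)"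
  unfolding drazin_def by (metis soc_proj_simps(6) soc_proj_power)

section \<open>Commuting perturbations that preserve the B-Fredholm property\<close>

text \<open>For \<open>q\<close> the product of the linear factors \<open>X - l\<close>, this is the polynomial
\<open>(q(X) - q(Y)) / (X - Y)\<close> with \<open>X\<close> and \<open>Y\<close> acting on \<open>a\<close> as left and right
multiplication by \<open>f\<close>. The commutator of \<open>f\<close> with the result is \<open>q(f) a - a q(f)\<close>.\<close>

primrec divided_difference :: "'a::complex_banach_algebra_1 \<Rightarrow> complex list \<Rightarrow> 'a \<Rightarrow> 'a" where
  "divided_difference f [] a = 0"
| "divided_difference f (l # ls) a = roots_prod f ls * a + divided_difference f ls a * (f - l *\<^sub>C 1)"

lemma divided_difference_commutator:
  "f * divided_difference f ls a - divided_difference f ls a * f = roots_prod f ls * a - a * roots_prod f ls"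
proof (induction ls)
  case (Cons l ls)
  define P where "P = roots_prod f ls"
  define D where "D = divided_difference f ls a"
  define g where "g = f - l *\<^sub>C 1"
  have gf: "g * f = f * g" unfolding g_def by (simp add: ring_distribs)
  have Pg: "P * g = g * P" unfolding P_def g_def
    using roots_prod_snoc[of f ls l] by simp
  have "f * (P * a + D * g) - (P * a + D * g) * f = f * P * a - P * a * f + (f * D - D * f) * g"
    using gf by (simp add: algebra_simps)
  also have "f * D - D * f = P * a - a * P" using Cons unfolding D_def P_def .
  also have "f * P * a - P * a * f + (P * a - a * P) * g = (f * P * a - P * a * (f - g)) - a * (P * g)"
    by (simp add: algebra_simps)
  also have "\<dots> = g * P * a - a * (g * P)"
    unfolding Pg by (simp add: g_def left_diff_distrib)
  finally show ?case by (simp add: P_def D_def g_def)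
qed simp

lemma divided_difference_annihilates:
  assumes "a * s = 0" "f * s = s * f"
  shows "divided_difference f ls a * s = 0"
proof (induction ls)
  case (Cons l ls)
  have "(f - l *\<^sub>C 1) * s = s * (f - l *\<^sub>C 1)"
    using assms(2) by (simp add: ring_distribs)
  then have "divided_difference f (l # ls) a * s
      = roots_prod f ls * (a * s) + divided_difference f ls a * s * (f - l *\<^sub>C 1)"
    by (simp add: distrib_right mult.assoc)
  then show ?case using assms(1) Cons by simp
qed simp

text \<open>For large \<open>k\<close> the factor \<open>y + k\<close> of \<open>f (y + k)\<close> is invertible with small inverse \<open>z\<close>, so
\<open>c z\<close> is a small Drazin inverse of \<open>f (y + k)\<close>, and \<open>\<mu>\<close> falls into the punctured disc
in which \<open>f (y + k) - \<mu>\<close> is invertible.\<close>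

lemma large_multiple_drazin:
  fixes f y :: "'a::complex_banach_algebra_1"
  assumes fd: "drazin f c" and fy: "f * y = y * f"
  shows "\<exists>k b. drazin (f * y + of_nat k * f - \<mu> *\<^sub>C 1) b"
proof -
  obtain k :: nat where k: "norm y + cmod \<mu> * norm c + 1 < of_nat k" using reals_Archimedean2 by blast
  then have k0: "norm y < of_nat k" "0 < (of_nat k :: real)"
    using norm_ge_zero[of y] mult_nonneg_nonneg[OF norm_ge_zero[of \<mu>] norm_ge_zero[of c]] by linarith+
  define v where "v = y + of_nat k"
  define r where "r = inverse (real k)"
  have kR: "(of_nat k :: 'a) = real k *\<^sub>R 1" by (metis of_real_def of_real_of_nat_eq)
  have ck: "of_nat k * w = w * of_nat k" for w :: 'a by (rule mult_of_nat_commute)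
  have "norm (- (r *\<^sub>R y)) < 1" using k0 by (simp add: r_def field_simps)
  then obtain z0 where z0: "(1 + r *\<^sub>R y) * z0 = 1" "z0 * (1 + r *\<^sub>R y) = 1"
    using neumann_inverse[of "- (r *\<^sub>R y)"] by auto
  define z where "z = r *\<^sub>R z0"
  have veq: "r *\<^sub>R v = 1 + r *\<^sub>R y"
    using k0 by (simp add: v_def kR r_def scaleR_add_right add.commute)
  have vz: "v * z = 1" "z * v = 1"
    using z0 unfolding veq[symmetric] z_def by simp_all
  have "norm z * (of_nat k - norm y) \<le> 1"
  proof -
    have "of_nat k * z = 1 - y * z" using vz(1) by (simp add: v_def distrib_right eq_diff_eq add.commute)
    then have "norm (of_nat k * z) \<le> 1 + norm y * norm z"
      using norm_triangle_ineq4[of 1 "y * z"] norm_mult_ineq[of y z] by simp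
    moreover have "norm (of_nat k * z) = of_nat k * norm z"
      by (metis norm_scaleR abs_of_nat of_real_of_nat_eq scaleR_conv_of_real)
    ultimately show ?thesis by (simp add: algebra_simps)
  qed
  have small: "cmod \<mu> * norm (c * z) < 1"
  proof -
    have "cmod \<mu> * norm (c * z) \<le> (cmod \<mu> * norm c) * norm z"
      using norm_mult_ineq[of c z] by (simp add: mult_left_mono mult.assoc)
    also have "\<dots> < 1"
    proof (cases "norm z = 0")
      case False
      then have "0 < norm z" by simp
      have "(cmod \<mu> * norm c) * norm z < (of_nat k - norm y) * norm z"
        using k \<open>0 < norm z\<close> by (intro mult_strict_right_mono) auto
      then show ?thesis using \<open>norm z * (of_nat k - norm y) \<le> 1\<close> by (simp add: mult.commute)
    qed simp
    finally show ?thesis .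
  qed
  have fv: "f * v = v * f" unfolding v_def using fy ck[of f] by (simp add: ring_distribs)
  have fc: "f * c = c * f" using fd by (simp add: drazin_def)
  have cv: "c * v = v * c" by (rule drazin_commute[OF fd fv])
  have fz: "f * z = z * f" using vz fv by (metis mult.assoc mult_1_left mult_1_right)
  have cz: "c * z = z * c" using vz cv by (metis mult.assoc mult_1_left mult_1_right)
  have fvcz: "(f * v) * (c * z) = f * c"
    using vz cv by (metis mult.assoc mult_1_right)
  have czfv: "(c * z) * (f * v) = f * c"
    using vz fz fc by (metis mult.assoc mult_1_right)
  have dfv: "drazin (f * v) (c * z)"
  proof -
    obtain m where m: "f ^ m * (f * c) = f ^ m" using drazin_power_absorb[OF fd] .
    have "(f * v) ^ m * (c * z) * (f * v) = (f * v) ^ m * (f * c)" by (metis czfv mult.assoc)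
    also have "\<dots> = v ^ m * (f ^ m * (f * c))"
      using power_mult_commute[of v f m] fv by (simp add: mult.assoc)
    also have "\<dots> = (f * v) ^ m" using m power_mult_commute[of v f m] fv by simp
    finally have "(f * v) ^ m * (c * z) * (f * v) = (f * v) ^ m" .
    moreover have "c * z * (f * v) * (c * z) = c * z"
      unfolding czfv using drazin_absorb(1)[OF fd] by (simp flip: mult.assoc)
    ultimately show ?thesis unfolding drazin_def using fvcz czfv by metis
  qed
  have eq: "f * y + of_nat k * f = f * v" unfolding v_def using ck[of f] by (simp add: distrib_left)
  have "\<exists>b. drazin (f * v - \<mu> *\<^sub>C 1) b"
  proof (cases "\<mu> = 0")
    case True
    then show ?thesis using dfv by auto
  next
    case False
    obtain w where w: "(1 - \<mu> *\<^sub>C (c * z)) * w = 1" "w * (1 - \<mu> *\<^sub>C (c * z)) = 1"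
      using neumann_inverse[of "\<mu> *\<^sub>C (c * z)"] small by (auto simp: norm_scaleC)
    obtain g where "(f * v - \<mu> *\<^sub>C 1) * g = 1" "g * (f * v - \<mu> *\<^sub>C 1) = 1"
      using drazin_isolated[OF dfv, of "\<mu> *\<^sub>C 1" "inverse \<mu> *\<^sub>C 1" w] w False
      by (auto simp: scaleC_scaleC scaleC_one)
    then show ?thesis using drazin_inverse_unit by blast
  qed
  then show ?thesis unfolding eq[symmetric] by blast
qed

text \<open>The property \<open>\<Phi>\<close> stands for B-Fredholm or B-Weyl. The minimal polynomial of \<open>f\<close> modulo
the socle is represented by a shortest list of roots.\<close>

lemma power_in_socle_if_perturbation_invariant:
  fixes f :: "'a::complex_banach_algebra_1" and \<Phi> :: "'a \<Rightarrow> bool"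
  assumes ss: "(jacobson_radical :: 'a set) = {0}"
    and fredholm: "\<And>a. \<Phi> a \<Longrightarrow> b_fredholm a"
    and drazin: "\<And>a b. drazin a b \<Longrightarrow> \<Phi> a"
    and invariant: "\<And>x \<mu>. x * f = f * x \<Longrightarrow> \<Phi> (x + f - \<mu> *\<^sub>C 1) \<longleftrightarrow> \<Phi> (x - \<mu> *\<^sub>C 1)"
  shows "\<exists>n. f ^ n \<in> socle"
proof -
  have all_drazin: "\<exists>d. drazin (soc_proj (x - \<mu> *\<^sub>C 1)) d" if "\<And>\<mu>. \<Phi> (x - \<mu> *\<^sub>C 1)" for x \<mu>
    using fredholm[OF that] unfolding b_fredholm_iff .
  have \<Phi>f: "\<Phi> (f - \<mu> *\<^sub>C 1)" for \<mu>
  proof -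
    have "roots_prod (0 - \<mu> *\<^sub>C 1 :: 'a) [- \<mu>] = 0" by simp
    then obtain b where "drazin (0 - \<mu> *\<^sub>C 1 :: 'a) b"
      using algebraic_drazin unfolding algebraic_element_def by blast
    then show ?thesis using invariant[of 0 \<mu>] drazin by auto
  qed
  obtain c where c: "drazin f c"
    using algebraic_drazin[OF algebraic_if_all_drazin[OF ss all_drazin[OF \<Phi>f]]] by blast
  obtain ls where ls: "roots_prod f ls \<in> socle"
    and min: "\<And>rs. roots_prod f rs \<in> socle \<Longrightarrow> length ls \<le> length rs"
    using polynomial_in_socle_if_all_drazin[OF all_drazin[OF \<Phi>f]]
      ex_has_least_nat[of "\<lambda>ls. roots_prod f ls \<in> socle" _ length] by metis
  show ?thesis
  proof (cases "set ls \<subseteq> {0}")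
    case True
    then have "roots_prod f ls = f ^ length ls" by (induction ls) auto
    then show ?thesis using ls by metis
  next
    case False
    then obtain l where l: "l \<in> set ls" "l \<noteq> 0" by blast
    then obtain as bs where split: "ls = as @ l # bs" by (meson split_list)
    define rs where "rs = as @ bs"
    define u where "u = roots_prod f rs"
    define s where "s = (f - l *\<^sub>C 1) * u"
    have "u \<notin> socle" using min[of rs] unfolding u_def by (auto simp: split rs_def)
    have "s = roots_prod f ls"
      using roots_prod_snoc[of f as l] by (simp add: s_def u_def rs_def split roots_prod_append flip: mult.assoc)
    then have s: "s \<in> socle" using ls by simp
    obtain y where y: "s * y * s = s" using socle_regular[OF ss s] .
    have fu: "f * u = u * f" unfolding u_def using roots_prod_commute[of f f rs] by simp
    have fs: "f * s = s * f"
      unfolding s_def using fu by (simp add: ring_distribs mult.assoc) (metis fu mult.assoc)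
    \<comment> \<open>The elements \<open>p b q\<close> are annihilated by \<open>s\<close> on both sides, and \<open>p\<close>, \<open>q\<close> differ
      from \<open>1\<close> by elements of the socle.\<close>
    define p where "p = 1 - y * s"
    define q where "q = 1 - s * y"
    have ps: "s * p = 0" and qs: "q * s = 0"
      unfolding p_def q_def using y by (simp_all add: ring_distribs mult.assoc)
    have "\<exists>d. drazin (b * (q * u * f * p)) d" for b
    proof -
      define a where "a = p * b * q"
      have as: "a * s = 0" and sa: "s * a = 0"
        unfolding a_def using ps qs by (simp_all add: mult.assoc) (simp_all flip: mult.assoc)
      define E where "E = divided_difference f (l # rs) a"
      have "roots_prod f (l # rs) = s" by (simp add: s_def u_def)
      then have fE: "f * E = E * f"
        using divided_difference_commutator[of f "l # rs" a] as sa unfolding E_def by simp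
      have "divided_difference f rs a * s = 0" by (rule divided_difference_annihilates[OF as fs])
      then have Eu: "E * u = u * a * u"
        unfolding E_def by (simp add: distrib_right mult.assoc flip: s_def u_def)
      define x where "x = f * E"
      have xf: "x * f = f * x" unfolding x_def using fE by (metis mult.assoc)
      \<comment> \<open>Adding \<open>f\<close> repeatedly moves \<open>x - \<mu>\<close> into the region where invertibility is explicit.\<close>
      have shift: "\<Phi> (x + of_nat k * f - \<mu> *\<^sub>C 1) \<longleftrightarrow> \<Phi> (x - \<mu> *\<^sub>C 1)" for k \<mu>
      proof (induction k)
        case (Suc k)
        have "(x + of_nat k * f) * f = f * (x + of_nat k * f)"
          using xf mult_of_nat_commute[of k f] by (simp add: ring_distribs) (metis mult.assoc)
        from invariant[OF this, of \<mu>] show ?case using Suc by (simp add: distrib_right add_ac)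
      qed simp
      have "\<Phi> (x - \<mu> *\<^sub>C 1)" for \<mu>
        using large_multiple_drazin[OF c fE, of \<mu>] drazin shift unfolding x_def by blast
      then have "algebraic_element x" by (intro algebraic_if_all_drazin[OF ss all_drazin])
      then obtain ms where ms: "roots_prod x ms = 0" unfolding algebraic_element_def by blast
      have "x * u = u * (f * a * u)" unfolding x_def using Eu fu by (metis mult.assoc)
      then have "u * roots_prod (f * a * u) ms = 0" using roots_prod_intertwine[of x u "f * a * u" ms] ms by simp
      then have "roots_prod (f * a * u) (0 # ms) = 0" by (simp add: mult.assoc)
      then have "algebraic_element (f * a * u)" unfolding algebraic_element_def by blast
      then have "algebraic_element ((f * p) * (b * q * u))" by (simp add: a_def mult.assoc)
      then have "algebraic_element ((b * q * u) * (f * p))" by (rule algebraic_mult_commute)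
      then show ?thesis using algebraic_drazin by (simp add: mult.assoc)
    qed
    then have v: "q * u * f * p \<in> socle" by (rule in_socle_if_left_multiples_drazin[OF ss])
    have "u * f = q * u * f * p + q * u * f * y * s + s * (y * u * f)"
      unfolding p_def q_def by (simp add: algebra_simps)
    then have "u * f \<in> socle" using v s by (simp add: socle_add socle_mult_left socle_mult_right)
    moreover have "l *\<^sub>C u = u * f - s" unfolding s_def using fu by (simp add: left_diff_distrib)
    ultimately have "l *\<^sub>C u \<in> socle" using s by (simp add: socle_diff)
    then have "inverse l *\<^sub>C l *\<^sub>C u \<in> socle" by (rule socle_scaleC)
    then show ?thesis using l(2) \<open>u \<notin> socle\<close> by (simp add: scaleC_scaleC scaleC_one)
  qed
qed

lemma b_fredholm_add_nilpotent:
  fixes x f :: "'a::complex_banach_algebra_1"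
  assumes xf: "x * f = f * x" and f: "f ^ n \<in> socle" and x: "b_fredholm x"
  shows "b_fredholm (x + f)"
proof -
  obtain d where d: "drazin (soc_proj x) d" using x unfolding b_fredholm_iff by blast
  have "soc_proj x * soc_proj f = soc_proj f * soc_proj x" using xf by (metis soc_proj_simps(6))
  moreover have "soc_proj f ^ n = 0" using f by (simp flip: soc_proj_power add: soc_proj_eq_0_iff)
  ultimately show ?thesis using drazin_add_nilpotent[OF d] unfolding b_fredholm_iff by auto
qed

section \<open>The trace on the socle of a primitive algebra\<close>

text \<open>If \<open>b\<close> does not kill \<open>v\<close>, irreducibility makes the orbit of \<open>b v\<close> the whole space, on which
\<open>a\<close> then vanishes.\<close>

lemma primitive_imp_prime:
  fixes a b :: "'a::complex_banach_algebra_1"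
  assumes prim: "primitive_algebra TYPE('a) TYPE('v::complex_vector)"
    and ab: "\<And>x. a * x * b = 0" and b: "b \<noteq> 0"
  shows "a = 0"
proof -
  obtain V :: "'v set" and \<rho> :: "'a \<Rightarrow> 'v \<Rightarrow> 'v"
    where irr: "irreducible_representation V \<rho>" and faithful: "faithful_on V \<rho>"
    using prim unfolding primitive_algebra_def by blast
  have rep: "representation V \<rho>" using irr unfolding irreducible_representation_def by blast
  have V: "\<And>a x. x \<in> V \<Longrightarrow> \<rho> a x \<in> V"
    and add: "\<And>a b x. x \<in> V \<Longrightarrow> \<rho> (a + b) x = \<rho> a x + \<rho> b x"
    and scale: "\<And>a c x. x \<in> V \<Longrightarrow> \<rho> (c *\<^sub>C a) x = c *\<^sub>C \<rho> a x"
    and mult: "\<And>a b x. x \<in> V \<Longrightarrow> \<rho> (a * b) x = \<rho> a (\<rho> b x)"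
    and one: "\<And>x. x \<in> V \<Longrightarrow> \<rho> 1 x = x"
    using rep unfolding representation_def by blast+
  have zero: "\<rho> 0 x = 0" if "x \<in> V" for x using add[OF that, of 0 0] by simp
  obtain v where v: "v \<in> V" "\<rho> b v \<noteq> 0" using faithful b unfolding faithful_on_def by blast
  define W where "W = range (\<lambda>x. \<rho> x (\<rho> b v))"
  define w where "w = \<rho> b v"
  have w: "w \<in> V" "w \<noteq> 0" using V[OF v(1)] v(2) by (simp_all add: w_def)
  have W: "x \<in> W \<longleftrightarrow> (\<exists>p. x = \<rho> p w)" for x unfolding W_def w_def by blast
  have "csubspace W"
    unfolding csubspace_def W
  proof (intro conjI ballI allI)
    show "\<exists>p. 0 = \<rho> p w" using zero[OF w(1)] by metis
  next
    fix x y assume "x \<in> W" "y \<in> W"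
    then obtain p q where "x = \<rho> p w" "y = \<rho> q w" unfolding W by blast
    then have "x + y = \<rho> (p + q) w" by (simp add: add[OF w(1)])
    then show "\<exists>p. x + y = \<rho> p w" by blast
  next
    fix c x assume "x \<in> W"
    then obtain p where "x = \<rho> p w" unfolding W by blast
    then have "c *\<^sub>C x = \<rho> (c *\<^sub>C p) w" by (simp add: scale[OF w(1)])
    then show "\<exists>p. c *\<^sub>C x = \<rho> p w" by blast
  qed
  moreover have "W \<subseteq> V" unfolding W_def using V[OF V[OF v(1)]] by blast
  moreover have "\<rho> a y \<in> W" if y: "y \<in> W" for a y
  proof -
    obtain p where "y = \<rho> p w" using y unfolding W by blast
    then have "\<rho> a y = \<rho> (a * p) w" by (simp add: mult[OF w(1)])
    then show ?thesis unfolding W by blast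
  qed
  moreover have "w \<in> W" unfolding W using one[OF w(1)] by metis
  ultimately have "W = V"
    using irr w(2) unfolding irreducible_representation_def by blast
  have "\<rho> a y = 0" if y: "y \<in> V" for y
  proof -
    obtain x where "y = \<rho> x (\<rho> b v)" using \<open>W = V\<close> y unfolding W_def by blast
    then have "\<rho> a y = \<rho> (a * x * b) v" using mult v(1) V by simp
    then show ?thesis using ab zero[OF v(1)] by simp
  qed
  then show ?thesis using faithful unfolding faithful_on_def by blast
qed

text \<open>These properties determine the trace, and they are all that the theory of the index needs.\<close>

locale socle_trace =
  fixes tr :: "'a::complex_banach_algebra_1 \<Rightarrow> complex"
  assumes semisimple: "(jacobson_radical :: 'a set) = {0}"
    and tr_add: "\<And>s s'. s \<in> socle \<Longrightarrow> s' \<in> socle \<Longrightarrow> tr (s + s') = tr s + tr s'"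
    and tr_scale: "\<And>c s. s \<in> socle \<Longrightarrow> tr (c *\<^sub>C s) = c * tr s"
    and tr_commute: "\<And>s y. s \<in> socle \<Longrightarrow> tr (s * y) = tr (y * s)"
    and tr_minimal: "\<And>e. minimal_idempotent e \<Longrightarrow> tr e = 1"

text \<open>The trace of the operator of left multiplication on \<open>A e\<close>, for a minimal idempotent \<open>e\<close>, computed
as the sum of the diagonal coefficients in a Hamel basis. This is visibly linear where only finitely
many coefficients are nonzero; and for the rank one operators \<open>a e b\<close>, which span the socle
because the algebra is prime, it is the scalar \<open>\<kappa>\<close> with \<open>e b a e = \<kappa> e\<close>.\<close>

lemma socle_trace_exists:
  assumes ss: "(jacobson_radical :: 'a::complex_banach_algebra_1 set) = {0}"
    and soc: "(socle :: 'a set) \<noteq> {0}"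
    and prime: "\<And>a b :: 'a. (\<And>x. a * x * b = 0) \<Longrightarrow> b \<noteq> 0 \<Longrightarrow> a = 0"
  shows "\<exists>tr :: 'a \<Rightarrow> complex. socle_trace tr"
proof -
  obtain e :: 'a where e: "minimal_idempotent e"
  proof -
    obtain s :: 'a where "s \<in> socle" "s \<noteq> 0" using soc socle_zero by blast
    then have "\<exists>R :: 'a set. minimal_right_ideal R"
      by (induction rule: socle_induct) auto
    then show ?thesis using minimal_right_ideal_idempotent[OF ss] that by blast
  qed
  have ee: "e * e = e" and e0: "e \<noteq> 0"
    using e minimal_idempotent_idem minimal_idempotent_nonzero by auto
  define \<kappa> where "\<kappa> y = (SOME \<mu>. e * y * e = \<mu> *\<^sub>C e)" for y
  have \<kappa>: "e * y * e = \<kappa> y *\<^sub>C e" for y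
    unfolding \<kappa>_def by (rule someI_ex) (metis minimal_idempotent_corner[OF e])
  have \<kappa>_eq: "\<kappa> y = \<mu>" if "e * y * e = \<mu> *\<^sub>C e" for y \<mu>
    using that \<kappa>[of y] cvec.scale_right_imp_eq[OF e0] by metis
  have \<kappa>_add: "\<kappa> (y + z) = \<kappa> y + \<kappa> z" for y z
    by (rule \<kappa>_eq) (simp add: ring_distribs \<kappa> scaleC_add_left)
  have \<kappa>_scale: "\<kappa> (c *\<^sub>C y) = c * \<kappa> y" for y c
    by (rule \<kappa>_eq) (simp add: \<kappa> scaleC_scaleC)
  have \<kappa>_sum: "\<kappa> (\<Sum>v\<in>F. g v) = (\<Sum>v\<in>F. \<kappa> (g v))" for g and F :: "'a set"
  proof (induction F rule: infinite_finite_induct)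
    case empty
    show ?case by (auto intro: \<kappa>_eq)
  qed (auto simp: \<kappa>_add intro: \<kappa>_eq)
  define V where "V = {v :: 'a. v * e = v}"
  obtain B where B: "B \<subseteq> V" "cvec.independent B" "V \<subseteq> cvec.span B"
    using cvec.maximal_independent_subset[of V] by blast
  define r where "r = cvec.representation B"
  have V_mult: "a * v \<in> V" if "v \<in> V" for a v using that unfolding V_def by (simp add: mult.assoc)
  have aV: "a * e \<in> V" for a unfolding V_def by (simp add: mult.assoc ee)
  have r_add: "r (v + w) u = r v u + r w u" if "v \<in> V" "w \<in> V" for u v w
    unfolding r_def using cvec.representation_add[OF B(2)] that B(3) by (auto simp: subset_iff)
  have r_scale: "r (c *\<^sub>C v) u = c * r v u" if "v \<in> V" for c u v
    unfolding r_def using cvec.representation_scale[OF B(2)] that B(3) by (auto simp: subset_iff)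
  have r_fin: "finite {u. r v u \<noteq> 0}" for v
    unfolding r_def by (rule cvec.finite_representation)
  have r_B: "u \<in> B" if "r v u \<noteq> 0" for u v
    using that unfolding r_def by (rule cvec.representation_ne_zero)
  have r_sum: "(\<Sum>u | r v u \<noteq> 0. r v u *\<^sub>C u) = v" if "v \<in> V" for v
    unfolding r_def using cvec.sum_nonzero_representation_eq[OF B(2)] that B(3) by blast
  define supp where "supp s = {v \<in> B. r (s * v) v \<noteq> 0}" for s
  define tr where "tr s = (\<Sum>v\<in>supp s. r (s * v) v)" for s
  have tr_eq: "tr s = (\<Sum>v\<in>F. r (s * v) v)" if "finite F" "supp s \<subseteq> F" "F \<subseteq> B" for s F
    unfolding tr_def by (rule sum.mono_neutral_left) (use that in \<open>auto simp: supp_def\<close>)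
  have BV: "s * v \<in> V" if "v \<in> B" for s v using that B(1) V_mult by blast
  have supp_add: "supp (s + s') \<subseteq> supp s \<union> supp s'" for s s'
    unfolding supp_def using r_add[OF BV BV] by (auto simp: distrib_right)
  have rank1: "r (a * e * b * v) v = \<kappa> (b * v) * r (a * e) v" if "v \<in> B" for a b v
  proof -
    have "v * e = v" using that B(1) unfolding V_def by blast
    then have "e * (b * v) = \<kappa> (b * v) *\<^sub>C e" using \<kappa>[of "b * v"] by (simp add: mult.assoc)
    then have "a * (e * (b * v)) = \<kappa> (b * v) *\<^sub>C (a * e)" by simp
    then have "a * e * b * v = \<kappa> (b * v) *\<^sub>C (a * e)" by (simp only: mult.assoc)
    then show ?thesis using r_scale[OF aV] by simp
  qed
  have supp1: "supp (a * e * b) \<subseteq> {u. r (a * e) u \<noteq> 0}" for a b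
    unfolding supp_def using rank1 by auto
  have tr1: "tr (a * e * b) = \<kappa> (b * a)" for a b
  proof -
    have "tr (a * e * b) = (\<Sum>v | r (a * e) v \<noteq> 0. r (a * e * b * v) v)"
      by (rule tr_eq[OF r_fin supp1]) (use r_B in blast)
    also have "\<dots> = (\<Sum>v | r (a * e) v \<noteq> 0. \<kappa> (b * (r (a * e) v *\<^sub>C v)))"
      by (rule sum.cong) (use r_B rank1 in \<open>auto simp: \<kappa>_scale mult.commute\<close>)
    also have "\<dots> = \<kappa> (b * (a * e))"
      unfolding \<kappa>_sum[symmetric] sum_distrib_left[symmetric] r_sum[OF aV] ..
    also have "\<dots> = \<kappa> (b * a)" by (rule \<kappa>_eq) (simp add: \<kappa>[symmetric] ee mult.assoc)
    finally show ?thesis .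
  qed
  have min_fac: "\<exists>a b. g = g * a * e * b" if g: "minimal_idempotent g" for g
  proof -
    obtain a where "g * a * e \<noteq> 0" using prime[of g e] e0 minimal_idempotent_nonzero[OF g] by blast
    then obtain b where "g * (a * e) * b = g"
      using minimal_idempotent_right_inverse[OF g, of "a * e"] by (metis mult.assoc)
    then show ?thesis by (metis mult.assoc)
  qed
  have soc_ind: "P s" if s: "s \<in> socle" and P0: "P 0"
    and step: "\<And>a b y. y \<in> socle \<Longrightarrow> P y \<Longrightarrow> P (a * e * b + y)" for P s
    using s
  proof (induction rule: socle_induct)
    case (add R x y)
    obtain g where g: "minimal_idempotent g" "R = range ((*) g)"
      using minimal_right_ideal_idempotent[OF ss add(1)] by blast
    obtain a b where ab: "g = g * a * e * b" using min_fac[OF g(1)] by blast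
    obtain z where "x = g * z" using add(2) g(2) by blast
    then have "x = (g * a) * e * (b * z)" using ab by (metis mult.assoc)
    then show ?case using step add(3,4) by metis
  qed (rule P0)
  have aeb_soc: "a * e * b \<in> socle" for a b
    by (intro socle_mult_right socle_mult_left minimal_idempotent_in_socle e)
  have fin: "finite (supp s)" if "s \<in> socle" for s
    using that
  proof (rule soc_ind)
    have "r 0 v = 0" for v using r_scale[of e 0 v] ee by (simp add: V_def)
    then show "finite (supp 0)" by (simp add: supp_def)
  next
    fix a b y assume "finite (supp y)"
    then show "finite (supp (a * e * b + y))"
      using finite_subset[OF supp_add] finite_subset[OF supp1 r_fin] by blast
  qed
  have tr_add: "tr (s + s') = tr s + tr s'" if "s \<in> socle" "s' \<in> socle" for s s'
  proof -
    let ?F = "supp s \<union> supp s'"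
    have F: "finite ?F" "?F \<subseteq> B" using fin that by (auto simp: supp_def)
    have "tr (s + s') = (\<Sum>v\<in>?F. r ((s + s') * v) v)" by (rule tr_eq[OF F(1) supp_add F(2)])
    also have "\<dots> = (\<Sum>v\<in>?F. r (s * v) v + r (s' * v) v)"
      by (rule sum.cong) (use r_add[OF BV BV] F(2) in \<open>auto simp: distrib_right\<close>)
    also have "\<dots> = tr s + tr s'"
      unfolding sum.distrib using tr_eq[OF F(1) _ F(2), of s] tr_eq[OF F(1) _ F(2), of s'] by simp
    finally show ?thesis .
  qed
  have tr0: "tr 0 = 0" using tr_add[of 0 0] by simp
  have tr_scale: "tr (c *\<^sub>C s) = c * tr s" if "s \<in> socle" for c s
    using that
  proof (rule soc_ind)
    fix a b y assume y: "y \<in> socle" "tr (c *\<^sub>C y) = c * tr y"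
    have "c *\<^sub>C (a * e * b) = (c *\<^sub>C a) * e * b" by simp
    moreover have "\<kappa> (b * (c *\<^sub>C a)) = c * \<kappa> (b * a)" by (simp add: \<kappa>_scale)
    ultimately have "tr (c *\<^sub>C (a * e * b)) = c * tr (a * e * b)" by (metis tr1)
    then show "tr (c *\<^sub>C (a * e * b + y)) = c * tr (a * e * b + y)"
      unfolding scaleC_add_right tr_add[OF socle_scaleC[OF aeb_soc] socle_scaleC[OF y(1)]]
        tr_add[OF aeb_soc y(1)] using y(2) by (simp add: distrib_left)
  qed (simp add: tr0)
  have tr_comm: "tr (s * y) = tr (y * s)" if "s \<in> socle" for s y
    using that
  proof (rule soc_ind)
    fix a b z assume z: "z \<in> socle" "tr (z * y) = tr (y * z)"
    have "tr (a * e * b * y) = tr (y * (a * e * b))"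
      using tr1[of a "b * y"] tr1[of "y * a" b] by (simp add: mult.assoc)
    then show "tr ((a * e * b + z) * y) = tr (y * (a * e * b + z))"
      unfolding ring_distribs
      using tr_add z aeb_soc socle_mult_left socle_mult_right by metis
  qed simp
  have tr_min: "tr g = 1" if g: "minimal_idempotent g" for g
  proof -
    obtain a b where ab: "g = g * a * e * b" using min_fac[OF g] by blast
    have gg: "g * g = g" using g by (rule minimal_idempotent_idem)
    define w where "w = e * (b * (g * a)) * e"
    have w: "w = \<kappa> (b * (g * a)) *\<^sub>C e" unfolding w_def by (rule \<kappa>)
    have ee': "e * (e * y) = e * y" and gg': "g * (g * y) = g * y" for y
      using ee gg by (simp_all flip: mult.assoc)
    have "w * w = e * b * (g * a * e * b) * g * a * e"
      unfolding w_def by (simp add: mult.assoc ee ee')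
    also have "\<dots> = w" unfolding ab[symmetric] w_def by (simp add: mult.assoc gg gg')
    finally have "w * w = w" .
    moreover have "w \<noteq> 0"
    proof
      assume "w = 0"
      have "g * a * w * b = (g * a * e * b) * (g * a * e * b)"
        unfolding w_def by (simp add: mult.assoc)
      then have "g * a * w * b = g * g" by (simp only: ab[symmetric])
      then show False using \<open>w = 0\<close> gg minimal_idempotent_nonzero[OF g] by simp
    qed
    ultimately have "\<kappa> (b * (g * a)) = 1"
      unfolding w using ee e0 by (simp add: scaleC_scaleC)
    then show ?thesis using tr1[of "g * a" b] ab by simp
  qed
  show ?thesis
    by (intro exI[of _ tr]) (unfold_locales; use ss tr_add tr_scale tr_comm tr_min in blast)
qed

section \<open>Riesz idempotents of algebraic elements\<close>

lemma circle_integral_pole: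
  fixes \<mu> :: complex
  assumes "0 < r"
  shows "((\<lambda>\<theta>. \<i> * of_real r * cis \<theta> / (\<mu> + of_real r * cis \<theta> - \<mu>) ^ Suc j) has_integral
      (if j = 0 then 2 * pi * \<i> else 0)) {0..2 * pi}"
proof -
  have "((\<lambda>u. 1 / (u - \<mu>) ^ Suc j) has_contour_integral
      (2 * pi * \<i>) / fact j * (deriv ^^ j) (\<lambda>_. 1) \<mu>) (circlepath \<mu> r)"
    by (rule Cauchy_has_contour_integral_higher_derivative_circlepath) (use assms in auto)
  moreover have "(2 * pi * \<i>) / fact j * (deriv ^^ j) (\<lambda>_. 1) \<mu> = (if j = 0 then 2 * pi * \<i> else 0)"
    by (cases j) (simp_all add: funpow_Suc_right del: funpow.simps)
  ultimately have "((\<lambda>t. 1 / (\<mu> + r * cis t - \<mu>) ^ Suc j * r * \<i> * cis t) has_integral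
      (if j = 0 then 2 * pi * \<i> else 0)) {0..2 * pi}"
    unfolding circlepath_def by (subst (asm) has_contour_integral_part_circlepath_iff) simp_all
  then show ?thesis by (rule has_integral_eq[rotated]) simp
qed

lemma circle_integral_outside:
  fixes \<mu> \<nu> :: complex
  assumes "0 < r" "\<nu> \<notin> cball \<mu> r"
  shows "((\<lambda>\<theta>. \<i> * of_real r * cis \<theta> / (\<mu> + of_real r * cis \<theta> - \<nu>) ^ Suc j) has_integral 0) {0..2 * pi}"
proof -
  have "((\<lambda>u. 1 / (u - \<nu>) ^ Suc j) has_contour_integral 0) (circlepath \<mu> r)"
  proof (rule Cauchy_theorem_convex_simple)
    show "(\<lambda>u. 1 / (u - \<nu>) ^ Suc j) holomorphic_on cball \<mu> r"
      using assms(2) by (intro holomorphic_intros) auto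
  qed (use assms in \<open>auto simp: sphere_def\<close>)
  then have "((\<lambda>t. 1 / (\<mu> + r * cis t - \<nu>) ^ Suc j * r * \<i> * cis t) has_integral 0) {0..2 * pi}"
    unfolding circlepath_def by (subst (asm) has_contour_integral_part_circlepath_iff) simp_all
  then show ?thesis by (rule has_integral_eq[rotated]) simp
qed

lemma not_in_spectrum_iff:
  fixes x :: "'a::complex_banach_algebra_1"
  shows "\<mu> \<notin> spectrum x \<longleftrightarrow> (\<exists>y. (\<mu> *\<^sub>C 1 - x) * y = 1 \<and> y * (\<mu> *\<^sub>C 1 - x) = 1)"
  unfolding spectrum_def Units_def by (auto simp: ring_of_type_algebra_def)

lemma inv_ring_of_type_algebra:
  fixes x y :: "'a::ring_1"
  assumes "x * y = 1" "y * x = 1"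
  shows "inv\<^bsub>ring_of_type_algebra\<^esub> x = y"
proof -
  interpret ring "ring_of_type_algebra :: 'a ring" by (rule ring_ring_of_type)
  show ?thesis using inv_unique'[of x y] assms by (simp add: ring_of_type_algebra_def)
qed

lemma roots_prod_shift: "roots_prod (x - \<mu> *\<^sub>C 1) ls = roots_prod x (map (\<lambda>l. l + \<mu>) ls)"
  by (induction ls) (simp_all add: scaleC_add_left algebra_simps)

lemma algebraic_shift:
  assumes "algebraic_element x" shows "algebraic_element (x - \<mu> *\<^sub>C 1)"
proof -
  obtain ls where "roots_prod x ls = 0" using assms unfolding algebraic_element_def by blast
  then have "roots_prod (x - \<mu> *\<^sub>C 1) (map (\<lambda>l. l - \<mu>) ls) = 0"
    unfolding roots_prod_shift by (simp add: comp_def)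
  then show ?thesis unfolding algebraic_element_def by blast
qed

text \<open>The idempotent at \<open>\<mu>\<close> is the complement of the support of \<open>x - \<mu>\<close>; it is \<open>0\<close> exactly
when \<open>x - \<mu>\<close> is invertible. Two of them are orthogonal since \<open>x - \<mu>\<close> and \<open>x - \<nu>\<close>
cannot both be nilpotent on the same nonzero corner, and they add up to \<open>1\<close> since the product of
the supports over all roots contains the factor \<open>roots_prod x ls = 0\<close>.\<close>

lemma spectral_idempotents:
  fixes x :: "'a::complex_banach_algebra_1"
  assumes alg: "algebraic_element x"
  obtains P where "finite (spectrum x)" "(\<Sum>\<mu>\<in>spectrum x. P \<mu>) = 1"
    "\<And>\<mu>. P \<mu> * P \<mu> = P \<mu>" "\<And>\<mu>. x * P \<mu> = P \<mu> * x"
    "\<And>\<mu>. \<exists>k>0. (x - \<mu> *\<^sub>C 1) ^ k * P \<mu> = 0"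
proof -
  obtain c where c: "\<And>\<mu>. drazin (x - \<mu> *\<^sub>C 1) (c \<mu>)"
    using algebraic_drazin[OF algebraic_shift[OF alg]] by metis
  define P where "P \<mu> = 1 - (x - \<mu> *\<^sub>C 1) * c \<mu>" for \<mu>
  have ccom: "c \<mu> * y = y * c \<mu>" if "x * y = y * x" for \<mu> y
    by (rule drazin_commute[OF c]) (use that in \<open>simp add: ring_distribs\<close>)
  have Pcom: "P \<mu> * y = y * P \<mu>" if "x * y = y * x" for \<mu> y
  proof -
    have "(x - \<mu> *\<^sub>C 1) * y = y * (x - \<mu> *\<^sub>C 1)"
      using that by (simp add: ring_distribs)
    then have "(x - \<mu> *\<^sub>C 1) * c \<mu> * y = y * ((x - \<mu> *\<^sub>C 1) * c \<mu>)"
      using ccom[OF that, of \<mu>] by (metis mult.assoc)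
    then show ?thesis unfolding P_def by (simp add: ring_distribs)
  qed
  have xP: "x * P \<mu> = P \<mu> * x" for \<mu> using Pcom[of x] by simp
  have PP: "P \<mu> * P \<mu> = P \<mu>" for \<mu>
    unfolding P_def by (rule idempotent_complement) (rule drazin_idempotent[OF c])
  have nil: "\<exists>k>0. (x - \<mu> *\<^sub>C 1) ^ k * P \<mu> = 0" for \<mu>
  proof -
    obtain k where "0 < k" "(x - \<mu> *\<^sub>C 1) ^ k * ((x - \<mu> *\<^sub>C 1) * c \<mu>) = (x - \<mu> *\<^sub>C 1) ^ k"
      using drazin_power_absorb_pos[OF c] by blast
    then show ?thesis unfolding P_def by (auto simp: right_diff_distrib)
  qed
  have orth: "P \<mu> * P \<nu> = 0" if "\<mu> \<noteq> \<nu>" for \<mu> \<nu>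
  proof -
    obtain k where k: "(x - \<mu> *\<^sub>C 1) ^ k * P \<mu> = 0" using nil by blast
    obtain n where n: "(x - \<nu> *\<^sub>C 1) ^ n * P \<nu> = 0" using nil by blast
    let ?y = "- (x - \<nu> *\<^sub>C 1)"
    have "(x - \<mu> *\<^sub>C 1 + ?y) ^ (k + n) * (P \<mu> * P \<nu>) = 0"
    proof (rule commuting_sum_power_annihilates)
      show "(x - \<mu> *\<^sub>C 1) * ?y = ?y * (x - \<mu> *\<^sub>C 1)" 
        by (simp add: algebra_simps cvec.scale_right_diff_distrib scaleC_scaleC)
      show "(x - \<mu> *\<^sub>C 1) ^ k * (P \<mu> * P \<nu>) = 0" using k by (simp flip: mult.assoc)
      have "?y ^ n = (x - \<nu> *\<^sub>C 1) ^ n \<or> ?y ^ n = - ((x - \<nu> *\<^sub>C 1) ^ n)" by (rule power_minus_cases)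
      then have "?y ^ n * P \<nu> = 0" using n by auto
      moreover have "P \<mu> * P \<nu> = P \<nu> * P \<mu>" by (rule Pcom) (rule xP)
      ultimately show "?y ^ n * (P \<mu> * P \<nu>) = 0" by (metis mult.assoc mult_zero_left)
    qed
    moreover have "x - \<mu> *\<^sub>C 1 + ?y = (\<nu> - \<mu>) *\<^sub>C 1" by (simp add: cvec.scale_left_diff_distrib)
    moreover have "((\<nu> - \<mu>) *\<^sub>C 1 :: 'a) ^ m = (\<nu> - \<mu>) ^ m *\<^sub>C 1" for m
      by (induction m) (simp_all add: scaleC_one scaleC_scaleC mult.commute)
    ultimately show ?thesis using that by simp
  qed
  obtain ls where ls: "roots_prod x ls = 0" using alg unfolding algebraic_element_def by blast
  define Q where "Q = 1 - (\<Sum>\<mu>\<in>set ls. P \<mu>)"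
  have PQ: "P \<mu> * Q = 0" if "\<mu> \<in> set ls" for \<mu>
  proof -
    have "P \<mu> * (\<Sum>\<nu>\<in>set ls. P \<nu>) = (\<Sum>\<nu>\<in>set ls. if \<nu> = \<mu> then P \<mu> else 0)"
      unfolding sum_distrib_left by (rule sum.cong) (use orth PP in auto)
    then show ?thesis using that unfolding Q_def by (simp add: right_diff_distrib)
  qed
  have "\<exists>C. Q = C * roots_prod x ms * Q" if "set ms \<subseteq> set ls" for ms
    using that
  proof (induction ms)
    case Nil
    show ?case by (intro exI[of _ 1]) simp
  next
    case (Cons \<mu> ms)
    then obtain C where C: "Q = C * roots_prod x ms * Q" by auto
    have Q: "Q = (x - \<mu> *\<^sub>C 1) * c \<mu> * Q"
      using PQ[of \<mu>] Cons(2) unfolding P_def by (simp add: left_diff_distrib)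
    have "c \<mu> * (x - \<mu> *\<^sub>C 1) = (x - \<mu> *\<^sub>C 1) * c \<mu>" using c[of \<mu>] by (simp add: drazin_def)
    then have "Q = C * roots_prod x ms * (c \<mu> * (x - \<mu> *\<^sub>C 1)) * Q" using C Q by (metis mult.assoc)
    also have "roots_prod x ms * (c \<mu> * (x - \<mu> *\<^sub>C 1)) = c \<mu> * roots_prod x (\<mu> # ms)"
      using ccom[of "roots_prod x ms" \<mu>] roots_prod_commute[of x x ms] roots_prod_snoc[of x ms \<mu>]
      by (metis mult.assoc)
    then have "C * roots_prod x ms * (c \<mu> * (x - \<mu> *\<^sub>C 1)) * Q = (C * c \<mu>) * roots_prod x (\<mu> # ms) * Q"
      by (simp only: mult.assoc)
    finally show ?case by blast
  qed
  then have "Q = 0" using ls by fastforce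
  then have sum1: "(\<Sum>\<mu>\<in>set ls. P \<mu>) = 1" by (simp add: Q_def)
  have P0: "P \<mu> = 0" if "\<mu> \<notin> set ls" for \<mu>
  proof -
    have "P \<mu> = P \<mu> * (\<Sum>\<nu>\<in>set ls. P \<nu>)" by (simp add: sum1)
    also have "\<dots> = 0" unfolding sum_distrib_left by (intro sum.neutral ballI) (metis orth that)
    finally show ?thesis .
  qed
  have spec: "\<mu> \<in> spectrum x \<longleftrightarrow> P \<mu> \<noteq> 0" for \<mu>
  proof
    assume "\<mu> \<in> spectrum x"
    show "P \<mu> \<noteq> 0"
    proof
      assume "P \<mu> = 0"
      then have 1: "(x - \<mu> *\<^sub>C 1) * c \<mu> = 1" by (simp add: P_def)
      moreover have "c \<mu> * (x - \<mu> *\<^sub>C 1) = 1" using 1 c[of \<mu>] by (simp add: drazin_def)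
      ultimately have "(\<mu> *\<^sub>C 1 - x) * (- c \<mu>) = 1 \<and> (- c \<mu>) * (\<mu> *\<^sub>C 1 - x) = 1"
        by (simp add: ring_distribs)
      then show False using \<open>\<mu> \<in> spectrum x\<close> not_in_spectrum_iff by blast
    qed
  next
    assume P: "P \<mu> \<noteq> 0"
    show "\<mu> \<in> spectrum x"
    proof (rule ccontr)
      assume "\<mu> \<notin> spectrum x"
      then obtain y where "y * (\<mu> *\<^sub>C 1 - x) = 1" using not_in_spectrum_iff by blast
      then have y: "(- y) * (x - \<mu> *\<^sub>C 1) = 1" by (simp add: right_diff_distrib)
      have inj: "w = 0" if "(x - \<mu> *\<^sub>C 1) ^ k * w = 0" for k w
        using that
      proof (induction k arbitrary: w)
        case (Suc k)
        then have "(x - \<mu> *\<^sub>C 1) ^ k * ((x - \<mu> *\<^sub>C 1) * w) = 0"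
          by (metis mult.assoc power_Suc2)
        then have "(x - \<mu> *\<^sub>C 1) * w = 0" by (rule Suc.IH)
        then have "(- y) * (x - \<mu> *\<^sub>C 1) * w = 0" by (simp only: mult.assoc mult_zero_right)
        then show ?case by (simp only: y mult_1_left)
      qed simp
      show False using nil[of \<mu>] inj P by blast
    qed
  qed
  have sub: "spectrum x \<subseteq> set ls" using spec P0 by blast
  then have "finite (spectrum x)" by (rule finite_subset) simp
  moreover have "(\<Sum>\<mu>\<in>spectrum x. P \<mu>) = 1"
    unfolding sum1[symmetric] by (rule sum.mono_neutral_left) (use sub spec in auto)
  ultimately show ?thesis using that PP xP nil by blast
qed

lemma bounded_linear_scaleC_left: "bounded_linear (\<lambda>c. c *\<^sub>C (v :: 'a::complex_banach_algebra_1))"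
proof (rule bounded_linear_intro[where K = "norm v"])
  show "(r *\<^sub>R c) *\<^sub>C v = r *\<^sub>R (c *\<^sub>C v)" for r c
    by (simp add: scaleR_scaleC scaleC_scaleC scaleR_conv_of_real)
qed (simp_all add: scaleC_add_left norm_scaleC)

lemma riesz_idempotent_eq:
  fixes x :: "'a::complex_banach_algebra_1"
  assumes fin: "finite (spectrum x)" and sum1: "(\<Sum>\<mu>\<in>spectrum x. P \<mu>) = 1"
    and nil: "\<And>\<mu>. \<exists>k>0. (x - \<mu> *\<^sub>C 1) ^ k * P \<mu> = 0" and xP: "\<And>\<mu>. x * P \<mu> = P \<mu> * x"
    and \<mu>: "\<mu> \<in> spectrum x"
  shows "riesz_idempotent x \<mu> = P \<mu>"
proof -
  define good where "good r \<longleftrightarrow> 0 < r \<and> cball \<mu> r \<inter> spectrum x \<subseteq> {\<mu>}" for r :: real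
  define r where "r = (SOME r. good r)"
  have "\<exists>r. good r"
  proof -
    obtain d where d: "0 < d" "\<And>\<nu>. \<nu> \<in> spectrum x \<Longrightarrow> \<nu> \<noteq> \<mu> \<Longrightarrow> d \<le> dist \<mu> \<nu>"
      using finite_set_avoid[OF fin, of \<mu>] by blast
    then have "good (d / 2)" unfolding good_def by fastforce
    then show ?thesis by blast
  qed
  then have "good r" unfolding r_def by (rule someI_ex)
  then have r: "0 < r" and r': "\<And>\<nu>. \<nu> \<in> spectrum x \<Longrightarrow> \<nu> \<noteq> \<mu> \<Longrightarrow> \<nu> \<notin> cball \<mu> r"
    unfolding good_def by auto
  define z where "z \<theta> = \<mu> + of_real r * cis \<theta>" for \<theta>
  have z: "z \<theta> \<notin> spectrum x" for \<theta>
  proof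
    assume "z \<theta> \<in> spectrum x"
    moreover have "z \<theta> \<noteq> \<mu>" using r by (simp add: z_def)
    moreover have "z \<theta> \<in> cball \<mu> r" using r by (simp add: z_def dist_norm norm_mult)
    ultimately show False using r' by blast
  qed
  obtain k where k: "\<And>\<nu>. (x - \<nu> *\<^sub>C 1) ^ k \<nu> * P \<nu> = 0" using nil by metis
  define w where "w \<nu> j = (x - \<nu> *\<^sub>C 1) ^ j * P \<nu>" for \<nu> j
  \<comment> \<open>By the partial fraction decomposition of the resolvent only the term with a simple pole
    at \<open>\<mu>\<close> contributes to the integral.\<close>
  define g where "g \<theta> = (\<Sum>\<nu>\<in>spectrum x. \<Sum>j<k \<nu>. (1 / (z \<theta> - \<nu>) ^ Suc j) *\<^sub>C w \<nu> j)" for \<theta>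
  have inv: "inv\<^bsub>ring_of_type_algebra\<^esub> (z \<theta> *\<^sub>C 1 - x) = g \<theta>" for \<theta>
  proof -
    obtain y where y: "(z \<theta> *\<^sub>C 1 - x) * y = 1" "y * (z \<theta> *\<^sub>C 1 - x) = 1"
      using z not_in_spectrum_iff by blast
    have "(z \<theta> *\<^sub>C 1 - x) * (\<Sum>j<k \<nu>. (1 / (z \<theta> - \<nu>) ^ Suc j) *\<^sub>C w \<nu> j) = P \<nu>"
      if "\<nu> \<in> spectrum x" for \<nu>
    proof -
      define h where "h = z \<theta> - \<nu>"
      have h: "h \<noteq> 0" using z[of \<theta>] that by (auto simp: h_def)
      define q where "q = inverse h *\<^sub>C (x - \<nu> *\<^sub>C 1)"
      have qj: "q ^ j = inverse h ^ j *\<^sub>C (x - \<nu> *\<^sub>C 1) ^ j" for j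
        by (induction j) (simp_all add: q_def scaleC_one scaleC_scaleC mult.commute)
      have "z \<theta> *\<^sub>C 1 - x = h *\<^sub>C (1 - q)"
        using h by (simp add: q_def h_def cvec.scale_right_diff_distrib scaleC_scaleC scaleC_one
            cvec.scale_left_diff_distrib)
      moreover have "(\<Sum>j<k \<nu>. (1 / h ^ Suc j) *\<^sub>C w \<nu> j) = inverse h *\<^sub>C ((\<Sum>j<k \<nu>. q ^ j) * P \<nu>)"
        unfolding sum_distrib_right cvec.scale_sum_right
        by (rule sum.cong) (simp_all add: qj w_def scaleC_scaleC divide_inverse power_inverse)
      ultimately have "(z \<theta> *\<^sub>C 1 - x) * (\<Sum>j<k \<nu>. (1 / h ^ Suc j) *\<^sub>C w \<nu> j)
          = (1 - q) * (\<Sum>j<k \<nu>. q ^ j) * P \<nu>"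
        using h by (simp add: scaleC_scaleC scaleC_one mult.assoc)
      also have "\<dots> = P \<nu>" unfolding geometric_telescope using k by (simp add: left_diff_distrib qj)
      finally show ?thesis by (simp add: h_def)
    qed
    then have "(z \<theta> *\<^sub>C 1 - x) * g \<theta> = 1"
      unfolding g_def sum_distrib_left sum1[symmetric] by (intro sum.cong) auto
    then have "y = g \<theta>" using y by (metis mult.assoc mult_1_left mult_1_right)
    then show ?thesis using y by (intro inv_ring_of_type_algebra) auto
  qed
  have int: "((\<lambda>\<theta>. (\<i> * of_real r * cis \<theta> / (z \<theta> - \<nu>) ^ Suc j) *\<^sub>C w \<nu> j) has_integral
      (if \<nu> = \<mu> \<and> j = 0 then (2 * pi * \<i>) *\<^sub>C P \<mu> else 0)) {0..2 * pi}"
    if "\<nu> \<in> spectrum x" for \<nu> j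
  proof -
    have "((\<lambda>\<theta>. \<i> * of_real r * cis \<theta> / (z \<theta> - \<nu>) ^ Suc j) has_integral
      (if \<nu> = \<mu> \<and> j = 0 then 2 * pi * \<i> else 0)) {0..2 * pi}"
    proof (cases "\<nu> = \<mu>")
      case True
      then show ?thesis using circle_integral_pole[OF r, of \<mu> j] by (simp add: z_def)
    next
      case False
      then show ?thesis using circle_integral_outside[OF r r'[OF that False], of j] by (simp add: z_def)
    qed
    from has_integral_linear[OF this bounded_linear_scaleC_left[of "w \<nu> j"]]
    show ?thesis by (auto simp: comp_def w_def)
  qed
  have "((\<lambda>\<theta>. (\<i> * of_real r * cis \<theta>) *\<^sub>C g \<theta>) has_integral
      (\<Sum>\<nu>\<in>spectrum x. \<Sum>j<k \<nu>. if \<nu> = \<mu> \<and> j = 0 then (2 * pi * \<i>) *\<^sub>C P \<mu> else 0)) {0..2 * pi}"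
  proof -
    have "(\<i> * of_real r * cis \<theta>) *\<^sub>C g \<theta>
        = (\<Sum>\<nu>\<in>spectrum x. \<Sum>j<k \<nu>. (\<i> * of_real r * cis \<theta> / (z \<theta> - \<nu>) ^ Suc j) *\<^sub>C w \<nu> j)" for \<theta>
      unfolding g_def cvec.scale_sum_right by (intro sum.cong) (simp_all add: scaleC_scaleC)
    then show ?thesis using int fin by (simp only:) (intro has_integral_sum; simp)
  qed
  moreover have "(\<Sum>\<nu>\<in>spectrum x. \<Sum>j<k \<nu>. if \<nu> = \<mu> \<and> j = 0 then (2 * pi * \<i>) *\<^sub>C P \<mu> else 0)
      = (2 * pi * \<i>) *\<^sub>C P \<mu>"
  proof -
    have "(\<Sum>j<k \<nu>. if \<nu> = \<mu> \<and> j = 0 then (2 * pi * \<i>) *\<^sub>C P \<mu> else 0)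
        = (if \<nu> = \<mu> then (2 * pi * \<i>) *\<^sub>C P \<mu> else 0)" for \<nu>
    proof (cases "k \<nu> = 0")
      case True
      then have "P \<nu> = 0" using k[of \<nu>] by simp
      then show ?thesis using True by auto
    qed (auto simp: sum.delta)
    then show ?thesis using fin \<mu> by (simp add: sum.delta)
  qed
  ultimately have "integral {0..2 * pi} (\<lambda>\<theta>. (\<i> * of_real r * cis \<theta>) *\<^sub>C g \<theta>) = (2 * pi * \<i>) *\<^sub>C P \<mu>"
    by (simp add: integral_unique)
  then have "integral {0..2 * pi} (\<lambda>\<theta>. (\<i> * of_real r * cis \<theta>) *\<^sub>C
      inv\<^bsub>ring_of_type_algebra\<^esub> ((\<mu> + of_real r * cis \<theta>) *\<^sub>C 1 - x)) = (2 * pi * \<i>) *\<^sub>C P \<mu>"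
    using inv unfolding z_def by simp
  then show ?thesis
    unfolding riesz_idempotent_def Let_def good_def[symmetric] r_def[symmetric]
    by (simp add: scaleC_scaleC scaleC_one)
qed

section \<open>The trace of the spectral definition is the linear trace\<close>

context socle_trace
begin

lemma tr_zero [simp]: "tr 0 = 0"
  using tr_add[of 0 0] by simp

lemma tr_sum:
  assumes "\<And>i. i \<in> A \<Longrightarrow> g i \<in> socle"
  shows "(\<Sum>i\<in>A. g i) \<in> socle \<and> tr (\<Sum>i\<in>A. g i) = (\<Sum>i\<in>A. tr (g i))"
  using assms
proof (induction A rule: infinite_finite_induct)
  case (insert i A)
  then show ?case
    using tr_add[of "g i" "sum g A"] socle_add[of "g i" "sum g A"] insert.prems[of i] by simp
qed auto

lemma tr_sum_minimal:
  assumes "finite E" "\<And>e. e \<in> E \<Longrightarrow> minimal_idempotent e"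
  shows "\<Sum>E \<in> socle" "tr (\<Sum>E) = of_nat (card E)"
  using tr_sum[of E "\<lambda>e. e"] assms minimal_idempotent_in_socle tr_minimal by auto

lemma tr_idempotent_cong:
  assumes "p \<in> socle" "q \<in> socle" "p * p = p" "q * q = q" "range ((*) p) = range ((*) q)"
  shows "tr p = tr q"
proof -
  have "p \<in> range ((*) q)" "q \<in> range ((*) p)" using assms(5) by (metis mult_1_right rangeI)+
  then have "q * p = p" "p * q = q"
    using in_range_idempotent[OF assms(4)] in_range_idempotent[OF assms(3)] by blast+
  then show ?thesis using tr_commute[OF assms(1), of q] by simp
qed

text \<open>A family of minimal right ideals with sum \<open>p A\<close> can be replaced by at most as many
orthogonal minimal idempotents, and their number is always the trace of \<open>p\<close>. So no such family is
smaller than an orthogonal one.\<close>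

lemma idempotent_rank_eq_tr:
  assumes p: "p \<in> socle" "p * p = p"
  shows "of_nat (idempotent_rank p) = tr p"
proof -
  obtain E where E: "finite E" "\<And>e. e \<in> E \<Longrightarrow> minimal_idempotent e"
    "\<And>e e'. e \<in> E \<Longrightarrow> e' \<in> E \<Longrightarrow> e \<noteq> e' \<Longrightarrow> e * e' = 0" and pE: "range ((*) p) = range ((*) (\<Sum>E))"
    by (rule socle_idempotent_decomposition[OF semisimple p]) blast
  have idemE: "\<And>e. e \<in> E \<Longrightarrow> e * e = e" using E(2) minimal_idempotent_idem by blast
  have qq: "\<Sum>E * \<Sum>E = \<Sum>E" and eq: "\<And>e. e \<in> E \<Longrightarrow> \<Sum>E * e = e"
    using sum_orthogonal_idempotents[OF E(1) idemE E(3)] by auto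
  have trp: "tr p = of_nat (card E)"
    using tr_idempotent_cong[OF p(1) tr_sum_minimal(1)[OF E(1,2)] p(2) qq pE] tr_sum_minimal(2)[OF E(1,2)]
    by simp
  have "idempotent_rank p = card E"
    unfolding idempotent_rank_def
  proof (rule Least_equality)
    define F where "F = (\<lambda>e. range ((*) e)) ` E"
    have "inj_on (\<lambda>e. range ((*) e)) E"
    proof (rule inj_onI)
      fix e e' assume e: "e \<in> E" "e' \<in> E" "range ((*) e) = range ((*) e')"
      have "e \<in> range ((*) e')" using e(3) by (metis mult_1_right rangeI)
      then have "e' * e = e" using idemE[OF e(2)] by (simp add: in_range_idempotent)
      then show "e = e'" using E(3)[OF e(2,1)] minimal_idempotent_nonzero[OF E(2)[OF e(1)]] by auto
    qed
    then have cF: "card F = card E" unfolding F_def by (rule card_image)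
    have mF: "\<forall>R\<in>F. minimal_right_ideal R"
      unfolding F_def using E(2) by (auto simp: minimal_idempotent_def)
    have "ideal_sum F = range ((*) p)"
      unfolding pE
    proof (intro Set.equalityI subsetI)
      fix x assume "x \<in> ideal_sum F"
      then have "\<Sum>E * x = x"
      proof (induction rule: ideal_sum_induct)
        case (add R r y)
        then obtain e a where "e \<in> E" "r = e * a" unfolding F_def by auto
        then have "\<Sum>E * r = r" using eq by (simp flip: mult.assoc)
        then show ?case using add by (simp add: distrib_left)
      qed simp
      then show "x \<in> range ((*) (\<Sum>E))" using qq by (simp add: in_range_idempotent)
    next
      fix x assume "x \<in> range ((*) (\<Sum>E))"
      then obtain a where x: "x = \<Sum>E * a" by blast
      have "(\<Sum>e\<in>E'. e * a) \<in> ideal_sum F" if "E' \<subseteq> E" for E'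
        using finite_subset[OF that E(1)] that
      proof (induction E' rule: finite_induct)
        case (insert e E')
        then have "e * a \<in> ideal_sum F" by (intro ideal_sum_incl[of "range ((*) e)"]) (auto simp: F_def)
        then show ?case using insert by (simp add: ideal_sum_add)
      qed (simp add: ideal_sum_zero)
      then show "x \<in> ideal_sum F" unfolding x sum_distrib_right by simp
    qed
    then show "\<exists>F. finite F \<and> card F = card E \<and> (\<forall>R\<in>F. minimal_right_ideal R) \<and> ideal_sum F = range ((*) p)"
      using cF mF E(1) by (intro exI[of _ F]) (auto simp: F_def)
  next
    fix n
    assume "\<exists>F. finite F \<and> card F = n \<and> (\<forall>R\<in>F. minimal_right_ideal R) \<and> ideal_sum F = range ((*) p)"
    then obtain F where F: "finite F" "card F = n" "\<forall>R\<in>F. minimal_right_ideal R" "ideal_sum F = range ((*) p)"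
      by blast
    obtain E' where E': "finite E'" "card E' \<le> card F" "\<And>e. e \<in> E' \<Longrightarrow> minimal_idempotent e"
      "\<And>e e'. e \<in> E' \<Longrightarrow> e' \<in> E' \<Longrightarrow> e \<noteq> e' \<Longrightarrow> e * e' = 0"
      and FE': "ideal_sum F = range ((*) (\<Sum>E'))"
      by (rule finite_sum_minimal_right_ideals[OF semisimple F(1)]) (use F(3) in blast)+
    have "\<Sum>E' * \<Sum>E' = \<Sum>E'"
      using sum_orthogonal_idempotents(3)[OF E'(1)] E'(3,4) minimal_idempotent_idem by blast
    then have "tr p = of_nat (card E')"
      using tr_idempotent_cong[OF p(1) tr_sum_minimal(1)[OF E'(1,3)] p(2)] FE' F(4)
        tr_sum_minimal(2)[OF E'(1,3)] by simp
    then have "card E = card E'" using trp by simp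
    then show "card E \<le> n" using E'(2) F(2) by simp
  qed
  then show ?thesis using trp by simp
qed

text \<open>Compressing a nilpotent element to its range lowers the order of nilpotency and
preserves the trace.\<close>

lemma tr_nilpotent:
  assumes "s \<in> socle" "s ^ k = 0"
  shows "tr s = 0"
  using assms
proof (induction k arbitrary: s)
  case 0
  then have "s = s * 0" by (metis mult_1_right power_0)
  then show ?case by simp
next
  case (Suc k)
  obtain y where y: "s * y * s = s" using socle_regular[OF semisimple Suc(2)] .
  define q where "q = s * y"
  have qs: "q * s = s" using y by (simp add: q_def)
  have pow: "(s * q) ^ j * q = s ^ j * q" for j
  proof (induction j)
    case (Suc j)
    have "(s * q) ^ Suc j * q = s * q * ((s * q) ^ j * q)" by (simp add: mult.assoc)
    also have "\<dots> = s * (q * (s ^ j * q))" by (simp only: Suc mult.assoc)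
    also have "q * (s ^ j * q) = s ^ j * q"
      by (cases j) (simp_all add: qs q_def y flip: mult.assoc)
    finally show ?case by (simp add: mult.assoc)
  qed simp
  show ?case
  proof (cases k)
    case 0
    then show ?thesis using Suc(3) by simp
  next
    case (Suc j)
    have qq: "q * q = q" using qs by (simp add: q_def flip: mult.assoc)
    have "(s * q) ^ k = (s * q) ^ k * q"
      unfolding Suc power_Suc2 by (simp add: mult.assoc qq)
    also have "\<dots> = s ^ Suc k * y" unfolding pow by (simp add: q_def power_commutes flip: mult.assoc)
    also have "\<dots> = 0" using Suc.prems(2) by simp
    finally have "tr (s * q) = 0" using Suc.IH socle_mult_right[OF Suc.prems(1)] by blast
    then show ?thesis using tr_commute[OF Suc.prems(1), of q] qs by simp
  qed
qed

text \<open>The part of \<open>s\<close> at a spectral value \<open>\<mu>\<close> is \<open>\<mu>\<close> times the Riesz idempotent plus a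
nilpotent element, which contributes nothing to the trace.\<close>

lemma soc_trace_eq_tr:
  assumes s: "s \<in> socle"
  shows "soc_trace s = tr s"
proof -
  obtain P where fin: "finite (spectrum s)" and sum1: "(\<Sum>\<mu>\<in>spectrum s. P \<mu>) = 1"
    and PP: "\<And>\<mu>. P \<mu> * P \<mu> = P \<mu>" and xP: "\<And>\<mu>. s * P \<mu> = P \<mu> * s"
    and nil: "\<And>\<mu>. \<exists>k>0. (s - \<mu> *\<^sub>C 1) ^ k * P \<mu> = 0"
    by (rule spectral_idempotents[OF socle_algebraic[OF semisimple s]]) blast
  have part: "tr (s * P \<mu>) = \<mu> * of_nat (alg_multiplicity \<mu> s)" if \<mu>: "\<mu> \<in> spectrum s" for \<mu>
  proof -
    obtain k where k: "0 < k" "(s - \<mu> *\<^sub>C 1) ^ k * P \<mu> = 0" using nil by blast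
    have Pcom: "(s - \<mu> *\<^sub>C 1) * P \<mu> = P \<mu> * (s - \<mu> *\<^sub>C 1)" using xP by (simp add: ring_distribs)
    have Pk: "P \<mu> ^ k = P \<mu>" using k(1) PP by (induction k) (auto, metis One_nat_def power_0 mult_1_right not_gr_zero)
    have nilp: "((s - \<mu> *\<^sub>C 1) * P \<mu>) ^ k = 0" using power_mult_commute[OF Pcom] Pk k(2) by simp
    show ?thesis
    proof (cases "\<mu> = 0")
      case True
      then have "(s * P \<mu>) ^ k = 0" using nilp by simp
      then show ?thesis using tr_nilpotent[OF socle_mult_right[OF s]] True by simp
    next
      case False
      have "soc_proj s = 0" using s by (simp add: soc_proj_eq_0_iff)
      then have "soc_proj (s - \<mu> *\<^sub>C 1) = cscal (- \<mu>)" by (simp add: cscal_def)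
      then have "cscal (- \<mu>) ^ k * soc_proj (P \<mu>) = 0" using arg_cong[OF k(2), of soc_proj] by simp
      moreover have "cscal (- inverse \<mu>) ^ k * cscal (- \<mu>) ^ k = (1 :: 'a soc_quot)"
        using power_mult_commute[OF cscal_central, of "- inverse \<mu>" "cscal (- \<mu>) :: 'a soc_quot" k] False
        by (simp add: cscal_simps(3) flip: cscal_simps(2))
      ultimately have "soc_proj (P \<mu>) = 0" by (metis mult.assoc mult_1_left mult_zero_right)
      then have P: "P \<mu> \<in> socle" by (simp add: soc_proj_eq_0_iff)
      have "s * P \<mu> = \<mu> *\<^sub>C P \<mu> + (s - \<mu> *\<^sub>C 1) * P \<mu>" by (simp add: left_diff_distrib)
      then have "tr (s * P \<mu>) = \<mu> * tr (P \<mu>) + tr ((s - \<mu> *\<^sub>C 1) * P \<mu>)"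
        using tr_add[OF socle_scaleC[OF P] socle_mult_left[OF P]] tr_scale[OF P] by metis
      also have "tr ((s - \<mu> *\<^sub>C 1) * P \<mu>) = 0" by (rule tr_nilpotent[OF socle_mult_left[OF P] nilp])
      finally show ?thesis
        using riesz_idempotent_eq[OF fin sum1 nil xP \<mu>] idempotent_rank_eq_tr[OF P PP]
        by (simp add: alg_multiplicity_def)
    qed
  qed
  have "tr s = tr (\<Sum>\<mu>\<in>spectrum s. s * P \<mu>)" by (simp add: sum1 flip: sum_distrib_left)
  also have "\<dots> = (\<Sum>\<mu>\<in>spectrum s. tr (s * P \<mu>))" using tr_sum[of _ "\<lambda>\<mu>. s * P \<mu>"] socle_mult_right[OF s] by blast
  also have "\<dots> = soc_trace s" unfolding soc_trace_def by (rule sum.cong) (simp_all add: part)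
  finally show ?thesis ..
qed

end

section \<open>The index\<close>

context socle_trace
begin

text \<open>Meaningful for commuting arguments: their lifts have a commutator in the socle, and its trace does not
depend on the lifts because \<open>tr\<close> vanishes on commutators with elements of the socle. The index is
the value at a class and its Drazin inverse.\<close>

definition comm_tr :: "'a soc_quot \<Rightarrow> 'a soc_quot \<Rightarrow> complex" where
  "comm_tr u v = (let x = (SOME x. soc_proj x = u); y = (SOME y. soc_proj y = v) in tr (x * y - y * x))"

lemma tr_diff: "s \<in> socle \<Longrightarrow> s' \<in> socle \<Longrightarrow> tr (s - s') = tr s - tr s'"
  using tr_add[of "s - s'" s'] socle_diff[of s s'] by simp

lemma comm_tr_soc_proj:
  assumes "soc_proj x * soc_proj y = soc_proj y * soc_proj x"
  shows "comm_tr (soc_proj x) (soc_proj y) = tr (x * y - y * x)"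
proof -
  define x' y' where "x' = (SOME x'. soc_proj x' = soc_proj x)" and "y' = (SOME y'. soc_proj y' = soc_proj y)"
  have "soc_proj x' = soc_proj x" "soc_proj y' = soc_proj y"
    unfolding x'_def y'_def by (rule someI[of _ x], simp) (rule someI[of _ y], simp)
  then have s: "x - x' \<in> socle" "y - y' \<in> socle" by (simp_all flip: soc_proj_eq_iff)
  have "x * y - y * x \<in> socle" using assms by (simp flip: soc_proj_eq_iff)
  moreover have c: "(x - x') * y - y * (x - x') \<in> socle" "x' * (y - y') - (y - y') * x' \<in> socle"
    using s by (simp_all add: socle_diff socle_mult_left socle_mult_right)
  moreover have "tr ((x - x') * y - y * (x - x')) = 0" "tr (x' * (y - y') - (y - y') * x') = 0"
    using s tr_commute by (simp_all add: tr_diff socle_mult_left socle_mult_right)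
  moreover have "x' * y' - y' * x' = (x * y - y * x) - ((x - x') * y - y * (x - x')) - (x' * (y - y') - (y - y') * x')"
    by (simp add: algebra_simps)
  ultimately have "tr (x' * y' - y' * x') = tr (x * y - y * x)"
    by (simp add: tr_diff socle_diff)
  then show ?thesis unfolding comm_tr_def Let_def x'_def y'_def .
qed

lemma comm_tr_add_left:
  assumes "u * w = w * u" "v * w = w * v"
  shows "comm_tr (u + v) w = comm_tr u w + comm_tr v w"
proof -
  obtain x y z where u: "u = soc_proj x" "v = soc_proj y" "w = soc_proj z" by (metis soc_proj_surj)
  have s: "x * z - z * x \<in> socle" "y * z - z * y \<in> socle"
    using assms by (simp_all add: u flip: soc_proj_eq_iff)
  have "comm_tr (u + v) w = comm_tr (soc_proj (x + y)) (soc_proj z)" by (simp add: u)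
  also have "\<dots> = tr ((x + y) * z - z * (x + y))"
    by (rule comm_tr_soc_proj) (use assms in \<open>simp add: u ring_distribs\<close>)
  also have "(x + y) * z - z * (x + y) = (x * z - z * x) + (y * z - z * y)" by (simp add: algebra_simps)
  also have "tr \<dots> = comm_tr u w + comm_tr v w"
    using tr_add[OF s] comm_tr_soc_proj[of x z] comm_tr_soc_proj[of y z] assms by (simp add: u)
  finally show ?thesis .
qed

lemma comm_tr_swap:
  assumes "u * v = v * u"
  shows "comm_tr v u = - comm_tr u v"
proof -
  obtain x y where u: "u = soc_proj x" "v = soc_proj y" by (metis soc_proj_surj)
  have "x * y - y * x \<in> socle" using assms by (simp add: u flip: soc_proj_eq_iff)
  then have "tr (y * x - x * y) = - tr (x * y - y * x)" using tr_diff[of 0 "x * y - y * x"] by simp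
  then show ?thesis using assms comm_tr_soc_proj[of x y] comm_tr_soc_proj[of y x] by (simp add: u)
qed

lemma comm_tr_diff_right:
  assumes "u * v = v * u" "u * w = w * u"
  shows "comm_tr u (v - w) = comm_tr u v - comm_tr u w"
proof -
  have c: "u * (v - w) = (v - w) * u" using assms by (simp add: ring_distribs)
  have "comm_tr v u = comm_tr (v - w) u + comm_tr w u"
    using comm_tr_add_left[of "v - w" u w] c assms by simp
  then have "- comm_tr v u = - comm_tr (v - w) u + - comm_tr w u" by simp
  then have "comm_tr u v = comm_tr u (v - w) + comm_tr u w"
    unfolding comm_tr_swap[OF assms(1)] comm_tr_swap[OF assms(2)] comm_tr_swap[OF c] by simp
  then show ?thesis by simp
qed

lemma comm_tr_0_if_lifts_commute: "x * y = y * x \<Longrightarrow> comm_tr (soc_proj x) (soc_proj y) = 0"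
  using comm_tr_soc_proj[of x y] by (metis diff_self soc_proj_simps(6) tr_zero)

lemma comm_tr_zero_right: "comm_tr u 0 = 0"
proof -
  obtain x where "u = soc_proj x" by (rule soc_proj_surj)
  then show ?thesis using comm_tr_0_if_lifts_commute[of x 0] by simp
qed

lemma comm_tr_cyclic:
  assumes "u * v = v * u" "v * w = w * v" "u * w = w * u"
  shows "comm_tr (u * v) w = comm_tr u (v * w) + comm_tr v (w * u)"
proof -
  obtain x y z where u: "u = soc_proj x" "v = soc_proj y" "w = soc_proj z" by (metis soc_proj_surj)
  have c: "u * v * w = w * (u * v)" "u * (v * w) = v * w * u" "v * (w * u) = w * u * v"
    using assms by (metis mult.assoc)+
  have 1: "comm_tr (u * v) w = tr (x * y * z - z * (x * y))"
    using comm_tr_soc_proj[of "x * y" z] c by (simp add: u)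
  have 2: "comm_tr u (v * w) = tr (x * (y * z) - y * z * x)"
    using comm_tr_soc_proj[of x "y * z"] c by (simp add: u)
  have 3: "comm_tr v (w * u) = tr (y * (z * x) - z * x * y)"
    using comm_tr_soc_proj[of y "z * x"] c by (simp add: u)
  have "x * (y * z) - y * z * x \<in> socle" "y * (z * x) - z * x * y \<in> socle"
    using c by (simp_all add: u flip: soc_proj_eq_iff)
  then have "tr ((x * (y * z) - y * z * x) + (y * (z * x) - z * x * y)) = comm_tr u (v * w) + comm_tr v (w * u)"
    unfolding 2 3 by (rule tr_add)
  moreover have "(x * (y * z) - y * z * x) + (y * (z * x) - z * x * y) = x * y * z - z * (x * y)"
    by (simp add: mult.assoc)
  ultimately show ?thesis using 1 by simp
qed

text \<open>The cyclic identity gives \<open>comm_tr e z = 2 * comm_tr e (e * z)\<close>; for \<open>e * z\<close> in place of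
\<open>z\<close> this says that \<open>comm_tr e (e * z) = 0\<close>.\<close>

lemma comm_tr_idempotent:
  assumes "e * e = e" "e * z = z * e"
  shows "comm_tr e z = 0"
proof -
  have "comm_tr e z = comm_tr e (e * z) + comm_tr e (e * z)"
    using comm_tr_cyclic[of e e z] assms by simp
  moreover have "comm_tr e (e * z) = comm_tr e (e * z) + comm_tr e (e * z)"
    using comm_tr_cyclic[of e e "e * z"] assms by (simp flip: mult.assoc) (simp add: mult.assoc assms)
  ultimately show ?thesis by simp
qed

text \<open>Up to a summand on the complement of \<open>e = a b\<close>, which the pairing does not see, \<open>a + f\<close> is the
product \<open>a (1 + u)\<close> with \<open>u = f b\<close>, and the cyclic identity splits its index into the indices of
\<open>a\<close> and of \<open>1 + u\<close>. The latter is zero: \<open>1 + u\<close> and its inverse are polynomials in \<open>u\<close>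
and lift to commuting elements.\<close>

lemma comm_tr_drazin_add_nilpotent:
  assumes d: "drazin a b" and af: "a * f = f * a" and f: "f ^ n = 0"
  shows "comm_tr (a + f) (b * neumann_sum n (f * b)) = comm_tr a b"
proof -
  define u where "u = f * b"
  define w where "w = neumann_sum n u"
  define e where "e = a * b"
  define g where "g = 1 - e"
  have ab: "a * b = b * a" using d by (simp add: drazin_def)
  have bf: "b * f = f * b" using drazin_commute[OF d af] .
  have un: "u ^ n = 0" unfolding u_def using power_mult_commute[of f b n] bf f by simp
  have ww: "(1 + u) * w = 1" "w * (1 + u) = 1"
    unfolding w_def using neumann_sum_inverse[OF un] by auto
  have ua: "u * a = a * u" and ub: "u * b = b * u" and uf: "u * f = f * u"
    unfolding u_def using ab bf af by (metis mult.assoc)+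
  have wa: "w * a = a * w" and wb: "w * b = b * w" and wf: "w * f = f * w" and wu: "w * u = u * w"
    unfolding w_def using neumann_sum_commute ua ub uf by blast+
  have ee: "e * e = e" unfolding e_def by (rule drazin_idempotent[OF d])
  have eb: "e * b = b" "b * e = b" using drazin_absorb[OF d] by (simp_all add: e_def)
  have ea: "e * a = a * e" unfolding e_def using ab by (metis mult.assoc)
  have ef: "e * f = f * e" unfolding e_def using af bf by (metis mult.assoc)
  have eu: "e * u = u" "u * e = u" unfolding u_def using ef eb by (metis mult.assoc)+
  have ew: "e * w = w * e" unfolding e_def using wa wb by (metis mult.assoc)
  have gg: "g * g = g" unfolding g_def by (simp add: ring_distribs ee)
  have gb: "g * b = 0" "b * g = 0" unfolding g_def by (simp_all add: ring_distribs eb)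
  have gf: "g * f = f * g" unfolding g_def by (simp add: ring_distribs ef)
  have gu: "g * u = 0" "u * g = 0" unfolding g_def by (simp_all add: ring_distribs eu)
  have gw: "g * w = g"
  proof -
    have "g = g * ((1 + u) * w)" by (simp add: ww)
    also have "\<dots> = g * w" by (simp add: ring_distribs gu flip: mult.assoc)
    finally show ?thesis ..
  qed
  have wg: "w * g = g" using gw ew by (simp add: g_def ring_distribs)
  have split: "a + f = a * (1 + u) + f * g"
  proof -
    have "a * u = f * e" unfolding u_def e_def using af by (metis mult.assoc)
    then show ?thesis unfolding g_def by (simp add: distrib_left right_diff_distrib)
  qed
  have c1: "a * (1 + u) * (b * w) = b * w * (a * (1 + u))"
  proof -
    have "(1 + u) * b = b * (1 + u)" "(1 + u) * w = w * (1 + u)"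
      using ub wu by (simp_all add: ring_distribs)
    then have "(b * w) * (1 + u) = (1 + u) * (b * w)" by (metis commute_mult)
    moreover have "(b * w) * a = a * (b * w)" using ab wa by (metis commute_mult)
    ultimately show ?thesis by (metis commute_mult)
  qed
  have c2: "f * g * (b * w) = b * w * (f * g)"
  proof -
    have "f * g * (b * w) = f * (g * b) * w" by (simp add: mult.assoc)
    moreover have "b * w * (f * g) = b * f * (w * g)" using wf by (metis mult.assoc)
    moreover have "b * f * (w * g) = f * (b * g)" unfolding wg bf by (simp add: mult.assoc)
    ultimately show ?thesis by (simp add: gb)
  qed
  have "comm_tr (a + f) (b * w) = comm_tr (a * (1 + u)) (b * w) + comm_tr (f * g) (b * w)"
    unfolding split by (rule comm_tr_add_left[OF c1 c2])
  also have "comm_tr (f * g) (b * w) = comm_tr f (g * (b * w)) + comm_tr g (b * w * f)"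
  proof (rule comm_tr_cyclic)
    show "f * g = g * f" using gf by simp
    have "b * (w * g) = 0" by (simp add: wg gb)
    then show "g * (b * w) = b * w * g" by (simp add: gb mult.assoc flip: mult.assoc[of g b])
    show "f * (b * w) = b * w * f" using bf wf by (metis mult.assoc)
  qed
  also have "g * (b * w) = 0" by (simp add: gb flip: mult.assoc)
  also have "comm_tr g (b * w * f) = 0"
  proof (rule comm_tr_idempotent[OF gg])
    have "b * w * f * g = b * f * (w * g)" using wf by (metis mult.assoc)
    also have "\<dots> = 0" unfolding wg bf by (simp add: gb mult.assoc)
    finally show "g * (b * w * f) = b * w * f * g" by (simp add: gb flip: mult.assoc)
  qed
  also have "comm_tr (a * (1 + u)) (b * w) = comm_tr a ((1 + u) * (b * w)) + comm_tr (1 + u) (b * w * a)"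
  proof (rule comm_tr_cyclic)
    show "a * (1 + u) = (1 + u) * a" using ua by (simp add: ring_distribs)
    show "(1 + u) * (b * w) = b * w * (1 + u)"
      by (rule commute_mult) (use ub wu in \<open>simp_all add: ring_distribs\<close>)
    show "a * (b * w) = b * w * a" using ab wa by (metis mult.assoc)
  qed
  also have "(1 + u) * (b * w) = b"
  proof -
    have "(1 + u) * (b * w) = b * ((1 + u) * w)" using ub by (simp add: ring_distribs flip: mult.assoc)
    then show ?thesis by (simp add: ww)
  qed
  also have "b * w * a = w - g"
  proof -
    have "b * w * a = e * w" unfolding e_def using ab wa by (metis mult.assoc)
    then show ?thesis using gw by (simp add: g_def left_diff_distrib algebra_simps)
  qed
  also have "comm_tr (1 + u) (w - g) = comm_tr (1 + u) w - comm_tr (1 + u) g"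
    by (rule comm_tr_diff_right) (use wu gu in \<open>simp_all add: ring_distribs\<close>)
  also have "comm_tr (1 + u) g = 0"
    using comm_tr_swap[of g "1 + u"] comm_tr_idempotent[OF gg, of "1 + u"] gu by (simp add: ring_distribs)
  also have "comm_tr (1 + u) w = 0"
  proof -
    obtain x where x: "u = soc_proj x" by (rule soc_proj_surj)
    have "(1 + x) * neumann_sum n x = neumann_sum n x * (1 + x)"
      using neumann_sum_commute[of x x n] by (simp add: ring_distribs)
    then show ?thesis
      using comm_tr_0_if_lifts_commute[of "1 + x" "neumann_sum n x"] by (simp add: w_def x soc_proj_neumann_sum)
  qed
  finally show ?thesis by (simp add: comm_tr_zero_right u_def w_def)
qed

lemma b_weyl_iff:
  fixes a :: 'a
  shows "b_weyl a \<longleftrightarrow> (\<exists>d. drazin (soc_proj a) d \<and> comm_tr (soc_proj a) d = 0)"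
proof (cases "b_fredholm a")
  case False
  then show ?thesis unfolding b_weyl_def using b_fredholm_iff by blast
next
  case True
  then obtain d where d: "drazin (soc_proj a) d" unfolding b_fredholm_iff by blast
  define a0 where "a0 = (SOME a0. drazin_inverse quot_socle (quot_map a) (quot_map a0))"
  obtain b where "soc_proj b = d" by (metis soc_proj_surj)
  then have "drazin_inverse quot_socle (quot_map a) (quot_map b)" using d by (simp add: drazin_inverse_quot_iff)
  then have "drazin_inverse quot_socle (quot_map a) (quot_map a0)" unfolding a0_def by (rule someI)
  then have "drazin (soc_proj a) (soc_proj a0)" by (simp add: drazin_inverse_quot_iff)
  then have a0: "soc_proj a0 = d" using drazin_unique d by blast
  have c: "soc_proj a * soc_proj a0 = soc_proj a0 * soc_proj a" using d by (simp add: a0 drazin_def)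
  then have "a * a0 - a0 * a \<in> socle" by (simp flip: soc_proj_eq_iff)
  then have "b_index a = comm_tr (soc_proj a) d"
    unfolding b_index_def Let_def a0_def[symmetric]
    using soc_trace_eq_tr comm_tr_soc_proj[OF c] by (simp add: a0)
  then show ?thesis unfolding b_weyl_def using True d drazin_unique by metis
qed

lemma b_weyl_if_drazin:
  fixes a b :: 'a
  assumes "drazin a b" shows "b_weyl a"
proof -
  have "comm_tr (soc_proj a) (soc_proj b) = 0"
    by (rule comm_tr_0_if_lifts_commute) (use assms in \<open>simp add: drazin_def\<close>)
  then show ?thesis using drazin_soc_proj[OF assms] b_weyl_iff by blast
qed

lemma b_weyl_add_nilpotent:
  fixes x f :: 'a
  assumes xf: "x * f = f * x" and f: "f ^ n \<in> socle" and x: "b_weyl x"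
  shows "b_weyl (x + f)"
proof -
  obtain d where d: "drazin (soc_proj x) d" "comm_tr (soc_proj x) d = 0" using x unfolding b_weyl_iff by blast
  have c: "soc_proj x * soc_proj f = soc_proj f * soc_proj x" using xf by (metis soc_proj_simps(6))
  have n: "soc_proj f ^ n = 0" using f by (simp flip: soc_proj_power add: soc_proj_eq_0_iff)
  show ?thesis
    using drazin_add_nilpotent[OF d(1) c n] comm_tr_drazin_add_nilpotent[OF d(1) c n] d(2)
    unfolding b_weyl_iff by auto
qed

end

lemma spectra_invariant_iff:
  fixes f :: "'a::complex_banach_algebra_1" and \<Phi> :: "'a \<Rightarrow> bool"
  assumes ss: "(jacobson_radical :: 'a set) = {0}"
    and fredholm: "\<And>a. \<Phi> a \<Longrightarrow> b_fredholm a"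
    and drazin: "\<And>a b. drazin a b \<Longrightarrow> \<Phi> a"
    and nilpotent: "\<And>x f n. x * f = f * x \<Longrightarrow> f ^ n \<in> socle \<Longrightarrow> \<Phi> x \<Longrightarrow> \<Phi> (x + f)"
  shows "(\<exists>n. f ^ n \<in> socle) \<longleftrightarrow>
    (\<forall>x. x * f = f * x \<longrightarrow> {\<mu>. \<not> \<Phi> (x + f - \<mu> *\<^sub>C 1)} = {\<mu>. \<not> \<Phi> (x - \<mu> *\<^sub>C 1)})"
proof
  assume "\<exists>n. f ^ n \<in> socle"
  then obtain n where n: "f ^ n \<in> socle" by blast
  have mn: "(- f) ^ n \<in> socle" using power_minus_cases[of f n] n socle_minus by metis
  show "\<forall>x. x * f = f * x \<longrightarrow> {\<mu>. \<not> \<Phi> (x + f - \<mu> *\<^sub>C 1)} = {\<mu>. \<not> \<Phi> (x - \<mu> *\<^sub>C 1)}"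
  proof (intro allI impI)
    fix x assume x: "x * f = f * x"
    have "\<Phi> (x + f - \<mu> *\<^sub>C 1) \<longleftrightarrow> \<Phi> (x - \<mu> *\<^sub>C 1)" for \<mu>
    proof
      assume "\<Phi> (x + f - \<mu> *\<^sub>C 1)"
      moreover have "(x + f - \<mu> *\<^sub>C 1) * (- f) = (- f) * (x + f - \<mu> *\<^sub>C 1)"
        using x by (simp add: algebra_simps)
      ultimately have "\<Phi> (x + f - \<mu> *\<^sub>C 1 + (- f))" using nilpotent mn by blast
      then show "\<Phi> (x - \<mu> *\<^sub>C 1)" by (simp add: algebra_simps)
    next
      assume "\<Phi> (x - \<mu> *\<^sub>C 1)"
      moreover have "(x - \<mu> *\<^sub>C 1) * f = f * (x - \<mu> *\<^sub>C 1)" using x by (simp add: algebra_simps)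
      ultimately have "\<Phi> (x - \<mu> *\<^sub>C 1 + f)" using nilpotent n by blast
      then show "\<Phi> (x + f - \<mu> *\<^sub>C 1)" by (simp add: algebra_simps)
    qed
    then show "{\<mu>. \<not> \<Phi> (x + f - \<mu> *\<^sub>C 1)} = {\<mu>. \<not> \<Phi> (x - \<mu> *\<^sub>C 1)}" by simp
  qed
next
  assume inv: "\<forall>x. x * f = f * x \<longrightarrow> {\<mu>. \<not> \<Phi> (x + f - \<mu> *\<^sub>C 1)} = {\<mu>. \<not> \<Phi> (x - \<mu> *\<^sub>C 1)}"
  show "\<exists>n. f ^ n \<in> socle"
  proof (rule power_in_socle_if_perturbation_invariant[OF ss fredholm drazin])
    show "\<Phi> (x + f - \<mu> *\<^sub>C 1) \<longleftrightarrow> \<Phi> (x - \<mu> *\<^sub>C 1)" if "x * f = f * x" for x \<mu>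
      using inv that by blast
  qed
qed

theorem theorem5p5:
  fixes f :: "'a::complex_banach_algebra_1"
  assumes semisimple: "(jacobson_radical :: 'a set) = {0}"
    and soc_nonzero: "(socle :: 'a set) \<noteq> {0}"
  shows "((\<exists>n. f ^ n \<in> socle) \<longleftrightarrow>
            (\<forall>x. x * f = f * x \<longrightarrow> bf_spectrum (x + f) = bf_spectrum x)) \<and>
         (primitive_algebra TYPE('a) TYPE('v::complex_vector) \<longrightarrow>
            ((\<exists>n. f ^ n \<in> socle) \<longleftrightarrow>
               (\<forall>x. x * f = f * x \<longrightarrow> bw_spectrum (x + f) = bw_spectrum x)))"
proof (intro conjI impI)
  show "(\<exists>n. f ^ n \<in> socle) \<longleftrightarrow>
      (\<forall>x. x * f = f * x \<longrightarrow> bf_spectrum (x + f) = bf_spectrum x)"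
    unfolding bf_spectrum_def
  proof (rule spectra_invariant_iff[OF semisimple])
    show "b_fredholm a" if "drazin a b" for a b :: 'a
      using drazin_soc_proj[OF that] b_fredholm_iff by blast
  qed (auto intro: b_fredholm_add_nilpotent)
next
  assume prim: "primitive_algebra TYPE('a) TYPE('v)"
  have "\<exists>tr :: 'a \<Rightarrow> complex. socle_trace tr"
    by (rule socle_trace_exists[OF semisimple soc_nonzero]) (rule primitive_imp_prime[OF prim])
  then obtain tr :: "'a \<Rightarrow> complex" where "socle_trace tr" by blast
  then interpret socle_trace tr .
  show "(\<exists>n. f ^ n \<in> socle) \<longleftrightarrow>
      (\<forall>x. x * f = f * x \<longrightarrow> bw_spectrum (x + f) = bw_spectrum x)"
    unfolding bw_spectrum_def
  proof (rule spectra_invariant_iff[OF semisimple])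
    show "b_fredholm a" if "b_weyl a" for a :: 'a using that by (simp add: b_weyl_def)
  qed (blast intro: b_weyl_if_drazin b_weyl_add_nilpotent)+
qed

end
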